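(* Fix $0<H<\frac12$, $p\ge 1$, $0<T<\infty$, a sequence $\{\epsilon_k;k\ge1\}$ of positive numbers with $\epsilon_k\downarrow 0$, a standard Brownian motion $B$ and the fractional Brownian motion $B_H=\Lambda_H B$ on $[0,T]$ with Hurst exponent $H$. Let $B^k_H$ ($k\ge1$) be the pure jump approximations of $B_H$ built from the random walks $A^k$ imbedded in $B$ (all defined in the context). For every pair $(\delta,\lambda)$ such that $$\max\Big\{0,1-\frac{pH}{2}\Big\}<\delta<1,\qquad \lambda\in\Big(\frac{1-H}{2},\ \frac12+\frac{2\delta-2}{2p}\Big),$$ there exists a constant $C$, which depends on $p,\delta,H,T,\lambda$, such that $$\mathbb{E}\|B^k_H-B_H\|_\infty^p\le C\,\epsilon_k^{\,p(1-2\lambda)+2(\delta-1)}$$ for every $k\ge1$.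
   Context: Throughout, $0<T<\infty$ is a fixed terminal time and $\|f\|_\infty:=\sup_{0\le t\le T}|f(t)|$. $(\Omega,\mathbb{F},\mathbb{P})$ is a filtered probability space carrying a one-dimensional standard Brownian motion $B$ (continuous paths, $B(0)=0$, defined on $[0,\infty)$), where $\mathbb{F}$ is the usual $\mathbb{P}$-augmentation of the filtration generated by $B$. Fractional Brownian motion (FBM) with Hurst exponent $H\in(0,1)$ is the continuous zero mean Gaussian process with covariance $\mathbb{E}[B_H(t)B_H(s)]=\frac12[s^{2H}+t^{2H}-|t-s|^{2H}]$. Kernels: for $0<H<\frac12$ and $0<s<t$, $$K_{H,1}(t,s):=c_H t^{H-\frac12}s^{\frac12-H}(t-s)^{H-\frac12},\qquad K_{H,2}(t,s):=c_H\Big(\tfrac12-H\Big)s^{\frac12-H}\int_s^t u^{H-\frac32}(u-s)^{H-\frac12}du,$$ and $K_H:=K_{H,1}+K_{H,2}$, where $c_H>0$ is the constant for which $\int_0^tK_H(t,s)\,dB(s)$, $0\le t\le T$, is an FBM with exponent $H$. With $\theta_H(t,s):=\int_1^{t/s}v^{H-\frac32}(v-1)^{H-\frac12}dv$ one has, for $0<s<t$, $$\partial_sK_{H,1}(t,s)=c_H\Big(\tfrac12-H\Big)\Big[t^{H-\frac12}s^{-\frac12-H}(t-s)^{H-\frac12}+t^{H-\frac12}s^{\frac12-H}(t-s)^{H-\frac32}\Big],$$ $$\partial_sK_{H,2}(t,s)=c_H\Big(\tfrac12-H\Big)\Big[-t^{H-\frac12}s^{-\frac12-H}(t-s)^{H-\frac12}+\Big(H-\tfrac12\Big)s^{H-\frac32}\theta_H(t,s)\Big].$$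 Operator $\Lambda_H$: for $f:[0,T]\to\mathbb{R}$ with $f(0)=0$ and Hölder continuous of order $\lambda$ for some $\frac12-H<\lambda<\frac12$, $$(\Lambda_Hf)(t):=\int_0^t[f(t)-f(s)]\,\partial_sK_{H,1}(t,s)\,ds-\int_0^t\partial_sK_{H,2}(t,s)f(s)\,ds,\quad 0\le t\le T.$$ It is applied pathwise to $B$, and $B_H=\Lambda_HB$ is an FBM with exponent $H$. Random walk: $T^k_0:=0$, $T^k_n:=\inf\{T^k_{n-1}<t<\infty;\ |B(t)-B(T^k_{n-1})|=\epsilon_k\}$ for $n\ge1$, and $A^k(t):=\sum_{n\ge1}\big(B(T^k_n)-B(T^k_{n-1})\big)\mathbf{1}_{\{T^k_n\le t\}}$, $t\ge0$. For $t\ge0$: $\bar t_k:=\max\{T^k_n;\ T^k_n\le t\}$, $\bar t^+_k:=\min\{T^k_n;\ \bar t_k<T^k_n\}\wedge T$ (similarly $\bar s_k,\bar s^+_k$ for $s$). Approximation: $$B^k_H(t):=\int_0^{\bar t_k}\partial_sK_{H,1}(\bar t_k,s)\big[A^k(\bar t_k)-A^k(\bar s^+_k)\big]ds-\int_0^{\bar t_k}\partial_sK_{H,2}(\bar t_k,s)A^k(s)\,ds,\quad 0\le t\le T.$$ *)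

theory Defs
  imports "HOL-Probability.Probability"
begin

section \<open>Gaussian processes, Brownian motion, fractional Brownian motion\<close>

definition brownian_motion :: "'a measure \<Rightarrow> (real \<Rightarrow> 'a \<Rightarrow> real) \<Rightarrow> bool" where
  "brownian_motion M B \<longleftrightarrow>
     (\<forall>t\<ge>0. B t \<in> borel_measurable M) \<and>
     (\<forall>\<omega>\<in>space M. B 0 \<omega> = 0 \<and> continuous_on {0..} (\<lambda>t. B t \<omega>)) \<and>
     (\<forall>s t. 0 \<le> s \<and> s < t \<longrightarrow>
        distributed M lborel (\<lambda>\<omega>. B t \<omega> - B s \<omega>) (normal_density 0 (sqrt (t - s)))) \<and>
     (\<forall>n (u :: nat \<Rightarrow> real). 0 \<le> u 0 \<and> (\<forall>i<n. u i \<le> u (Suc i)) \<longrightarrow>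
        prob_space.indep_vars M (\<lambda>_. borel) (\<lambda>i \<omega>. B (u (Suc i)) \<omega> - B (u i) \<omega>) {..<n})"

text \<open>Point masses count as Gaussian.\<close>

definition gaussian_rv :: "'a measure \<Rightarrow> ('a \<Rightarrow> real) \<Rightarrow> bool" where
  "gaussian_rv M X \<longleftrightarrow>
     X \<in> borel_measurable M \<and>
     ((\<exists>m. AE \<omega> in M. X \<omega> = m) \<or>
      (\<exists>m \<sigma>. 0 < \<sigma> \<and> distributed M lborel X (normal_density m \<sigma>)))"

definition gaussian_process :: "'a measure \<Rightarrow> real set \<Rightarrow> (real \<Rightarrow> 'a \<Rightarrow> real) \<Rightarrow> bool" where
  "gaussian_process M I X \<longleftrightarrow>
     (\<forall>J a. finite J \<and> J \<subseteq> I \<longrightarrow> gaussian_rv M (\<lambda>\<omega>. \<Sum>t\<in>J. a t * X t \<omega>))"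

definition fractional_brownian_motion ::
  "'a measure \<Rightarrow> real \<Rightarrow> real \<Rightarrow> (real \<Rightarrow> 'a \<Rightarrow> real) \<Rightarrow> bool" where
  "fractional_brownian_motion M T H X \<longleftrightarrow>
     gaussian_process M {0..T} X \<and>
     (\<forall>\<omega>\<in>space M. continuous_on {0..T} (\<lambda>t. X t \<omega>)) \<and>
     (\<forall>t\<in>{0..T}. (\<integral>\<omega>. X t \<omega> \<partial>M) = 0) \<and>
     (\<forall>s\<in>{0..T}. \<forall>t\<in>{0..T}. (\<integral>\<omega>. X t \<omega> * X s \<omega> \<partial>M) =
        1/2 * (s powr (2 * H) + t powr (2 * H) - \<bar>t - s\<bar> powr (2 * H)))"

section \<open>The Wiener integral\<close>

definition step_fun :: "nat \<Rightarrow> (nat \<Rightarrow> real) \<Rightarrow> (nat \<Rightarrow> real) \<Rightarrow> real \<Rightarrow> real" where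
  "step_fun n u a s = (\<Sum>i<n. a i * indicator {u i<..u (Suc i)} s)"

definition step_integral ::
  "(real \<Rightarrow> 'a \<Rightarrow> real) \<Rightarrow> nat \<Rightarrow> (nat \<Rightarrow> real) \<Rightarrow> (nat \<Rightarrow> real) \<Rightarrow> 'a \<Rightarrow> real" where
  "step_integral B n u a \<omega> = (\<Sum>i<n. a i * (B (u (Suc i)) \<omega> - B (u i) \<omega>))"

text \<open>\<open>wiener_integral M B t f X\<close>: the random variable \<open>X\<close> is a version of the
  stochastic integral of the deterministic integrand \<open>f\<close> with respect to \<open>B\<close> over \<open>[0, t]\<close>, that is,
  the mean square limit of the integrals of step functions converging to \<open>f\<close> in \<open>L\<^sup>2(0, t)\<close>.\<close>

definition wiener_integral ::
  "'a measure \<Rightarrow> (real \<Rightarrow> 'a \<Rightarrow> real) \<Rightarrow> real \<Rightarrow> (real \<Rightarrow> real) \<Rightarrow> ('a \<Rightarrow> real) \<Rightarrow> bool" where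
  "wiener_integral M B t f X \<longleftrightarrow>
     X \<in> borel_measurable M \<and> set_borel_measurable lborel {0<..<t} f \<and>
     (\<exists>(n :: nat \<Rightarrow> nat) (u :: nat \<Rightarrow> nat \<Rightarrow> real) (a :: nat \<Rightarrow> nat \<Rightarrow> real).
        (\<forall>m. 0 \<le> u m 0 \<and> (\<forall>i<n m. u m i \<le> u m (Suc i)) \<and> u m (n m) \<le> t) \<and>
        (\<lambda>m. \<integral>\<^sup>+s\<in>{0<..<t}. ennreal ((f s - step_fun (n m) (u m) (a m) s)\<^sup>2) \<partial>lborel)
          \<longlonglongrightarrow> 0 \<and>
        (\<lambda>m. \<integral>\<^sup>+\<omega>. ennreal ((X \<omega> - step_integral B (n m) (u m) (a m) \<omega>)\<^sup>2) \<partial>M)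
          \<longlonglongrightarrow> 0)"

section \<open>Kernels\<close>

text \<open>The normalising constant is an explicit argument \<open>c\<close>; the kernels are meaningful for
  \<open>0 < s < t\<close> only.\<close>

definition K1 :: "real \<Rightarrow> real \<Rightarrow> real \<Rightarrow> real \<Rightarrow> real" where
  "K1 c H t s = c * t powr (H - 1/2) * s powr (1/2 - H) * (t - s) powr (H - 1/2)"

definition K2 :: "real \<Rightarrow> real \<Rightarrow> real \<Rightarrow> real \<Rightarrow> real" where
  "K2 c H t s = c * (1/2 - H) * s powr (1/2 - H) *
     (LINT u:{s<..<t}|lborel. u powr (H - 3/2) * (u - s) powr (H - 1/2))"

definition dK1 :: "real \<Rightarrow> real \<Rightarrow> real \<Rightarrow> real \<Rightarrow> real" where
  "dK1 c H t s = deriv (\<lambda>r. K1 c H t r) s"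

definition dK2 :: "real \<Rightarrow> real \<Rightarrow> real \<Rightarrow> real \<Rightarrow> real" where
  "dK2 c H t s = deriv (\<lambda>r. K2 c H t r) s"

text \<open>\<open>c\<close> is the constant \<open>c\<^sub>H > 0\<close> for which the Wiener integrals of
  \<open>K\<^sub>H(t, \<cdot>) = K\<^sub>H\<^sub>,\<^sub>1(t, \<cdot>) + K\<^sub>H\<^sub>,\<^sub>2(t, \<cdot>)\<close> over \<open>[0, t]\<close>, for \<open>0 \<le> t \<le> T\<close>, form a fractional Brownian motion.
  Since these integrals are determined only up to null sets, this asks for suitable
  versions \<open>X\<close>.\<close>

definition fbm_constant ::
  "'a measure \<Rightarrow> (real \<Rightarrow> 'a \<Rightarrow> real) \<Rightarrow> real \<Rightarrow> real \<Rightarrow> real \<Rightarrow> bool" where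
  "fbm_constant M B T H c \<longleftrightarrow>
     0 < c \<and>
     (\<exists>X. (\<forall>t\<in>{0..T}. wiener_integral M B t (\<lambda>s. K1 c H t s + K2 c H t s) (X t)) \<and>
          fractional_brownian_motion M T H X)"

text \<open>The operator \<open>\<Lambda>\<^sub>H\<close>; both integrals converge absolutely when \<open>f\<close> is Hoelder continuous of
  order larger than \<open>1/2 - H\<close> and \<open>f 0 = 0\<close>, which holds for almost every Brownian path.\<close>

definition Lam :: "real \<Rightarrow> real \<Rightarrow> (real \<Rightarrow> real) \<Rightarrow> real \<Rightarrow> real" where
  "Lam c H f t =
     (LINT s:{0<..<t}|lborel. (f t - f s) * dK1 c H t s) -
     (LINT s:{0<..<t}|lborel. dK2 c H t s * f s)"

section \<open>The imbedded random walk and the approximation\<close>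

text \<open>All objects are functions of a path \<open>b\<close> and a step size \<open>e\<close>. The times are extended
  reals: a level that is never reached is reached at time \<open>\<infinity>\<close>.\<close>

primrec hit_time :: "real \<Rightarrow> (real \<Rightarrow> real) \<Rightarrow> nat \<Rightarrow> ereal" where
  "hit_time e b 0 = 0"
| "hit_time e b (Suc n) =
     Inf (ereal ` {t. hit_time e b n < ereal t \<and> \<bar>b t - b (real_of_ereal (hit_time e b n))\<bar> = e})"

definition walk :: "real \<Rightarrow> (real \<Rightarrow> real) \<Rightarrow> real \<Rightarrow> real" where
  "walk e b t = (\<Sum>n. if hit_time e b (Suc n) \<le> ereal t
     then b (real_of_ereal (hit_time e b (Suc n))) - b (real_of_ereal (hit_time e b n)) else 0)"

text \<open>For continuous \<open>b\<close>, \<open>e > 0\<close> and \<open>t \<ge> 0\<close> only finitely many hitting times lie in \<open>[0, t]\<close>, so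
  the maximum below exists, and the infimum in \<open>next_time\<close> is a minimum.\<close>

definition last_time :: "real \<Rightarrow> (real \<Rightarrow> real) \<Rightarrow> real \<Rightarrow> real" where
  "last_time e b t = real_of_ereal (Max {\<tau> \<in> range (hit_time e b). \<tau> \<le> ereal t})"

definition next_time :: "real \<Rightarrow> real \<Rightarrow> (real \<Rightarrow> real) \<Rightarrow> real \<Rightarrow> real" where
  "next_time T e b t =
     real_of_ereal (min (Inf {\<tau> \<in> range (hit_time e b). ereal (last_time e b t) < \<tau>}) (ereal T))"

definition fbm_approx ::
  "real \<Rightarrow> real \<Rightarrow> real \<Rightarrow> real \<Rightarrow> (real \<Rightarrow> real) \<Rightarrow> real \<Rightarrow> real" where
  "fbm_approx c H T e b t =
     (LINT s:{0<..<last_time e b t}|lborel. dK1 c H (last_time e b t) s *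
        (walk e b (last_time e b t) - walk e b (next_time T e b s))) -
     (LINT s:{0<..<last_time e b t}|lborel. dK2 c H (last_time e b t) s * walk e b s)"

definition sup_norm :: "real \<Rightarrow> (real \<Rightarrow> real) \<Rightarrow> real" where
  "sup_norm T f = (SUP t\<in>{0..T}. \<bar>f t\<bar>)"

end

(* Everything is controlled path by path. Put r = 1 - 2 lam + 2 (delta - 1) / p, so that 0 < r < H, and let
   L be a Hoelder constant on [0, T] of the Brownian path, of an order kappa < 1/2 close to 1/2.
   The substitution s = t u turns both integrals into integrals over (0, 1) against fixed kernels g1, g2.
   Write t' for the last hitting time before t.
   Freezing the path at hitting times costs at most min (2 eps) (L (t - s)^kappa) at time s, and interpolating this
   minimum gives |approximation(t) - Lam B t'| <= C eps^r L^(1-r).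
   The operator Lam maps kappa-Hoelder paths to r-Hoelder paths, so |Lam B t - Lam B t'| <= C L (t - t')^r.
   The moments of L come from dyadic chaining. For the gaps: if some gap exceeds x, then on a
   grid of mesh x/2 some block has m consecutive small increments, all at most 2 eps; by independence this has
   probability O(x^(-1-m/2) eps^m), whence E (sup gap)^(2rp) <= C eps^(2rp).
   Young's inequality combines the two factors. *)
theory Submission
  imports Defs
begin

text \<open>The Hoelder order has to satisfy kappa - r > 1/2 - H, so that \<open>Lam\<close> can
  pass on order r, and kappa (1 - r) > 1/2 - H, so that the kernels stay integrable against what
  interpolation leaves. The midpoint kappa = 1/2 - (H - r)/2 of the interval (1/2 - (H - r), 1/2)
  meets both because 0 < r < H, and it stays below 1/2, so that L has the moments needed. L and the
  gaps are dependent; Young's inequality separates them with weight eps^(rp), chosen so that both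
  resulting terms have order eps^(rp). Two obstacles remain. C may depend neither on the probability
  space nor on c, so c itself is bounded in terms of H and T, by comparing the variance at time T
  with the L2 norm of the kernel. And a supremum over all times need not be measurable: outside a
  null set the error is right continuous, so countably many times suffice there, and completeness of
  the measure takes care of the null set.\<close>

section \<open>The kernels and their derivatives\<close>

text \<open>Both terms of the product rule contain
  \<open>s powr (- 1/2 - H) * (t - s) powr (H - 3/2)\<close>, and the cofactors add up to (t - s) +
  s = t. The resulting single monomial makes the later substitution s = t u immediate.\<close>

lemma dK1_eq:
  assumes "0 < s" "s < t"
  shows "dK1 c H t s = c * (1/2 - H) * t powr (1/2 + H) * s powr (- 1/2 - H) * (t - s) powr (H - 3/2)"
proof -
  have "((\<lambda>r. K1 c H t r) has_real_derivative
     c * t powr (H - 1/2) * ((1/2 - H) * s powr (1/2 - H - 1)) * (t - s) powr (H - 1/2)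
     + c * t powr (H - 1/2) * s powr (1/2 - H) * ((H - 1/2) * (t - s) powr (H - 1/2 - 1) * (-1))) (at s)"
    unfolding K1_def using assms
    by (auto intro!: derivative_eq_intros simp: algebra_simps powr_diff divide_simps)
  then have "dK1 c H t s = 
     c * t powr (H - 1/2) * ((1/2 - H) * s powr (1/2 - H - 1)) * (t - s) powr (H - 1/2)
     + c * t powr (H - 1/2) * s powr (1/2 - H) * ((H - 1/2) * (t - s) powr (H - 1/2 - 1) * (-1))"
    unfolding dK1_def by (rule DERIV_imp_deriv)
  also have "\<dots> = c * t powr (H - 1/2) * (1/2 - H) * 
      (s powr (1/2 - H - 1) * (t - s) powr (H - 1/2) + s powr (1/2 - H) * (t - s) powr (H - 1/2 - 1))"
    by (simp add: algebra_simps)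
  also have "s powr (1/2 - H - 1) * (t - s) powr (H - 1/2) + s powr (1/2 - H) * (t - s) powr (H - 1/2 - 1)
    = s powr (-1/2 - H) * (t - s) powr (H - 3/2) * ((t - s) + s)"
  proof -
    have 1: "(t - s) powr (H - 1/2) = (t - s) powr (H - 3/2) * (t - s)"
      using assms powr_add[of "t - s" "H - 3/2" 1] by (simp add: field_simps)
    have 2: "s powr (1/2 - H) = s powr (-1/2 - H) * s"
      using assms powr_add[of s "-1/2 - H" 1] by (simp add: field_simps)
    have 3: "1/2 - H - 1 = -1/2 - H" "H - 1/2 - 1 = H - 3/2" by auto
    show ?thesis unfolding 3 1 2 by (simp add: algebra_simps)
  qed
  also have "t powr (1/2 + H) = t powr (H - 1/2) * t"
    using assms powr_add[of t "H - 1/2" 1] by (simp add: add.commute)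
  ultimately show ?thesis using \<open>t powr (1/2 + H) = t powr (H - 1/2) * t\<close> by (simp add: algebra_simps)
qed

definition theta_fun :: "real \<Rightarrow> real \<Rightarrow> real" where
  "theta_fun H v = v powr (H - 3/2) * (v - 1) powr (H - 1/2)"

text \<open>This is theta_H(t, s) as a function of the ratio x = t / s.\<close>

definition theta :: "real \<Rightarrow> real \<Rightarrow> real" where
  "theta H x = (LINT v:{1<..<x}|lborel. theta_fun H v)"

lemma borel_measurable_theta_fun[measurable]: "theta_fun H \<in> borel_measurable borel"
  unfolding theta_fun_def[abs_def] by measurable

lemma theta_fun_nonneg: "0 \<le> theta_fun H v"
  by (simp add: theta_fun_def)

text \<open>The singularity (v - 1)^(H - 1/2) at 1 is integrable because H > 0, and the decay v^(2H
  - 2) at infinity suffices because H < 1/2. Integrability up to infinity yields a bound on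
  \<open>theta H (t / s)\<close> that is uniform as s tends to 0.\<close>

lemma integrable_theta_fun:
  assumes "0 < H" "H < 1/2"
  shows "set_integrable lborel {1..} (theta_fun H)"
proof -
  have A: "set_integrable lborel {1..2} (\<lambda>v. (v - 1) powr (H - 1/2))"
  proof -
    have "(\<lambda>x::real. x powr (H - 1/2)) absolutely_integrable_on {0..1}"
      by (intro nonnegative_absolutely_integrable_1 integrable_on_powr_from_0) (use assms in auto)
    then have "set_integrable lborel {0..1} (\<lambda>x::real. x powr (H - 1/2))"
      unfolding set_integrable_def by (subst (asm) integrable_completion) auto
    from lborel_integrable_real_affine[OF this[unfolded set_integrable_def], of 1 "-1"]
    have "integrable lborel (\<lambda>x. indicator {0..1} (x - 1) *\<^sub>R ((x - 1) powr (H - 1/2)))"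
      by simp
    moreover have "indicator {0..1} (x - 1) = (indicator {1..2} x :: real)" for x :: real
      by (auto simp: indicator_def)
    ultimately show ?thesis unfolding set_integrable_def by simp
  qed
  \<comment> \<open>The factor 2 absorbs 2^(1/2 - H), which appears because v - 1 is at least v/2
    for v >= 2.\<close>
  have B: "set_integrable lborel {2..} (\<lambda>v. 2 * v powr (2 * H - 2))"
  proof -
    have "((\<lambda>v::real. v powr (2 * H - 2)) has_integral -(2 powr (2 * H - 2 + 1)) / (2 * H - 2 + 1)) {2..}"
      by (rule has_integral_powr_to_inf) (use assms in auto)
    then have "(\<lambda>v::real. v powr (2 * H - 2)) absolutely_integrable_on {2..}"
      by (intro nonnegative_absolutely_integrable_1) auto
    then have "set_integrable lborel {2..} (\<lambda>v::real. v powr (2 * H - 2))"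
      unfolding set_integrable_def by (subst (asm) integrable_completion) auto
    then show ?thesis by (rule set_integrable_mult_right) 
  qed
  have "set_integrable lborel {1..2} (theta_fun H)"
  proof (rule set_integrable_bound[OF A])
    show "set_borel_measurable lborel {1..2} (theta_fun H)"
      unfolding set_borel_measurable_def by measurable
    show "AE x in lborel. x \<in> {1..2} \<longrightarrow> norm (theta_fun H x) \<le> norm ((x - 1) powr (H - 1/2))"
    proof (intro AE_I2 impI)
      fix x :: real assume x: "x \<in> {1..2}"
      then have "x powr (H - 3/2) \<le> 1" using assms powr_mono[of "H - 3/2" 0 x] by simp
      then show "norm (theta_fun H x) \<le> norm ((x - 1) powr (H - 1/2))"
        by (auto simp: theta_fun_def abs_mult intro!: mult_left_le_one_le)
    qed
  qed
  moreover have "set_integrable lborel {2..} (theta_fun H)"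
  proof (rule set_integrable_bound[OF B])
    show "set_borel_measurable lborel {2..} (theta_fun H)"
      unfolding set_borel_measurable_def by measurable
    show "AE x in lborel. x \<in> {2..} \<longrightarrow> norm (theta_fun H x) \<le> norm (2 * x powr (2 * H - 2))"
    proof (intro AE_I2 impI)
      fix x :: real assume "x \<in> {2..}"
      then have x: "2 \<le> x" by simp
      have "(x - 1) powr (H - 1/2) \<le> (x / 2) powr (H - 1/2)"
        using x assms by (intro powr_mono2') auto
      also have "\<dots> = x powr (H - 1/2) * 2 powr (1/2 - H)"
        using x by (simp add: powr_divide powr_diff powr_minus field_simps flip: powr_add)
      also have "\<dots> \<le> x powr (H - 1/2) * 2 powr 1"
        using assms by (intro mult_left_mono powr_mono) auto
      finally have "theta_fun H x \<le> x powr (H - 3/2) * (x powr (H - 1/2) * 2)"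
        unfolding theta_fun_def by (intro mult_left_mono) auto
      also have "\<dots> = 2 * x powr (2 * H - 2)"
        using powr_add[of x "H - 3/2" "H - 1/2"] by (simp add: algebra_simps)
      finally show "norm (theta_fun H x) \<le> norm (2 * x powr (2 * H - 2))"
        using theta_fun_nonneg[of H x] by simp
    qed
  qed
  moreover have "{1..} = {1..2} \<union> {2::real..}" by auto
  ultimately show ?thesis
    using set_integrable_Un[of lborel "{1..2}" "theta_fun H" "{2..}"] by simp
qed

lemma integrable_theta_fun_subset:
  assumes "0 < H" "H < 1/2" "A \<subseteq> {1..}" "A \<in> sets borel"
  shows "set_integrable lborel A (theta_fun H)"
  using set_integrable_subset[OF integrable_theta_fun[OF assms(1,2)]] assms(3,4) by simp

lemma integrable_theta_fun_Ioo:
  assumes "0 < H" "H < 1/2"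
  shows "integrable lborel (\<lambda>v. indicator {1<..<x} v *\<^sub>R theta_fun H v)"
proof -
  have "{1<..<x} \<subseteq> {1..}" by auto
  from integrable_theta_fun_subset[OF assms this] show ?thesis by (simp add: set_integrable_def)
qed

lemma theta_nonneg: "0 \<le> theta H x"
  unfolding theta_def set_lebesgue_integral_def
  by (intro Bochner_Integration.integral_nonneg) (auto simp: theta_fun_nonneg)

definition theta_max :: "real \<Rightarrow> real" where
  "theta_max H = (LINT v:{1..}|lborel. theta_fun H v)"

lemma theta_le_max:
  assumes "0 < H" "H < 1/2"
  shows "theta H x \<le> theta_max H"
  unfolding theta_def theta_max_def set_lebesgue_integral_def
proof (rule integral_mono)
  show "integrable lborel (\<lambda>v. indicator {1<..<x} v *\<^sub>R theta_fun H v)"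
    by (rule integrable_theta_fun_Ioo[OF assms])
  show "integrable lborel (\<lambda>v. indicator {1..} v *\<^sub>R theta_fun H v)"
    using integrable_theta_fun[OF assms] by (simp add: set_integrable_def)
qed (auto simp: indicator_def theta_fun_nonneg)

lemma theta_eq_integral:
  assumes "0 < H" "H < 1/2"
  shows "theta H x = integral {1..x} (theta_fun H)"
proof -
  have "set_lebesgue_integral lborel {1<..<x} (theta_fun H) = integral {1<..<x} (theta_fun H)"
    by (rule set_borel_integral_eq_integral) (auto intro!: integrable_theta_fun_subset assms)
  then show ?thesis
    by (simp add: theta_def integral_open_interval_real)
qed

lemma theta_has_derivative:
  assumes "0 < H" "H < 1/2" "1 < x"
  shows "(theta H has_real_derivative theta_fun H x) (at x)"
proof -
  \<comment> \<open>The right end x + 1 keeps x in the interior, so that the derivative within the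
    interval is a two-sided one.\<close>
  have "theta_fun H integrable_on {1..x+1}"
    by (rule set_borel_integral_eq_integral) (auto intro!: integrable_theta_fun_subset assms)
  moreover have "continuous (at x within {1..x+1}) (theta_fun H)"
    unfolding theta_fun_def[abs_def] using assms by (intro continuous_intros) auto
  ultimately have "((\<lambda>u. integral {1..u} (theta_fun H)) has_vector_derivative theta_fun H x) (at x within {1..x+1})"
    using assms integral_has_vector_derivative_continuous_at[of "theta_fun H" 1 "x+1" x "{}"] by auto
  moreover have "theta H = (\<lambda>u. integral {1..u} (theta_fun H))"
    using theta_eq_integral[OF assms(1,2)] by auto
  moreover have "at x within {1..x+1} = at x"
    using assms by (intro at_within_interior) auto
  ultimately show ?thesis
    by (simp add: has_real_derivative_iff_has_vector_derivative)
qed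

text \<open>Nonnegativity of the integrand makes \<open>theta H\<close> monotone, which already
  gives measurability.\<close>

lemma borel_measurable_theta:
  assumes "0 < H" "H < 1/2"
  shows "theta H \<in> borel_measurable borel"
proof -
  have "mono (theta H)"
    unfolding theta_def set_lebesgue_integral_def mono_def
  proof (intro allI impI integral_mono)
    fix x y :: real assume "x \<le> y"
    show "integrable lborel (\<lambda>v. indicator {1<..<x} v *\<^sub>R theta_fun H v)" for x
      by (rule integrable_theta_fun_Ioo[OF assms])
    then show "integrable lborel (\<lambda>v. indicator {1<..<y} v *\<^sub>R theta_fun H v)" .
    show "indicator {1<..<x} v *\<^sub>R theta_fun H v \<le> indicator {1<..<y} v *\<^sub>R theta_fun H v" for v
      using \<open>x \<le> y\<close> by (auto simp: indicator_def theta_fun_nonneg)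
  qed
  then show ?thesis by (rule borel_measurable_mono)
qed

text \<open>Substituting u = s x moves s from the lower limit and the integrand into the argument of
  \<open>theta H\<close>. The derivative in s then needs only the chain rule, not differentiation
  under an integral that is singular at its moving end point.\<close>

lemma K2_eq:
  assumes "0 < s"
  shows "K2 c H t s = c * (1/2 - H) * s powr (H - 1/2) * theta H (t / s)"
proof -
  have "(LINT u:{s<..<t}|lborel. u powr (H - 3/2) * (u - s) powr (H - 1/2))
    = \<bar>s\<bar> *\<^sub>R (LINT x|lborel. indicator {s<..<t} (0 + s * x) *\<^sub>R ((0 + s * x) powr (H - 3/2) * ((0 + s * x) - s) powr (H - 1/2)))"
    unfolding set_lebesgue_integral_def by (rule lborel_integral_real_affine) (use assms in auto)
  also have "(LINT x|lborel. indicator {s<..<t} (0 + s * x) *\<^sub>R ((0 + s * x) powr (H - 3/2) * ((0 + s * x) - s) powr (H - 1/2)))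
     = (LINT x|lborel. s powr (2 * H - 2) * (indicator {1<..<t/s} x *\<^sub>R theta_fun H x))"
  proof (rule Bochner_Integration.integral_cong)
    fix x :: real
    have *: "0 + s * x \<in> {s<..<t} \<longleftrightarrow> x \<in> {1<..<t/s}" using assms by (auto simp: field_simps)
    show "indicator {s<..<t} (0 + s * x) *\<^sub>R ((0 + s * x) powr (H - 3/2) * ((0 + s * x) - s) powr (H - 1/2))
      = s powr (2 * H - 2) * (indicator {1<..<t/s} x *\<^sub>R theta_fun H x)"
    proof (cases "x \<in> {1<..<t/s}")
      case True
      have "s * x - s = s * (x - 1)" by (simp add: algebra_simps)
      then have "(s * x - s) powr (H - 1/2) = s powr (H - 1/2) * (x - 1) powr (H - 1/2)"
        using True assms by (simp add: powr_mult)
      then show ?thesis using True * assms powr_add[of s "H - 3/2" "H - 1/2"]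
        by (simp add: theta_fun_def powr_mult)
    next
      case False
      then show ?thesis using * by simp
    qed
  qed auto
  also have "\<dots> = s powr (2 * H - 2) * theta H (t / s)"
    by (simp add: theta_def set_lebesgue_integral_def)
  finally have "K2 c H t s = c * (1/2 - H) * (s powr (1/2 - H) * s * s powr (2 * H - 2)) * theta H (t / s)"
    using assms by (simp add: K2_def algebra_simps)
  also have "s powr (1/2 - H) * s * s powr (2 * H - 2) = s powr (H - 1/2)"
    using assms powr_add[of s "1/2 - H" 1] powr_add[of s "1/2 - H + 1" "2 * H - 2"] by simp
  finally show ?thesis .
qed

text \<open>The first summand is the chain rule term through \<open>theta H\<close>, the second
  comes from the power s^(H - 1/2). For c > 0 neither summand changes the sign, so
  \<open>dK2\<close> is nonpositive.\<close>

lemma dK2_eq: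
  assumes "0 < H" "H < 1/2" "0 < s" "s < t"
  shows "dK2 c H t s = - (c * (1/2 - H) * (t powr (H - 1/2) * s powr (- 1/2 - H) * (t - s) powr (H - 1/2)
     + (1/2 - H) * s powr (H - 3/2) * theta H (t / s)))"
proof -
  have d: "((\<lambda>r. c * (1/2 - H) * r powr (H - 1/2) * theta H (t / r)) has_real_derivative
     c * (1/2 - H) * ((H - 1/2) * s powr (H - 1/2 - 1)) * theta H (t / s) +
     c * (1/2 - H) * s powr (H - 1/2) * (theta_fun H (t / s) * (- t / s\<^sup>2))) (at s)"
  proof -
    have "1 < t / s" using assms by simp
    note * = DERIV_chain2[where f="theta H" and g="\<lambda>r. t / r" and x=s and s=UNIV, OF theta_has_derivative[OF assms(1,2) this]]
    have "((\<lambda>r. t / r) has_real_derivative (- t / s\<^sup>2)) (at s)"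
      using assms by (auto intro!: derivative_eq_intros simp: power2_eq_square)
    from *[OF this] show ?thesis
      using assms by (auto intro!: derivative_eq_intros)
  qed
  have "dK2 c H t s = deriv (\<lambda>r. c * (1/2 - H) * r powr (H - 1/2) * theta H (t / r)) s"
    unfolding dK2_def
  proof (rule deriv_cong_ev)
    show "\<forall>\<^sub>F x in nhds s. K2 c H t x = c * (1 / 2 - H) * x powr (H - 1 / 2) * theta H (t / x)"
      using eventually_nhds_in_open[of "{0<..}" s] assms(3)
      by (auto elim!: eventually_mono simp: K2_eq)
  qed auto
  also have "\<dots> = c * (1/2 - H) * ((H - 1/2) * s powr (H - 1/2 - 1)) * theta H (t / s) +
     c * (1/2 - H) * s powr (H - 1/2) * (theta_fun H (t / s) * (- t / s\<^sup>2))"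
    using d by (rule DERIV_imp_deriv)
  also have "s powr (H - 1/2 - 1) = s powr (H - 3/2)" by simp
  also have "c * (1/2 - H) * s powr (H - 1/2) * (theta_fun H (t / s) * (- t / s\<^sup>2)) =
     - (c * (1/2 - H) * (s powr (H - 1/2) * theta_fun H (t / s) * t / s\<^sup>2))" by simp
  also have "s powr (H - 1/2) * theta_fun H (t / s) * t / s\<^sup>2 = t powr (H - 1/2) * s powr (- 1/2 - H) * (t - s) powr (H - 1/2)"
  proof -
    have 1: "t / s - 1 = (t - s) / s" using assms by (simp add: field_simps)
    have "s powr (H - 1/2) * theta_fun H (t / s) * t / s\<^sup>2 =
      (t powr (H - 3/2) * t) * (t - s) powr (H - 1/2) * (s powr (H - 1/2) / s powr (H - 3/2) / s powr (H - 1/2) / s powr 2)"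
      unfolding theta_fun_def 1 using assms by (simp add: powr_divide powr_numeral field_simps)
    also have "t powr (H - 3/2) * t = t powr (H - 1/2)"
      using assms powr_add[of t "H - 3/2" 1] by simp
    also have "s powr (H - 1/2) / s powr (H - 3/2) / s powr (H - 1/2) / s powr 2 = s powr (- 1/2 - H)"
      unfolding powr_diff[symmetric] by (rule arg_cong[where f="\<lambda>x. s powr x"]) simp
    finally show ?thesis by simp
  qed
  finally show ?thesis by (simp add: algebra_simps)
qed

section \<open>Homogeneity of the kernels and reduction to the unit interval\<close>

definition g1 :: "real \<Rightarrow> real \<Rightarrow> real" where
  "g1 H u = (1/2 - H) * (u powr (- 1/2 - H) * (1 - u) powr (H - 3/2))"

text \<open>\<open>g1\<close> and \<open>g2\<close> are \<open>dK1\<close> and minus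
  \<open>dK2\<close> at s = t u, divided by c t^(H - 3/2). The sign is reversed in \<open>g2\<close>
  so that both kernels are nonnegative for H < 1/2.\<close>

definition g2 :: "real \<Rightarrow> real \<Rightarrow> real" where
  "g2 H u = (1/2 - H) * (u powr (- 1/2 - H) * (1 - u) powr (H - 1/2)
     + (1/2 - H) * (u powr (H - 3/2) * theta H (1 / u)))"

lemma g1_nonneg: "H < 1/2 \<Longrightarrow> 0 \<le> g1 H u"
  by (simp add: g1_def)

lemma g2_nonneg: "H < 1/2 \<Longrightarrow> 0 \<le> g2 H u"
  by (simp add: g2_def theta_nonneg)

lemma borel_measurable_g1[measurable]: "g1 H \<in> borel_measurable borel"
  unfolding g1_def[abs_def] by measurable

lemma borel_measurable_g2:
  assumes "0 < H" "H < 1/2"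
  shows "g2 H \<in> borel_measurable borel"
  using borel_measurable_theta[OF assms] unfolding g2_def[abs_def] by measurable

lemma dK1_scale:
  assumes "0 < t" "0 < u" "u < 1"
  shows "dK1 c H t (t * u) = c * t powr (H - 3/2) * g1 H u"
proof -
  have "t * u < t" "0 < t * u" using assms by auto
  then have "dK1 c H t (t * u) = c * (1/2 - H) * t powr (1/2 + H) * (t * u) powr (- 1/2 - H) * (t - t * u) powr (H - 3/2)"
    by (intro dK1_eq) auto
  also have "t - t * u = t * (1 - u)" by (simp add: algebra_simps)
  also have "c * (1/2 - H) * t powr (1/2 + H) * (t * u) powr (- 1/2 - H) * (t * (1 - u)) powr (H - 3/2)
     = c * (t powr (1/2 + H) * t powr (- 1/2 - H) * t powr (H - 3/2)) * g1 H u"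
    using assms by (simp add: g1_def powr_mult)
  also have "t powr (1/2 + H) * t powr (- 1/2 - H) * t powr (H - 3/2) = t powr (H - 3/2)"
    using assms by (simp flip: powr_add)
  finally show ?thesis .
qed

lemma dK2_scale:
  assumes "0 < H" "H < 1/2" "0 < t" "0 < u" "u < 1"
  shows "dK2 c H t (t * u) = - (c * t powr (H - 3/2) * g2 H u)"
proof -
  have "t * u < t" "0 < t * u" using assms by auto
  then have "dK2 c H t (t * u) = - (c * (1/2 - H) * (t powr (H - 1/2) * (t * u) powr (- 1/2 - H) * (t - t * u) powr (H - 1/2)
     + (1/2 - H) * (t * u) powr (H - 3/2) * theta H (t / (t * u))))"
    using assms by (intro dK2_eq) auto
  also have "t - t * u = t * (1 - u)" by (simp add: algebra_simps)
  also have "t powr (H - 1/2) * (t * u) powr (- 1/2 - H) * (t * (1 - u)) powr (H - 1/2)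
    = (t powr (H - 1/2) * t powr (- 1/2 - H) * t powr (H - 1/2)) * (u powr (- 1/2 - H) * (1 - u) powr (H - 1/2))"
    using assms by (simp add: powr_mult)
  also have "t powr (H - 1/2) * t powr (- 1/2 - H) * t powr (H - 1/2) = t powr (H - 3/2)"
    unfolding powr_add[symmetric] by simp
  also have "t / (t * u) = 1 / u" using assms by simp
  also have "(t * u) powr (H - 3/2) = t powr (H - 3/2) * u powr (H - 3/2)"
    using assms by (simp add: powr_mult)
  finally show ?thesis by (simp add: g2_def algebra_simps)
qed

lemma set_integral_scale_unit:
  fixes F :: "real \<Rightarrow> real"
  assumes "0 < t"
  shows "(LINT s:{0<..<t}|lborel. F s) = t * (LINT u:{0<..<1}|lborel. F (t * u))"
proof -
  have "(LINT s:{0<..<t}|lborel. F s) = \<bar>t\<bar> *\<^sub>R (LINT u|lborel. indicator {0<..<t} (0 + t * u) *\<^sub>R F (0 + t * u))"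
    unfolding set_lebesgue_integral_def by (rule lborel_integral_real_affine) (use assms in auto)
  also have "(LINT u|lborel. indicator {0<..<t} (0 + t * u) *\<^sub>R F (0 + t * u)) = (LINT u:{0<..<1}|lborel. F (t * u))"
    unfolding set_lebesgue_integral_def
    by (rule Bochner_Integration.integral_cong) (use assms in \<open>auto simp: indicator_def zero_less_mult_iff\<close>)
  finally show ?thesis using assms by simp
qed

definition J1 :: "real \<Rightarrow> (real \<Rightarrow> real) \<Rightarrow> real" where
  "J1 H F = (LINT u:{0<..<1}|lborel. F u * g1 H u)"

definition J2 :: "real \<Rightarrow> (real \<Rightarrow> real) \<Rightarrow> real" where
  "J2 H F = (LINT u:{0<..<1}|lborel. F u * g2 H u)"

lemma integral_dK1_scale:
  assumes "0 < t"
  shows "(LINT s:{0<..<t}|lborel. dK1 c H t s * F s) = c * t powr (H - 1/2) * J1 H (\<lambda>u. F (t * u))"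
proof -
  have "(LINT s:{0<..<t}|lborel. dK1 c H t s * F s) = t * (LINT u:{0<..<1}|lborel. dK1 c H t (t * u) * F (t * u))"
    by (rule set_integral_scale_unit[OF assms])
  also have "(LINT u:{0<..<1}|lborel. dK1 c H t (t * u) * F (t * u)) =
     (LINT u:{0<..<1}|lborel. (c * t powr (H - 3/2)) * (F (t * u) * g1 H u))"
    by (intro set_lebesgue_integral_cong) (auto simp: dK1_scale assms)
  also have "\<dots> = (c * t powr (H - 3/2)) * J1 H (\<lambda>u. F (t * u))"
    unfolding J1_def by simp
  also have "t * (c * t powr (H - 3/2) * J1 H (\<lambda>u. F (t * u))) = c * (t powr 1 * t powr (H - 3/2)) * J1 H (\<lambda>u. F (t * u))"
    using assms by simp
  also have "t powr 1 * t powr (H - 3/2) = t powr (H - 1/2)" unfolding powr_add[symmetric] by simp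
  finally show ?thesis .
qed

lemma integral_dK2_scale:
  assumes "0 < H" "H < 1/2" "0 < t"
  shows "(LINT s:{0<..<t}|lborel. dK2 c H t s * F s) = - (c * t powr (H - 1/2) * J2 H (\<lambda>u. F (t * u)))"
proof -
  have "(LINT s:{0<..<t}|lborel. dK2 c H t s * F s) = t * (LINT u:{0<..<1}|lborel. dK2 c H t (t * u) * F (t * u))"
    by (rule set_integral_scale_unit[OF assms(3)])
  also have "(LINT u:{0<..<1}|lborel. dK2 c H t (t * u) * F (t * u)) =
     (LINT u:{0<..<1}|lborel. (- (c * t powr (H - 3/2))) * (F (t * u) * g2 H u))"
    by (intro set_lebesgue_integral_cong) (auto simp: dK2_scale[OF assms] simp del: mult_minus_left)
  also have "\<dots> = (- (c * t powr (H - 3/2))) * J2 H (\<lambda>u. F (t * u))"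
    unfolding J2_def by (rule set_integral_mult_right)
  also have "t * (- (c * t powr (H - 3/2)) * J2 H (\<lambda>u. F (t * u))) = - (c * (t powr 1 * t powr (H - 3/2)) * J2 H (\<lambda>u. F (t * u)))"
    using assms by simp
  also have "t powr 1 * t powr (H - 3/2) = t powr (H - 1/2)" unfolding powr_add[symmetric] by simp
  finally show ?thesis .
qed

text \<open>After rescaling, t enters only through the prefactor and through the path evaluated at t
  and t u. Values of \<open>Lam\<close> at two times thus become integrals over the same interval
  with the same kernels, and their difference can be estimated under one integral.\<close>

lemma Lam_scale:
  assumes "0 < H" "H < 1/2" "0 < t"
  shows "Lam c H f t = c * t powr (H - 1/2) * (J1 H (\<lambda>u. f t - f (t * u)) + J2 H (\<lambda>u. f (t * u)))"
  unfolding Lam_def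
  by (subst mult.commute, subst integral_dK1_scale[OF assms(3)], subst integral_dK2_scale[OF assms])
     (simp add: algebra_simps)

lemma Lam_0 [simp]: "Lam c H f 0 = 0"
  by (simp add: Lam_def set_lebesgue_integral_def)

section \<open>Integrability of the rescaled kernels against Hoelder weights\<close>

lemma set_integrable_Beta:
  fixes x y :: real
  assumes "-1 < x" "-1 < y"
  shows "set_integrable lborel {0<..<1} (\<lambda>u. u powr x * (1 - u) powr y)"
proof -
  have "((\<lambda>u. u powr (x + 1 - 1) * (1 - u) powr (y + 1 - 1)) has_integral Beta (x + 1) (y + 1)) {0..1}"
    by (rule has_integral_Beta_real) (use assms in auto)
  then have "(\<lambda>u. u powr x * (1 - u) powr y) integrable_on {0<..<1}"
    by (auto simp: integrable_on_def has_integral_Icc_iff_Ioo)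
  then have "(\<lambda>u. u powr x * (1 - u) powr y) absolutely_integrable_on {0<..<1}"
    by (intro nonnegative_absolutely_integrable_1) auto
  then show ?thesis
    unfolding set_integrable_def by (subst (asm) integrable_completion) auto
qed

text \<open>The weight has to cancel the singularity (1 - u)^(H - 3/2): the sum of the exponents
  exceeds -1 exactly when \<mu> > 1/2 - H. At u = 0 the exponent -1/2 - H exceeds -1 because H <
  1/2.\<close>

lemma set_integrable_g1:
  assumes "0 < H" "H < 1/2" "1/2 - H < \<mu>"
  shows "set_integrable lborel {0<..<1} (\<lambda>u. (1 - u) powr \<mu> * g1 H u)"
proof -
  have "set_integrable lborel {0<..<1} (\<lambda>u. (1/2 - H) * (u powr (- 1/2 - H) * (1 - u) powr (H - 3/2 + \<mu>)))"
    by (rule set_integrable_mult_right) (auto intro!: set_integrable_Beta simp: assms, (use assms in argo)+)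
  also have "(\<lambda>u. (1/2 - H) * (u powr (- 1/2 - H) * (1 - u) powr (H - 3/2 + \<mu>))) = (\<lambda>u. (1 - u) powr \<mu> * g1 H u)"
    by (auto simp: g1_def powr_add)
  finally show ?thesis .
qed

text \<open>Since \<open>theta H\<close> is bounded, the critical term is u^(H - 3/2) at 0, again
  tamed exactly when \<mu> > 1/2 - H. The singularity u^(- 1/2 - H) of the other term is milder and
  is covered by the same condition.\<close>

lemma set_integrable_g2:
  assumes "0 < H" "H < 1/2" "1/2 - H < \<mu>"
  shows "set_integrable lborel {0<..<1} (\<lambda>u. u powr \<mu> * g2 H u)"
proof -
  have 1: "set_integrable lborel {0<..<1} (\<lambda>u. (1/2 - H) * (u powr (\<mu> - 1/2 - H) * (1 - u) powr (H - 1/2)))"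
    by (rule set_integrable_mult_right) (use assms in \<open>auto intro!: set_integrable_Beta\<close>)
  \<comment> \<open>The factor \<open>(1 - u) powr 0\<close> is 1 on the open interval; it gives the
    integrand the Beta shape.\<close>
  have 2: "set_integrable lborel {0<..<1} (\<lambda>u. (1/2 - H)\<^sup>2 * theta_max H * (u powr (\<mu> + H - 3/2) * (1 - u) powr 0))"
    by (intro set_integrable_mult_right set_integrable_Beta) (use assms in auto)
  have 2: "set_integrable lborel {0<..<1} (\<lambda>u. (1/2 - H)\<^sup>2 * (u powr (\<mu> + H - 3/2) * theta H (1 / u)))"
  proof (rule set_integrable_bound[OF 2])
    show "set_borel_measurable lborel {0<..<1} (\<lambda>u. (1/2 - H)\<^sup>2 * (u powr (\<mu> + H - 3/2) * theta H (1 / u)))"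
      unfolding set_borel_measurable_def using borel_measurable_theta[OF assms(1,2)] by measurable
    have "0 \<le> theta_max H" using theta_nonneg[of H 0] theta_le_max[OF assms(1,2), of 0] by simp
    then show "AE x in lborel. x \<in> {0<..<1} \<longrightarrow>
          norm ((1/2 - H)\<^sup>2 * (x powr (\<mu> + H - 3/2) * theta H (1 / x)))
          \<le> norm ((1/2 - H)\<^sup>2 * theta_max H * (x powr (\<mu> + H - 3/2) * (1 - x) powr 0))"
      using theta_le_max[OF assms(1,2)]
      by (intro AE_I2) (auto simp: theta_nonneg abs_mult mult_ac intro!: mult_left_mono mult_right_mono)
  qed
  have alg: "k * (m * p * q) + k\<^sup>2 * (m * w * th) = m * (k * (p * q + k * (w * th)))" for k m p q w th :: real
    by (simp add: algebra_simps power2_eq_square)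
  have A: "set_integrable lborel {0<..<1} (\<lambda>u. (1/2 - H) * (u powr (\<mu> - 1/2 - H) * (1 - u) powr (H - 1/2)) +
     (1/2 - H)\<^sup>2 * (u powr (\<mu> + H - 3/2) * theta H (1 / u)))"
    by (rule set_integral_add(1)[OF 1 2])
  have eq: "(\<lambda>u. (1/2 - H) * (u powr (\<mu> - 1/2 - H) * (1 - u) powr (H - 1/2)) +
     (1/2 - H)\<^sup>2 * (u powr (\<mu> + H - 3/2) * theta H (1 / u))) = (\<lambda>u. u powr \<mu> * g2 H u)"
  proof
    fix u :: real
    have "u powr (\<mu> - 1/2 - H) = u powr \<mu> * u powr (- 1/2 - H)" "u powr (\<mu> + H - 3/2) = u powr \<mu> * u powr (H - 3/2)"
      by (simp_all flip: powr_add add: algebra_simps)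
    note * = this
    show "(1/2 - H) * (u powr (\<mu> - 1/2 - H) * (1 - u) powr (H - 1/2)) +
     (1/2 - H)\<^sup>2 * (u powr (\<mu> + H - 3/2) * theta H (1 / u)) = u powr \<mu> * g2 H u"
      unfolding g2_def * by (rule alg)
  qed
  show ?thesis using A unfolding eq .
qed

text \<open>The constant Q is kept explicit because it will be path dependent, containing the
  Hoelder constant, and has to pass through the integrals linearly.\<close>

lemma set_integral_weighted_bound:
  fixes F w g :: "real \<Rightarrow> real"
  assumes "set_integrable lborel A (\<lambda>u. w u * g u)"
    and "set_borel_measurable lborel A F" "g \<in> borel_measurable borel"
    and "\<And>u. u \<in> A \<Longrightarrow> \<bar>F u\<bar> \<le> Q * w u" "\<And>u. 0 \<le> g u"
  shows "set_integrable lborel A (\<lambda>u. F u * g u)"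
    and "\<bar>LINT u:A|lborel. F u * g u\<bar> \<le> Q * (LINT u:A|lborel. w u * g u)"
proof -
  have 1: "set_integrable lborel A (\<lambda>u. Q * (w u * g u))"
    by (rule set_integrable_mult_right) (use assms in auto)
  have le: "\<bar>F u * g u\<bar> \<le> Q * (w u * g u)" if "u \<in> A" for u
    using mult_right_mono[OF assms(4)[OF that] assms(5)[of u]] assms(5)[of u] by (simp add: abs_mult)
  show *: "set_integrable lborel A (\<lambda>u. F u * g u)"
  proof (rule set_integrable_bound[OF 1])
    have "(\<lambda>u. (indicator A u *\<^sub>R F u) * g u) \<in> borel_measurable lborel"
      using assms(2,3) unfolding set_borel_measurable_def by measurable
    then show "set_borel_measurable lborel A (\<lambda>u. F u * g u)"
      unfolding set_borel_measurable_def by (simp add: mult.assoc)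
    show "AE x in lborel. x \<in> A \<longrightarrow> norm (F x * g x) \<le> norm (Q * (w x * g x))"
    proof (intro AE_I2 impI)
      fix x assume "x \<in> A"
      from le[OF this] show "norm (F x * g x) \<le> norm (Q * (w x * g x))" by simp
    qed
  qed
  have "\<bar>LINT u:A|lborel. F u * g u\<bar> \<le> (LINT u:A|lborel. \<bar>F u * g u\<bar>)"
    using set_integral_norm_bound[OF *] by simp
  also have "\<dots> \<le> (LINT u:A|lborel. Q * (w u * g u))"
    by (rule set_integral_mono) (use * 1 le in \<open>auto intro!: set_integrable_abs\<close>)
  finally show "\<bar>LINT u:A|lborel. F u * g u\<bar> \<le> Q * (LINT u:A|lborel. w u * g u)" by simp
qed

text \<open>\<open>N1\<close> and \<open>N2\<close> act as the norms of \<open>J1\<close> and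
  \<open>J2\<close> on functions dominated by \<open>(1 - u) powr \<mu>\<close> and by
  \<open>u powr \<mu>\<close>; the pathwise constants below are built from them.\<close>

definition N1 :: "real \<Rightarrow> real \<Rightarrow> real" where "N1 H \<mu> = J1 H (\<lambda>u. (1 - u) powr \<mu>)"
definition N2 :: "real \<Rightarrow> real \<Rightarrow> real" where "N2 H \<mu> = J2 H (\<lambda>u. u powr \<mu>)"

context
  fixes H \<mu> :: real
  assumes H: "0 < H" "H < 1/2" "1/2 - H < \<mu>"
begin

lemma N1_nonneg: "0 \<le> N1 H \<mu>"
  unfolding N1_def J1_def set_lebesgue_integral_def using H
  by (intro Bochner_Integration.integral_nonneg) (auto simp: g1_nonneg)

lemma N2_nonneg: "0 \<le> N2 H \<mu>"
  unfolding N2_def J2_def set_lebesgue_integral_def using H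
  by (intro Bochner_Integration.integral_nonneg) (auto simp: g2_nonneg)

lemma J1_bound:
  assumes "set_borel_measurable lborel {0<..<1} F" "\<And>u. 0 < u \<Longrightarrow> u < 1 \<Longrightarrow> \<bar>F u\<bar> \<le> Q * (1 - u) powr \<mu>"
  shows "set_integrable lborel {0<..<1} (\<lambda>u. F u * g1 H u)" "\<bar>J1 H F\<bar> \<le> Q * N1 H \<mu>"
  unfolding J1_def N1_def
  using set_integral_weighted_bound[OF set_integrable_g1[OF H] assms(1) borel_measurable_g1, of Q] assms(2) H
  by (auto simp: g1_nonneg)

lemma J2_bound:
  assumes "set_borel_measurable lborel {0<..<1} F" "\<And>u. 0 < u \<Longrightarrow> u < 1 \<Longrightarrow> \<bar>F u\<bar> \<le> Q * u powr \<mu>"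
  shows "set_integrable lborel {0<..<1} (\<lambda>u. F u * g2 H u)" "\<bar>J2 H F\<bar> \<le> Q * N2 H \<mu>"
  unfolding J2_def N2_def
  using set_integral_weighted_bound[OF set_integrable_g2[OF H] assms(1) borel_measurable_g2[OF H(1,2)], of Q] assms(2) H
  by (auto simp: g2_nonneg)

end

lemma J1_add:
  assumes "set_integrable lborel {0<..<1} (\<lambda>u. F u * g1 H u)" "set_integrable lborel {0<..<1} (\<lambda>u. G u * g1 H u)"
  shows "J1 H (\<lambda>u. F u + G u) = J1 H F + J1 H G"
  unfolding J1_def using set_integral_add(2)[OF assms] by (simp add: algebra_simps)

lemma J2_add:
  assumes "set_integrable lborel {0<..<1} (\<lambda>u. F u * g2 H u)" "set_integrable lborel {0<..<1} (\<lambda>u. G u * g2 H u)"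
  shows "J2 H (\<lambda>u. F u + G u) = J2 H F + J2 H G"
  unfolding J2_def using set_integral_add(2)[OF assms] by (simp add: algebra_simps)

lemma J1_cmult: "J1 H (\<lambda>u. k * F u) = k * J1 H F"
  unfolding J1_def by (simp add: mult.assoc)

lemma J2_cmult: "J2 H (\<lambda>u. k * F u) = k * J2 H F"
  unfolding J2_def by (simp add: mult.assoc)

section \<open>Hitting times of a continuous path\<close>

declare hit_time.simps(2) [simp del]

context
  fixes b :: "real \<Rightarrow> real" and e :: real
  assumes cont: "continuous_on {0..} b" and e: "0 < e"
begin

lemma hit_time_Suc_infinity: "hit_time e b n = \<infinity> \<Longrightarrow> hit_time e b (Suc n) = \<infinity>"
  by (simp add: top_ereal_def hit_time.simps)

text \<open>The condition t > x is open, but e > 0 excludes t = x from the level set, so the set of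
  candidate times is closed and its infimum is attained. An empty set gives infinity. This dichotomy
  replaces the recursion equation from here on.\<close>

lemma hit_time_Suc_cases:
  assumes "hit_time e b n = ereal x" "0 \<le> x"
  shows "(hit_time e b (Suc n) = \<infinity> \<and> (\<forall>t>x. \<bar>b t - b x\<bar> \<noteq> e)) \<or>
    (\<exists>y>x. hit_time e b (Suc n) = ereal y \<and> \<bar>b y - b x\<bar> = e \<and> (\<forall>t>x. \<bar>b t - b x\<bar> = e \<longrightarrow> y \<le> t))"
proof -
  define S where "S = {t. x < t \<and> \<bar>b t - b x\<bar> = e}"
  have h: "hit_time e b (Suc n) = Inf (ereal ` S)"
    by (simp only: hit_time.simps(2) assms(1) S_def less_ereal.simps(1) real_of_ereal.simps(1))
  show ?thesis
  proof (cases "S = {}")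
    case True
    then have "hit_time e b (Suc n) = \<infinity>" unfolding h by (simp add: top_ereal_def)
    moreover have "\<forall>t>x. \<bar>b t - b x\<bar> \<noteq> e" using True unfolding S_def by blast
    ultimately show ?thesis by blast
  next
    case False
    have "S = {t \<in> {x..}. \<bar>b t - b x\<bar> = e}"
      using e by (auto simp: S_def order_less_le)
    moreover have "continuous_on {x..} b"
      using assms by (intro continuous_on_subset[OF cont]) auto
    then have "continuous_on {x..} (\<lambda>t. \<bar>b t - b x\<bar>)"
      by (intro continuous_intros)
    then have "closed {t \<in> {x..}. \<bar>b t - b x\<bar> = e}"
      by (intro continuous_closed_preimage_constant) auto
    ultimately have "closed S" by simp
    moreover have bdd: "bdd_below S" by (auto simp: S_def bdd_below_def intro!: exI[of _ x])
    ultimately have inS: "Inf S \<in> S" using False by (intro closed_contains_Inf)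
    moreover have "Inf (ereal ` S) = ereal (Inf S)"
      using inS cInf_lower[OF _ bdd]
      by (intro antisym Inf_greatest) (auto intro!: Inf_lower)
    ultimately have "hit_time e b (Suc n) = ereal (Inf S)" "x < Inf S" "\<bar>b (Inf S) - b x\<bar> = e"
      unfolding h by (simp_all add: S_def)
    moreover have "\<forall>t>x. \<bar>b t - b x\<bar> = e \<longrightarrow> Inf S \<le> t"
      using cInf_lower[OF _ bdd] by (simp add: S_def)
    ultimately show ?thesis by blast
  qed
qed

lemma hit_time_nonneg_cases: "hit_time e b n = \<infinity> \<or> (\<exists>x\<ge>0. hit_time e b n = ereal x)"
proof (induction n)
  case 0
  then show ?case by (auto simp: zero_ereal_def)
next
  case (Suc n)
  then show ?case
  proof (elim disjE exE conjE)
    fix x assume "0 \<le> x" "hit_time e b n = ereal x"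
    from hit_time_Suc_cases[OF this(2,1)] this(1) show ?thesis by (elim disjE exE conjE) auto
  qed (use hit_time_Suc_infinity in blast)
qed

lemma hit_time_less_Suc: "hit_time e b n \<noteq> \<infinity> \<Longrightarrow> hit_time e b n < hit_time e b (Suc n)"
  using hit_time_nonneg_cases[of n] hit_time_Suc_cases[of n] by fastforce

lemma hit_time_mono: "n \<le> m \<Longrightarrow> hit_time e b n \<le> hit_time e b m"
proof (rule lift_Suc_mono_le[of "hit_time e b"])
  show "hit_time e b n \<le> hit_time e b (Suc n)" for n
    using hit_time_less_Suc[of n] hit_time_Suc_infinity[of n] by (cases "hit_time e b n = \<infinity>") auto
qed

text \<open>The distance from b x starts at 0 and is continuous; a value of at least e at time s
  would force the exact value e somewhere in (x, s], and the next hit would come no later than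
  s.\<close>

lemma abs_diff_less_before_hit:
  assumes "hit_time e b n = ereal x" "0 \<le> x" "x \<le> s" "ereal s < hit_time e b (Suc n)"
  shows "\<bar>b s - b x\<bar> < e"
proof (rule ccontr)
  assume "\<not> ?thesis"
  moreover have "continuous_on {x..s} b"
    using assms by (intro continuous_on_subset[OF cont]) auto
  then have "continuous_on {x..s} (\<lambda>t. \<bar>b t - b x\<bar>)"
    by (intro continuous_intros)
  ultimately have "\<exists>t. x \<le> t \<and> t \<le> s \<and> \<bar>b t - b x\<bar> = e"
    using assms e by (intro IVT') auto
  then obtain t where t: "x \<le> t" "t \<le> s" "\<bar>b t - b x\<bar> = e" by blast
  then have "x < t" using e by (cases "x = t") auto
  with t hit_time_Suc_cases[OF assms(1,2)] assms(4) show False by force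
qed

text \<open>A bounded increasing sequence of hitting times would converge, and continuity at the
  limit would make consecutive path values merge, although they differ by exactly e.\<close>

lemma hit_time_unbounded: "\<exists>n. ereal t < hit_time e b n"
proof (rule ccontr)
  assume "\<not> ?thesis"
  then have le: "hit_time e b n \<le> ereal t" for n by (simp add: not_less)
  define x where "x n = real_of_ereal (hit_time e b n)" for n
  have x: "hit_time e b n = ereal (x n)" "0 \<le> x n" for n
    using hit_time_nonneg_cases[of n] le[of n] by (auto simp: x_def)
  have "incseq x"
    unfolding incseq_def
  proof (intro allI impI)
    fix m n :: nat assume "m \<le> n"
    from hit_time_mono[OF this] show "x m \<le> x n" by (simp only: x ereal_less_eq)
  qed
  moreover have xt: "x n \<le> t" for n using le[of n] by (simp only: x ereal_less_eq)
  ultimately obtain l where l: "x \<longlonglongrightarrow> l"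
    using incseq_convergent[of x t] by blast
  have l0: "0 \<le> l" using l x by (intro LIMSEQ_le_const) auto
  have "(\<lambda>n. b (x n)) \<longlonglongrightarrow> b l"
    using continuous_on_tendsto_compose[OF cont l] l0 x by auto
  then have "(\<lambda>n. \<bar>b (x (Suc n)) - b (x n)\<bar>) \<longlonglongrightarrow> \<bar>b l - b l\<bar>"
    by (intro tendsto_intros) (auto intro: LIMSEQ_Suc)
  moreover have "\<bar>b (x (Suc n)) - b (x n)\<bar> = e" for n
    using hit_time_Suc_cases[OF x[of n]] x[of "Suc n"] by auto
  ultimately show False using e by (simp add: LIMSEQ_const_iff)
qed

text \<open>The index of the last hit up to time t; \<open>last_time\<close>, \<open>walk\<close>
  and \<open>next_time\<close> are all evaluated by means of it.\<close>

lemma ex_hit_index: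
  assumes "0 \<le> t"
  obtains n where "hit_time e b n \<le> ereal t" "ereal t < hit_time e b (Suc n)"
proof -
  define m where "m = (LEAST n. ereal t < hit_time e b n)"
  have m: "ereal t < hit_time e b m"
    unfolding m_def using hit_time_unbounded by (rule LeastI_ex)
  then obtain n where n: "m = Suc n" using assms by (cases m) auto
  then have "n < m" by simp
  then have "\<not> ereal t < hit_time e b n" unfolding m_def by (rule not_less_Least)
  with m n that show ?thesis by (auto simp: not_less)
qed

context
  fixes t n
  assumes n: "hit_time e b n \<le> ereal t" "ereal t < hit_time e b (Suc n)"
begin

lemma hit_time_le_iff: "hit_time e b m \<le> ereal t \<longleftrightarrow> m \<le> n"
  using n hit_time_mono[of m n] hit_time_mono[of "Suc n" m] not_less_eq_eq
  by (metis leD order_trans)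

lemma hit_time_real: "ereal (real_of_ereal (hit_time e b n)) = hit_time e b n"
  "0 \<le> real_of_ereal (hit_time e b n)"
  using hit_time_nonneg_cases[of n] n by auto

lemma last_time_eq: "last_time e b t = real_of_ereal (hit_time e b n)"
proof -
  have "{\<tau> \<in> range (hit_time e b). \<tau> \<le> ereal t} = hit_time e b ` {..n}"
    using hit_time_le_iff by auto
  moreover have "Max (hit_time e b ` {..n}) = hit_time e b n"
    by (rule Max_eqI) (auto intro: hit_time_mono)
  ultimately show ?thesis by (simp add: last_time_def)
qed

text \<open>Only the summands with index below n are nonzero, and they telescope: the walk is the
  path frozen at its last hitting time.\<close>

lemma walk_eq: "walk e b t = b (real_of_ereal (hit_time e b n)) - b 0"
proof -
  let ?b = "\<lambda>n. b (real_of_ereal (hit_time e b n))"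
  have "walk e b t = (\<Sum>m<n. ?b (Suc m) - ?b m)"
    unfolding walk_def using hit_time_le_iff
    by (subst suminf_finite[of "{..<n}"]) (auto simp: not_le not_less Suc_le_eq)
  also have "\<dots> = ?b n - ?b 0" by (rule sum_lessThan_telescope)
  finally show ?thesis by simp
qed

lemma next_time_eq: "next_time T e b t = real_of_ereal (min (hit_time e b (Suc n)) (ereal T))"
proof -
  have "Inf {\<tau> \<in> range (hit_time e b). hit_time e b n < \<tau>} = hit_time e b (Suc n)"
  proof (rule antisym)
    show "Inf {\<tau> \<in> range (hit_time e b). hit_time e b n < \<tau>} \<le> hit_time e b (Suc n)"
      using n by (intro Inf_lower) auto
    show "hit_time e b (Suc n) \<le> Inf {\<tau> \<in> range (hit_time e b). hit_time e b n < \<tau>}"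
    proof (rule Inf_greatest)
      fix \<tau> assume "\<tau> \<in> {\<tau> \<in> range (hit_time e b). hit_time e b n < \<tau>}"
      then obtain m where m: "\<tau> = hit_time e b m" "hit_time e b n < hit_time e b m" by auto
      then have "\<not> m \<le> n" using hit_time_mono[of m n] by auto
      then show "hit_time e b (Suc n) \<le> \<tau>" using m hit_time_mono[of "Suc n" m] by auto
    qed
  qed
  then show ?thesis unfolding next_time_def last_time_eq hit_time_real(1) by simp
qed

end

lemma last_time_bounds:
  assumes "0 \<le> t"
  shows "0 \<le> last_time e b t" "last_time e b t \<le> t"
    and "walk e b t = b (last_time e b t) - b 0"
    and "walk e b (last_time e b t) = b (last_time e b t) - b 0"
    and "\<And>s. last_time e b t \<le> s \<Longrightarrow> s \<le> t \<Longrightarrow> \<bar>b s - b (last_time e b t)\<bar> < e"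
    and "last_time e b (last_time e b t) = last_time e b t"
proof -
  obtain n where n: "hit_time e b n \<le> ereal t" "ereal t < hit_time e b (Suc n)"
    using ex_hit_index[OF assms] .
  note r = hit_time_real[OF n] last_time_eq[OF n]
  show "0 \<le> last_time e b t" using r by simp
  show le: "last_time e b t \<le> t" using r n by (metis ereal_less_eq(3))
  show "walk e b t = b (last_time e b t) - b 0" using walk_eq[OF n] r by simp
  have n': "hit_time e b n \<le> ereal (last_time e b t)" "ereal (last_time e b t) < hit_time e b (Suc n)"
    using r n le by (auto intro: le_less_trans)
  show "walk e b (last_time e b t) = b (last_time e b t) - b 0" using walk_eq[OF n'] r by simp
  show "last_time e b (last_time e b t) = last_time e b t" using last_time_eq[OF n'] r by simp
  show "\<bar>b s - b (last_time e b t)\<bar> < e" if "last_time e b t \<le> s" "s \<le> t" for s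
  proof (rule abs_diff_less_before_hit[of n])
    show "hit_time e b n = ereal (last_time e b t)" using r by simp
    show "ereal s < hit_time e b (Suc n)" using n that by (meson ereal_less_eq(3) le_less_trans)
  qed (use that r in auto)
qed

text \<open>If s lies before the last hit up to t, the hit following s occurs no later than that
  one, hence no later than T, so the truncation at T is inactive. The bound 2 * e is e for the
  completed step plus less than e for the position of s within it.\<close>

lemma next_time_bounds:
  assumes "0 \<le> s" "s < last_time e b t" "0 \<le> t" "t \<le> T"
  shows "s \<le> next_time T e b s" "next_time T e b s \<le> last_time e b t"
    and "walk e b (next_time T e b s) = b (next_time T e b s) - b 0"
    and "\<bar>b s - b (next_time T e b s)\<bar> \<le> 2 * e"
proof -
  obtain n where n: "hit_time e b n \<le> ereal t" "ereal t < hit_time e b (Suc n)"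
    using ex_hit_index[OF assms(3)] .
  obtain m where m: "hit_time e b m \<le> ereal s" "ereal s < hit_time e b (Suc m)"
    using ex_hit_index[OF assms(1)] .
  have tau: "hit_time e b n = ereal (last_time e b t)" using hit_time_real[OF n] last_time_eq[OF n] by simp
  have sig: "hit_time e b m = ereal (last_time e b s)" "0 \<le> last_time e b s"
    using hit_time_real[OF m] last_time_eq[OF m] by auto
  have "\<not> n \<le> m" using m tau assms(2) hit_time_mono[of n m] by (metis ereal_less_eq(3) leD order_trans)
  then have mn: "hit_time e b (Suc m) \<le> hit_time e b n" by (intro hit_time_mono) auto
  then obtain y where y: "hit_time e b (Suc m) = ereal y"
    using tau m by (cases "hit_time e b (Suc m)") auto
  have "y \<le> T" using y mn tau n assms(4) by (metis ereal_less_eq(3) order_trans)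
  then have nt: "next_time T e b s = y" unfolding next_time_eq[OF m] y by (simp add: min_def)
  show *: "s \<le> next_time T e b s" "next_time T e b s \<le> last_time e b t"
    using m y nt mn tau by auto
  have m': "hit_time e b (Suc m) \<le> ereal y" "ereal y < hit_time e b (Suc (Suc m))"
    using y hit_time_less_Suc[of "Suc m"] by auto
  show "walk e b (next_time T e b s) = b (next_time T e b s) - b 0"
    using walk_eq[OF m'] y nt by simp
  have "\<bar>b y - b (last_time e b s)\<bar> = e"
    using hit_time_Suc_cases[OF sig] y by auto
  moreover have "\<bar>b s - b (last_time e b s)\<bar> < e"
    using last_time_bounds[OF assms(1)] by simp
  ultimately show "\<bar>b s - b (next_time T e b s)\<bar> \<le> 2 * e" unfolding nt by arith
qed

end

section \<open>Pathwise error bounds\<close>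

text \<open>L is an argument because it later becomes a random variable whose moments are
  estimated.\<close>

definition holder :: "real \<Rightarrow> real \<Rightarrow> real \<Rightarrow> (real \<Rightarrow> real) \<Rightarrow> bool" where
  "holder L \<kappa> T b \<longleftrightarrow> (\<forall>s\<in>{0..T}. \<forall>t\<in>{0..T}. \<bar>b t - b s\<bar> \<le> L * \<bar>t - s\<bar> powr \<kappa>)"

lemma holderD: "holder L \<kappa> T b \<Longrightarrow> 0 \<le> s \<Longrightarrow> s \<le> t \<Longrightarrow> t \<le> T \<Longrightarrow> \<bar>b t - b s\<bar> \<le> L * (t - s) powr \<kappa>"
  unfolding holder_def by (drule bspec[of _ _ s], simp, drule bspec[of _ _ t], auto)

section \<open>Interpolation inequalities for powers\<close>

text \<open>The smaller of x and y controls A, and min(x, y)^(r + \<mu>) is at most x^r y^\<mu>.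
  This trades a bound in the time step and a bound in the distance to the singularity for a product
  of both.\<close>

lemma interpolate_powr:
  assumes "0 \<le> x" "0 \<le> y" "0 \<le> r" "0 \<le> \<mu>" "0 \<le> (K::real)"
    and "A \<le> K * x powr (r + \<mu>)" "A \<le> K * y powr (r + \<mu>)"
  shows "A \<le> K * (x powr r * y powr \<mu>)"
proof (cases "x \<le> y")
  case True
  have "A \<le> K * (x powr r * x powr \<mu>)" using assms(6) by (simp add: powr_add)
  also have "\<dots> \<le> K * (x powr r * y powr \<mu>)"
    using True assms by (intro mult_left_mono powr_mono2) auto
  finally show ?thesis .
next
  case False
  have "A \<le> K * (y powr r * y powr \<mu>)" using assms(7) by (simp add: powr_add)
  also have "\<dots> \<le> K * (x powr r * y powr \<mu>)"
    using False assms by (intro mult_left_mono mult_right_mono powr_mono2) auto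
  finally show ?thesis .
qed

text \<open>A splits as A^r A^(1 - r), each factor taking one of the two bounds. In this way the
  cost of freezing the path yields a power of the step size together with an integrable
  weight.\<close>

lemma min_interpolate_powr:
  assumes "0 \<le> A" "A \<le> x" "A \<le> y" "0 \<le> r" "r \<le> (1::real)"
  shows "A \<le> x powr r * y powr (1 - r)"
proof (cases "A = 0")
  case False
  then have "A = A powr r * A powr (1 - r)" using assms by (simp flip: powr_add)
  also have "\<dots> \<le> x powr r * y powr (1 - r)"
    using assms by (intro mult_mono powr_mono2) auto
  finally show ?thesis .
qed simp

text \<open>With x = s / t the claim reduces to 1 - x^a <= 1 - x <= (1 - x)^\<gamma>, valid since a
  and \<gamma> are at most 1. It controls the change of the prefactor t^(H - 1/2), which is
  unbounded near 0 unless a power of s compensates.\<close>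

lemma powr_minus_diff_bound:
  fixes s t a \<gamma> :: real
  assumes "0 < s" "s \<le> t" "0 \<le> a" "a \<le> 1" "0 \<le> \<gamma>" "\<gamma> \<le> 1"
  shows "(s powr - a - t powr - a) * s powr (\<gamma> + a) \<le> (t - s) powr \<gamma>"
proof -
  have "s / t \<le> (s / t) powr a"
    using powr_mono'[of a 1 "s / t"] assms by simp
  then have 1: "1 - (s / t) powr a \<le> (t - s) / t"
    using assms by (simp add: field_simps)
  have "(t - s) / t \<le> ((t - s) / t) powr \<gamma>"
    using powr_mono'[of \<gamma> 1 "(t - s) / t"] assms by simp
  with 1 have 2: "1 - (s / t) powr a \<le> ((t - s) / t) powr \<gamma>" by simp
  have "(s powr - a - t powr - a) * s powr (\<gamma> + a) = s powr \<gamma> * (1 - (s / t) powr a)"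
    using assms by (simp add: powr_divide powr_minus powr_add field_simps)
  also have "\<dots> \<le> s powr \<gamma> * ((t - s) / t) powr \<gamma>"
    using 2 by (intro mult_left_mono) auto
  also have "\<dots> \<le> t powr \<gamma> * ((t - s) / t) powr \<gamma>"
    using assms by (intro mult_right_mono powr_mono2) auto
  also have "\<dots> = (t - s) powr \<gamma>"
    using assms by (simp add: powr_divide)
  finally show ?thesis .
qed

lemma set_borel_measurable_scaled_path:
  fixes b :: "real \<Rightarrow> real" and t :: real
  assumes "continuous_on {0..} b" "0 \<le> t"
  shows "set_borel_measurable lborel {0<..<1} (\<lambda>u. b (t * u))"
proof -
  have "continuous_on {0<..<1} (\<lambda>u. t * u)" by (rule continuous_on_mult_left[OF continuous_on_id])
  moreover have "(\<lambda>u. t * u) ` {0<..<1} \<subseteq> {0..}" using assms(2) by (auto intro!: mult_nonneg_nonneg)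
  ultimately have "continuous_on {0<..<1} (\<lambda>u. b (t * u))"
    by (rule continuous_on_compose2[OF assms(1)])
  then show ?thesis
    using borel_measurable_continuous_on_indicator[of "{0<..<1}" "\<lambda>u. b (t * u)"]
    by (simp add: set_borel_measurable_def)
qed

lemma set_borel_measurable_diff:
  fixes f g :: "_ \<Rightarrow> real"
  assumes "set_borel_measurable M A f" "set_borel_measurable M A g"
  shows "set_borel_measurable M A (\<lambda>x. f x - g x)"
  using borel_measurable_diff[OF assms[unfolded set_borel_measurable_def]]
  by (simp add: set_borel_measurable_def algebra_simps)

lemma set_borel_measurable_add:
  fixes f g :: "_ \<Rightarrow> real"
  assumes "set_borel_measurable M A f" "set_borel_measurable M A g"
  shows "set_borel_measurable M A (\<lambda>x. f x + g x)"
  using borel_measurable_add[OF assms[unfolded set_borel_measurable_def]]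
  by (simp add: set_borel_measurable_def algebra_simps)

lemma set_borel_measurable_cmult:
  fixes f :: "_ \<Rightarrow> real"
  assumes "set_borel_measurable M A f"
  shows "set_borel_measurable M A (\<lambda>x. k * f x)"
  using borel_measurable_times[OF borel_measurable_const assms[unfolded set_borel_measurable_def], of k]
  by (simp add: set_borel_measurable_def algebra_simps)

lemma set_borel_measurable_constI: "A \<in> sets M \<Longrightarrow> set_borel_measurable M A (\<lambda>x. k :: real)"
  unfolding set_borel_measurable_def by simp

section \<open>Hoelder continuity of the operator and the error of freezing a path\<close>

context
  fixes H \<mu> r T L :: real and b :: "real \<Rightarrow> real"
  assumes H: "0 < H" "H < 1/2" and \<mu>: "1/2 - H < \<mu>" and r: "0 < r" "r + \<mu> \<le> 1" and T: "0 < T" and L: "0 \<le> L"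
    and cont: "continuous_on {0..} b" and b0: "b 0 = 0" and hold: "holder L (r + \<mu>) T b"
begin

lemma holder_increment_bound:
  assumes t: "0 < t" "t \<le> T" and u: "0 < u" "u < 1"
  shows "\<bar>b t - b (t * u)\<bar> \<le> L * (t powr (r + \<mu>) * (1 - u) powr (r + \<mu>))"
    "\<bar>b (t * u)\<bar> \<le> L * (t powr (r + \<mu>) * u powr (r + \<mu>))"
proof -
  have "t * u \<le> t" using t u by (simp add: mult_left_le)
  then have tu: "t * u \<le> T" using t by linarith
  have "\<bar>b t - b (t * u)\<bar> \<le> L * (t - t * u) powr (r + \<mu>)"
    using t u tu by (intro holderD[OF hold]) auto
  also have "t - t * u = t * (1 - u)" by (simp add: algebra_simps)
  finally show "\<bar>b t - b (t * u)\<bar> \<le> L * (t powr (r + \<mu>) * (1 - u) powr (r + \<mu>))"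
    using t u by (simp add: powr_mult)
  have "\<bar>b (t * u) - b 0\<bar> \<le> L * (t * u - 0) powr (r + \<mu>)"
    using t u tu by (intro holderD[OF hold]) auto
  then show "\<bar>b (t * u)\<bar> \<le> L * (t powr (r + \<mu>) * u powr (r + \<mu>))"
    using t u b0 by (simp add: powr_mult)
qed

lemma path_kernel_integrable:
  assumes t: "0 < t" "t \<le> T"
  shows "set_integrable lborel {0<..<1} (\<lambda>u. (b t - b (t * u)) * g1 H u)"
    "set_integrable lborel {0<..<1} (\<lambda>u. b (t * u) * g2 H u)"
proof -
  note meas = set_borel_measurable_scaled_path[OF cont, of t]
  have 1: "1/2 - H < r + \<mu>" using r \<mu> by simp
  show "set_integrable lborel {0<..<1} (\<lambda>u. (b t - b (t * u)) * g1 H u)"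
    by (rule J1_bound(1)[OF H 1, where Q="L * t powr (r + \<mu>)"])
      (use holder_increment_bound(1)[OF t] meas t in \<open>auto intro!: set_borel_measurable_diff set_borel_measurable_constI simp: mult.assoc\<close>)
  show "set_integrable lborel {0<..<1} (\<lambda>u. b (t * u) * g2 H u)"
    by (rule J2_bound(1)[OF H 1, where Q="L * t powr (r + \<mu>)"])
      (use holder_increment_bound(2)[OF t] meas t in \<open>auto simp: mult.assoc\<close>)
qed

text \<open>Since \<mu> + H - 1/2 is positive, its power is bounded by the value at T; what remains
  is order r with a constant uniform over [0, T].\<close>

lemma powr_exponent_split:
  "0 \<le> x \<Longrightarrow> x \<le> T \<Longrightarrow> x powr (r + \<mu> + H - 1/2) \<le> x powr r * T powr (\<mu> + H - 1/2)"
  using \<mu> powr_mono2[of "\<mu> + H - 1/2" x T] powr_add[of x r "\<mu> + H - 1/2"]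
  by (auto simp: algebra_simps intro!: mult_left_mono)

text \<open>Write t^(H - 1/2) F(t) - s^(H - 1/2) F(s) as t^(H - 1/2) (F(t) - F(s)) - k F(s), where k
  is the change of the prefactor. The k term contributes 1 to each constant, by
  \<open>powr_minus_diff_bound\<close>; the difference F(t) - F(s) contributes 2 when F is an
  increment of the path and 1 when F is a value.\<close>

lemma Lam_increment_bounds:
  assumes s: "0 < s" "s < t" "t \<le> T" and u: "0 < u" "u < 1"
  shows "\<bar>t powr (H - 1/2) * (b t - b (t * u)) - s powr (H - 1/2) * (b s - b (s * u))\<bar>
     \<le> 3 * L * ((t - s) powr r * T powr (\<mu> + H - 1/2)) * (1 - u) powr \<mu>" (is ?A)
    and "\<bar>t powr (H - 1/2) * b (t * u) - s powr (H - 1/2) * b (s * u)\<bar>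
     \<le> 2 * L * ((t - s) powr r * T powr (\<mu> + H - 1/2)) * u powr \<mu>" (is ?B)
proof -
  let ?x = "t - s" and ?l = "r + \<mu>" and ?a = "1/2 - H" and ?g = "r + \<mu> + H - 1/2"
  have t: "0 < t" "s \<le> T" using s by auto
  define k where "k = s powr - ?a - t powr - ?a"
  have k0: "0 \<le> k" unfolding k_def using s H powr_mono2'[of "- ?a" s t] by simp
  have k: "k * s powr ?l \<le> ?x powr r * T powr (\<mu> + H - 1/2)"
  proof -
    have "k * s powr (?g + ?a) \<le> ?x powr ?g"
      unfolding k_def using s H r \<mu> by (intro powr_minus_diff_bound) auto
    also have "\<dots> \<le> ?x powr r * T powr (\<mu> + H - 1/2)"
      using s by (intro powr_exponent_split) auto
    finally show ?thesis by simp
  qed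
  have e: "- ?a = H - 1/2" by simp
  show ?A
  proof -
    let ?D = "(b t - b (t * u)) - (b s - b (s * u))"
    have "\<bar>?D\<bar> \<le> 2 * L * ?x powr ?l"
    proof -
      have 1: "\<bar>b t - b s\<bar> \<le> L * ?x powr ?l" using s by (intro holderD[OF hold]) auto
      have "t * u \<le> t" using t u by (simp add: mult_left_le)
      then have "t * u \<le> T" using s by linarith
      then have "\<bar>b (t * u) - b (s * u)\<bar> \<le> L * (t * u - s * u) powr ?l"
        using s u by (intro holderD[OF hold]) auto
      also have "\<dots> \<le> L * ?x powr ?l"
      proof (intro mult_left_mono powr_mono2)
        have "(t - s) * u \<le> (t - s) * 1" using s u by (intro mult_left_mono) auto
        then show "t * u - s * u \<le> t - s" by (simp add: algebra_simps)
      qed (use s u r \<mu> H L in auto)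
      finally show ?thesis using 1 by linarith
    qed
    \<comment> \<open>The four path values are paired the other way here, each with its own end
      point: this bound is small for u near 1, the previous one for s near t. Only their
      interpolation supplies order r in t - s together with the weight at u = 1.\<close>
    moreover have "\<bar>?D\<bar> \<le> 2 * L * (t * (1 - u)) powr ?l"
    proof -
      have "\<bar>b s - b (s * u)\<bar> \<le> L * (s powr ?l * (1 - u) powr ?l)"
        using holder_increment_bound(1)[of s u] s u t by simp
      also have "\<dots> \<le> L * (t powr ?l * (1 - u) powr ?l)"
        using s L r \<mu> H by (intro mult_left_mono mult_right_mono powr_mono2) auto
      finally have "\<bar>?D\<bar> \<le> 2 * L * (t powr ?l * (1 - u) powr ?l)"
        using holder_increment_bound(1)[of t u] s u t by linarith
      then show ?thesis using t u by (simp add: powr_mult)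
    qed
    ultimately have "\<bar>?D\<bar> \<le> 2 * L * (?x powr r * (t * (1 - u)) powr \<mu>)"
      using s u t L H r \<mu> by (intro interpolate_powr) auto
    then have "t powr (H - 1/2) * \<bar>?D\<bar> \<le> t powr (H - 1/2) * (2 * L * (?x powr r * (t * (1 - u)) powr \<mu>))"
      by (intro mult_left_mono) auto
    also have "\<dots> = 2 * L * (?x powr r * t powr (\<mu> + H - 1/2)) * (1 - u) powr \<mu>"
      using t u powr_add[of t "H - 1/2" \<mu>] by (simp add: powr_mult add.commute add_diff_eq)
    also have "\<dots> \<le> 2 * L * (?x powr r * T powr (\<mu> + H - 1/2)) * (1 - u) powr \<mu>"
      using t s L \<mu> by (intro mult_left_mono mult_right_mono powr_mono2) auto
    finally have 1: "t powr (H - 1/2) * \<bar>?D\<bar> \<le> 2 * L * (?x powr r * T powr (\<mu> + H - 1/2)) * (1 - u) powr \<mu>" .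
    have "k * \<bar>b s - b (s * u)\<bar> \<le> k * (L * (s powr ?l * (1 - u) powr ?l))"
      using holder_increment_bound(1)[of s u] s u t k0 by (intro mult_left_mono) auto
    also have "\<dots> = (k * s powr ?l) * (L * (1 - u) powr ?l)" by simp
    also have "\<dots> \<le> (?x powr r * T powr (\<mu> + H - 1/2)) * (L * (1 - u) powr \<mu>)"
      by (rule mult_mono[OF k]) (use L u r in \<open>auto intro!: mult_left_mono powr_mono'\<close>)
    finally have 2: "k * \<bar>b s - b (s * u)\<bar> \<le> L * (?x powr r * T powr (\<mu> + H - 1/2)) * (1 - u) powr \<mu>"
      by (simp add: algebra_simps)
    have "t powr (H - 1/2) * (b t - b (t * u)) - s powr (H - 1/2) * (b s - b (s * u))
      = t powr (H - 1/2) * ?D - k * (b s - b (s * u))"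
      unfolding k_def e by (simp add: algebra_simps)
    also have "\<bar>\<dots>\<bar> \<le> t powr (H - 1/2) * \<bar>?D\<bar> + k * \<bar>b s - b (s * u)\<bar>"
      using k0 by (intro order_trans[OF abs_triangle_ineq4]) (simp add: abs_mult)
    finally show ?A using 1 2 by (simp add: algebra_simps)
  qed
  show ?B
  proof -
    have "t * u \<le> t" using t u by (simp add: mult_left_le)
    then have "t * u \<le> T" using s by linarith
    then have "\<bar>b (t * u) - b (s * u)\<bar> \<le> L * (t * u - s * u) powr ?l"
      using s u by (intro holderD[OF hold]) auto
    also have "t * u - s * u = ?x * u" by (simp add: algebra_simps)
    finally have "t powr (H - 1/2) * \<bar>b (t * u) - b (s * u)\<bar> \<le> ?x powr (H - 1/2) * (L * (?x powr ?l * u powr ?l))"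
      using s u H L by (intro mult_mono powr_mono2') (auto simp: powr_mult)
    also have "\<dots> = L * ?x powr ?g * u powr ?l"
      using powr_add[of ?x "H - 1/2" ?l] by (simp add: algebra_simps)
    also have "\<dots> \<le> L * (?x powr r * T powr (\<mu> + H - 1/2)) * u powr \<mu>"
      using L u r s powr_exponent_split[of ?x] by (intro mult_mono mult_left_mono powr_mono') auto
    finally have 1: "t powr (H - 1/2) * \<bar>b (t * u) - b (s * u)\<bar> \<le> L * (?x powr r * T powr (\<mu> + H - 1/2)) * u powr \<mu>" .
    have "k * \<bar>b (s * u)\<bar> \<le> k * (L * (s powr ?l * u powr ?l))"
      using holder_increment_bound(2)[of s u] s u t k0 by (intro mult_left_mono) auto
    also have "\<dots> = (k * s powr ?l) * (L * u powr ?l)" by simp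
    also have "\<dots> \<le> (?x powr r * T powr (\<mu> + H - 1/2)) * (L * u powr \<mu>)"
      by (rule mult_mono[OF k]) (use L u r in \<open>auto intro!: mult_left_mono powr_mono'\<close>)
    finally have 2: "k * \<bar>b (s * u)\<bar> \<le> L * (?x powr r * T powr (\<mu> + H - 1/2)) * u powr \<mu>"
      by (simp add: algebra_simps)
    have "t powr (H - 1/2) * b (t * u) - s powr (H - 1/2) * b (s * u)
      = t powr (H - 1/2) * (b (t * u) - b (s * u)) - k * b (s * u)"
      unfolding k_def e by (simp add: algebra_simps)
    also have "\<bar>\<dots>\<bar> \<le> t powr (H - 1/2) * \<bar>b (t * u) - b (s * u)\<bar> + k * \<bar>b (s * u)\<bar>"
      using k0 by (intro order_trans[OF abs_triangle_ineq4]) (simp add: abs_mult)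
    finally show ?B using 1 2 by (simp add: algebra_simps)
  qed
qed

text \<open>Both values are rescaled to integrals over (0, 1), where \<open>N1\<close> and
  \<open>N2\<close> integrate the weights of \<open>Lam_increment_bounds\<close>. The time s = 0 is
  separate because rescaling needs a positive time; there \<open>Lam\<close> is 0 and only its size
  at t matters.\<close>

lemma Lam_holder:
  assumes "0 \<le> s" "s \<le> t" "t \<le> T" "0 \<le> c"
  shows "\<bar>Lam c H b t - Lam c H b s\<bar> \<le> c * (3 * N1 H \<mu> + 2 * N2 H \<mu>) * T powr (\<mu> + H - 1/2) * L * (t - s) powr r"
proof -
  note N = N1_nonneg[OF H \<mu>] N2_nonneg[OF H \<mu>]
  note meas = set_borel_measurable_scaled_path[OF cont]
  consider "s = t" | "s = 0" "0 < t" | "0 < s" "s < t" using assms by linarith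
  then show ?thesis
  proof cases
    case 1
    then show ?thesis by simp
  next
    case 2
    let ?Q = "L * t powr (r + \<mu>)"
    have "(1 - u) powr (r + \<mu>) \<le> (1 - u) powr \<mu>" "u powr (r + \<mu>) \<le> u powr \<mu>" if "0 < u" "u < 1" for u
      using that r by (auto intro!: powr_mono')
    then have b1: "\<bar>b t - b (t * u)\<bar> \<le> ?Q * (1 - u) powr \<mu>" and b2: "\<bar>b (t * u)\<bar> \<le> ?Q * u powr \<mu>" if "0 < u" "u < 1" for u
      using holder_increment_bound[of t u] that 2 assms L
      by (auto simp: mult.assoc intro!: order_trans[OF holder_increment_bound(1)[of t u]] order_trans[OF holder_increment_bound(2)[of t u]] mult_left_mono)
    have "\<bar>J1 H (\<lambda>u. b t - b (t * u))\<bar> \<le> ?Q * N1 H \<mu>"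
      by (rule J1_bound(2)[OF H \<mu>]) (use b1 meas[of t] 2 in \<open>auto intro!: set_borel_measurable_diff set_borel_measurable_constI\<close>)
    moreover have "\<bar>J2 H (\<lambda>u. b (t * u))\<bar> \<le> ?Q * N2 H \<mu>"
      by (rule J2_bound(2)[OF H \<mu>]) (use b2 meas[of t] 2 in auto)
    ultimately have 1: "\<bar>J1 H (\<lambda>u. b t - b (t * u)) + J2 H (\<lambda>u. b (t * u))\<bar> \<le> ?Q * (N1 H \<mu> + N2 H \<mu>)"
      unfolding distrib_left by linarith
    have "\<bar>Lam c H b t\<bar> = c * t powr (H - 1/2) * \<bar>J1 H (\<lambda>u. b t - b (t * u)) + J2 H (\<lambda>u. b (t * u))\<bar>"
      using assms unfolding Lam_scale[OF H 2(2)] by (simp add: abs_mult)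
    also have "\<dots> \<le> c * t powr (H - 1/2) * (?Q * (N1 H \<mu> + N2 H \<mu>))"
      by (intro mult_left_mono 1) (use assms in auto)
    also have "\<dots> = c * (N1 H \<mu> + N2 H \<mu>) * L * t powr (r + \<mu> + H - 1/2)"
      using powr_add[of t "H - 1/2" "r + \<mu>"] by (simp add: algebra_simps)
    also have "\<dots> \<le> c * (3 * N1 H \<mu> + 2 * N2 H \<mu>) * L * (t powr r * T powr (\<mu> + H - 1/2))"
      using N assms L powr_exponent_split[of t] by (intro mult_mono mult_nonneg_nonneg) auto
    finally show ?thesis using 2 by (simp add: algebra_simps)
  next
    case 3
    have t: "0 < t" "s \<le> T" using 3 assms by auto
    let ?K = "L * ((t - s) powr r * T powr (\<mu> + H - 1/2))"
    let ?D1 = "\<lambda>u. t powr (H - 1/2) * (b t - b (t * u)) + (- (s powr (H - 1/2))) * (b s - b (s * u))"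
    let ?D2 = "\<lambda>u. t powr (H - 1/2) * b (t * u) + (- (s powr (H - 1/2))) * b (s * u)"
    have i: "set_integrable lborel {0<..<1} (\<lambda>u. k * (b t - b (t * u)) * g1 H u)"
      "set_integrable lborel {0<..<1} (\<lambda>u. k * b (t * u) * g2 H u)" if "0 < t" "t \<le> T" for k t
      unfolding mult.assoc by (intro set_integrable_mult_right path_kernel_integrable that)+
    have D1: "J1 H ?D1 = t powr (H - 1/2) * J1 H (\<lambda>u. b t - b (t * u)) + (- (s powr (H - 1/2))) * J1 H (\<lambda>u. b s - b (s * u))"
      using J1_add[OF i(1)[OF t(1) assms(3)] i(1)[OF 3(1) t(2)]] by (simp only: J1_cmult)
    have D2: "J2 H ?D2 = t powr (H - 1/2) * J2 H (\<lambda>u. b (t * u)) + (- (s powr (H - 1/2))) * J2 H (\<lambda>u. b (s * u))"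
      using J2_add[OF i(2)[OF t(1) assms(3)] i(2)[OF 3(1) t(2)]] by (simp only: J2_cmult)
    have "\<bar>J1 H ?D1\<bar> \<le> 3 * ?K * N1 H \<mu>"
    proof (rule J1_bound(2)[OF H \<mu>])
      show "set_borel_measurable lborel {0<..<1} ?D1"
        using t 3 by (intro set_borel_measurable_add set_borel_measurable_cmult set_borel_measurable_diff
          set_borel_measurable_constI meas) auto
      show "\<bar>?D1 u\<bar> \<le> 3 * ?K * (1 - u) powr \<mu>" if "0 < u" "u < 1" for u
        using Lam_increment_bounds(1)[OF 3 assms(3) that] by (simp add: mult.assoc)
    qed
    moreover have "\<bar>J2 H ?D2\<bar> \<le> 2 * ?K * N2 H \<mu>"
    proof (rule J2_bound(2)[OF H \<mu>])
      show "set_borel_measurable lborel {0<..<1} ?D2"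
        using t 3 by (intro set_borel_measurable_add set_borel_measurable_cmult meas) auto
      show "\<bar>?D2 u\<bar> \<le> 2 * ?K * u powr \<mu>" if "0 < u" "u < 1" for u
        using Lam_increment_bounds(2)[OF 3 assms(3) that] by (simp add: mult.assoc)
    qed
    ultimately have "\<bar>J1 H ?D1 + J2 H ?D2\<bar> \<le> 3 * ?K * N1 H \<mu> + 2 * ?K * N2 H \<mu>"
      by (rule order_trans[OF abs_triangle_ineq add_mono])
    then have bd: "\<bar>J1 H ?D1 + J2 H ?D2\<bar> \<le> (3 * N1 H \<mu> + 2 * N2 H \<mu>) * ?K"
      by (simp only: distrib_right distrib_left mult_ac)
    have "Lam c H b t - Lam c H b s = c * (J1 H ?D1 + J2 H ?D2)"
      unfolding Lam_scale[OF H t(1)] Lam_scale[OF H 3(1)] D1 D2 by (simp add: algebra_simps)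
    then have "\<bar>Lam c H b t - Lam c H b s\<bar> = c * \<bar>J1 H ?D1 + J2 H ?D2\<bar>"
      using assms by (simp add: abs_mult)
    also have "\<dots> \<le> c * ((3 * N1 H \<mu> + 2 * N2 H \<mu>) * ?K)"
      by (intro mult_left_mono bd assms)
    finally show ?thesis by (simp add: algebra_simps)
  qed
qed

text \<open>W and V stand for the path frozen at the next and at the last hit; what is used of them
  is their distance from b and their measurability. Interpolating 2 * e with the Hoelder bound
  leaves the weight exponent (r + \<mu>) * (1 - r), whence the hypothesis \<open>r1\<close>.\<close>

lemma approx_kernel_error:
  fixes W V :: "real \<Rightarrow> real"
  assumes t: "0 < t" "t \<le> T" and c: "0 \<le> c" and e: "0 < e" and r1: "1/2 - H < (r + \<mu>) * (1 - r)"
    and W: "\<And>s. 0 < s \<Longrightarrow> s < t \<Longrightarrow> \<bar>b s - W s\<bar> \<le> 2 * e" "\<And>s. 0 < s \<Longrightarrow> s < t \<Longrightarrow> \<bar>b s - W s\<bar> \<le> L * (t - s) powr (r + \<mu>)"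
    and V: "\<And>s. 0 < s \<Longrightarrow> s < t \<Longrightarrow> \<bar>b s - V s\<bar> \<le> 2 * e" "\<And>s. 0 < s \<Longrightarrow> s < t \<Longrightarrow> \<bar>b s - V s\<bar> \<le> L * s powr (r + \<mu>)"
    and mW: "set_borel_measurable lborel {0<..<1} (\<lambda>u. W (t * u))"
    and mV: "set_borel_measurable lborel {0<..<1} (\<lambda>u. V (t * u))"
  shows "\<bar>c * t powr (H - 1/2) * (J1 H (\<lambda>u. b t - W (t * u)) + J2 H (\<lambda>u. V (t * u))) - Lam c H b t\<bar>
    \<le> c * (N1 H ((r + \<mu>) * (1 - r)) + N2 H ((r + \<mu>) * (1 - r))) * T powr ((r + \<mu>) * (1 - r) + H - 1/2)
      * ((2 * e) powr r * L powr (1 - r))"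
proof -
  let ?\<nu> = "(r + \<mu>) * (1 - r)"
  let ?Q = "(2 * e) powr r * L powr (1 - r) * t powr ?\<nu>"
  note meas = set_borel_measurable_scaled_path[OF cont, of t]
  have tu: "0 < t * u" "t * u < t" "t - t * u = t * (1 - u)" if "0 < u" "u < 1" for u
    using that t by (auto simp: algebra_simps)
  have b1: "\<bar>b (t * u) - W (t * u)\<bar> \<le> ?Q * (1 - u) powr ?\<nu>" if u: "0 < u" "u < 1" for u
  proof -
    have "\<bar>b (t * u) - W (t * u)\<bar> \<le> (2 * e) powr r * (L * (t - t * u) powr (r + \<mu>)) powr (1 - r)"
      using W[OF tu(1,2)[OF u]] r \<mu> H by (intro min_interpolate_powr) auto
    also have "\<dots> = ?Q * (1 - u) powr ?\<nu>"
      unfolding tu(3)[OF u] using u t L by (simp add: powr_mult powr_powr)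
    finally show ?thesis .
  qed
  have b2: "\<bar>V (t * u) - b (t * u)\<bar> \<le> ?Q * u powr ?\<nu>" if u: "0 < u" "u < 1" for u
  proof -
    have "\<bar>b (t * u) - V (t * u)\<bar> \<le> (2 * e) powr r * (L * (t * u) powr (r + \<mu>)) powr (1 - r)"
      using V[OF tu(1,2)[OF u]] r \<mu> H by (intro min_interpolate_powr) auto
    also have "\<dots> = ?Q * u powr ?\<nu>"
      using u t L by (simp add: powr_mult powr_powr)
    finally show ?thesis by (simp add: abs_minus_commute)
  qed
  note j1 = J1_bound[OF H r1 set_borel_measurable_diff[OF meas mW] b1]
  note j2 = J2_bound[OF H r1 set_borel_measurable_diff[OF mV meas] b2]
  have "J1 H (\<lambda>u. (b t - b (t * u)) + (b (t * u) - W (t * u))) = J1 H (\<lambda>u. b t - b (t * u)) + J1 H (\<lambda>u. b (t * u) - W (t * u))"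
    using t by (intro J1_add path_kernel_integrable j1) auto
  moreover have "J2 H (\<lambda>u. b (t * u) + (V (t * u) - b (t * u))) = J2 H (\<lambda>u. b (t * u)) + J2 H (\<lambda>u. V (t * u) - b (t * u))"
    using t by (intro J2_add path_kernel_integrable j2) auto
  ultimately have "c * t powr (H - 1/2) * (J1 H (\<lambda>u. b t - W (t * u)) + J2 H (\<lambda>u. V (t * u))) - Lam c H b t
     = c * t powr (H - 1/2) * (J1 H (\<lambda>u. b (t * u) - W (t * u)) + J2 H (\<lambda>u. V (t * u) - b (t * u)))"
    unfolding Lam_scale[OF H t(1)] by (simp add: algebra_simps)
  then have "\<bar>c * t powr (H - 1/2) * (J1 H (\<lambda>u. b t - W (t * u)) + J2 H (\<lambda>u. V (t * u))) - Lam c H b t\<bar>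
     = c * t powr (H - 1/2) * \<bar>J1 H (\<lambda>u. b (t * u) - W (t * u)) + J2 H (\<lambda>u. V (t * u) - b (t * u))\<bar>"
    using c by (simp add: abs_mult)
  also have "\<dots> \<le> c * t powr (H - 1/2) * (?Q * N1 H ?\<nu> + ?Q * N2 H ?\<nu>)"
    using j1(2) j2(2) t c by (intro mult_left_mono order_trans[OF abs_triangle_ineq add_mono]) auto
  also have "\<dots> = c * (N1 H ?\<nu> + N2 H ?\<nu>) * t powr (?\<nu> + H - 1/2) * ((2 * e) powr r * L powr (1 - r))"
    using powr_add[of t ?\<nu> "H - 1/2"] by (simp add: add_diff_eq distrib_left mult_ac)
  also have "\<dots> \<le> c * (N1 H ?\<nu> + N2 H ?\<nu>) * T powr (?\<nu> + H - 1/2) * ((2 * e) powr r * L powr (1 - r))"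
    using t c r1 N1_nonneg[OF H r1] N2_nonneg[OF H r1]
    by (intro mult_right_mono mult_left_mono powr_mono2) auto
  finally show ?thesis .
qed

end

section \<open>Measurability of the imbedded walk\<close>

text \<open>The locale assumes no probability measure, so that it can also be interpreted on a
  one-point space, where joint measurability becomes measurability in time for a single
  path.\<close>

locale continuous_paths =
  fixes M :: "'a measure" and B :: "real \<Rightarrow> 'a \<Rightarrow> real"
  assumes measurable_B: "\<And>t. 0 \<le> t \<Longrightarrow> B t \<in> borel_measurable M"
    and cont_paths: "\<And>\<omega>. \<omega> \<in> space M \<Longrightarrow> continuous_on {0..} (\<lambda>t. B t \<omega>)"
    and B_0: "\<And>\<omega>. \<omega> \<in> space M \<Longrightarrow> B 0 \<omega> = 0"
begin

text \<open>Paths are continued to negative times by their value at 0, so that composition with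
  arbitrary real-valued measurable times stays measurable.\<close>

definition Bp :: "'a \<Rightarrow> real \<Rightarrow> real" where "Bp \<omega> t = B (max 0 t) \<omega>"

text \<open>The discretised time floor(n t)/n takes countably many values, so the discretised
  process is jointly measurable, and continuity of the paths gives pointwise convergence. For n = 0
  the quotient is 0 by convention, which the limit ignores.\<close>

lemma measurable_path_pair: "(\<lambda>(\<omega>, t). Bp \<omega> t) \<in> borel_measurable (M \<Otimes>\<^sub>M borel)"
proof (rule borel_measurable_LIMSEQ_real)
  let ?f = "\<lambda>n (\<omega>, t). B (max 0 (of_int \<lfloor>real n * t\<rfloor> / real n)) \<omega>"
  show "?f n \<in> borel_measurable (M \<Otimes>\<^sub>M borel)" for n
  proof -
    have "(\<lambda>x. B (max 0 (of_int \<lfloor>real n * snd x\<rfloor> / real n)) (fst x)) \<in> borel_measurable (M \<Otimes>\<^sub>M borel)"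
    proof (rule measurable_compose_countable[where f="\<lambda>i x. B (max 0 (of_int i / real n)) (fst x)" and g="\<lambda>x. \<lfloor>real n * snd x\<rfloor>"])
      fix i :: int
      have [measurable]: "B (max 0 (of_int i / real n)) \<in> borel_measurable M" by (rule measurable_B) simp
      show "(\<lambda>x. B (max 0 (of_int i / real n)) (fst x)) \<in> borel_measurable (M \<Otimes>\<^sub>M borel)" by measurable
    qed measurable
    then show ?thesis by (simp add: case_prod_beta)
  qed
  show "(\<lambda>n. ?f n x) \<longlonglongrightarrow> (case x of (\<omega>, t) \<Rightarrow> Bp \<omega> t)" if in_space: "x \<in> space (M \<Otimes>\<^sub>M borel)" for x
  proof -
    obtain \<omega> t where x: "x = (\<omega>, t)" "\<omega> \<in> space M"
      using in_space by (cases x) (simp add: space_pair_measure)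
    have "(\<lambda>n. of_int \<lfloor>real n * t\<rfloor> / real n) \<longlonglongrightarrow> t"
    proof (rule tendsto_sandwich)
      have *: "t - 1 / real n \<le> of_int \<lfloor>real n * t\<rfloor> / real n \<and> of_int \<lfloor>real n * t\<rfloor> / real n \<le> t"
        if "0 < n" for n :: nat
      proof -
        have "real n * t - 1 \<le> of_int \<lfloor>real n * t\<rfloor>" "of_int \<lfloor>real n * t\<rfloor> \<le> real n * t" by linarith+
        then have "(real n * t - 1) / real n \<le> of_int \<lfloor>real n * t\<rfloor> / real n"
          "of_int \<lfloor>real n * t\<rfloor> / real n \<le> real n * t / real n"
          by (intro divide_right_mono; simp)+
        then show ?thesis using that by (simp add: diff_divide_distrib)
      qed
      show "\<forall>\<^sub>F n in sequentially. t - 1 / real n \<le> of_int \<lfloor>real n * t\<rfloor> / real n"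
        using eventually_gt_at_top[of 0] by (rule eventually_mono) (use * in blast)
      show "\<forall>\<^sub>F n in sequentially. of_int \<lfloor>real n * t\<rfloor> / real n \<le> t"
        using eventually_gt_at_top[of 0] by (rule eventually_mono) (use * in blast)
      show "(\<lambda>n. t - 1 / real n) \<longlonglongrightarrow> t" using tendsto_diff[OF tendsto_const lim_1_over_n, of t] by simp
    qed simp
    then have "(\<lambda>n. max 0 (of_int \<lfloor>real n * t\<rfloor> / real n)) \<longlonglongrightarrow> max 0 t"
      by (intro tendsto_intros)
    from continuous_on_tendsto_compose[OF cont_paths[OF x(2)] this]
    show ?thesis by (simp add: x Bp_def)
  qed
qed

lemma measurable_Bp [measurable (raw)]:
  assumes [measurable]: "f \<in> measurable N M" "g \<in> borel_measurable N"
  shows "(\<lambda>x. Bp (f x) (g x)) \<in> borel_measurable N"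
  using measurable_compose[OF _ measurable_path_pair, of "\<lambda>x. (f x, g x)" N] by simp

definition hit :: "real \<Rightarrow> nat \<Rightarrow> 'a \<Rightarrow> ereal" where
  "hit e n \<omega> = hit_time e (\<lambda>t. B t \<omega>) n"

text \<open>This expresses a hitting event through countably many times. Not having hit e up to t
  means staying below e with a positive margin, because the maximum over a compact interval is
  attained; by continuity the margin needs to be tested at rational times only.\<close>

lemma hit_gt_iff:
  assumes "\<omega> \<in> space M" "0 < e" "0 \<le> t"
  shows "ereal t < hit e (Suc n) \<omega> \<longleftrightarrow> ereal t < hit e n \<omega> \<or>
    (\<exists>k::nat. \<forall>q::rat. of_rat q \<le> t \<and> hit e n \<omega> \<le> ereal (of_rat q)  \<longrightarrow>
        \<bar>Bp \<omega> (of_rat q) - Bp \<omega> (real_of_ereal (hit e n \<omega>))\<bar> \<le> e - 1 / Suc k)" (is "?L \<longleftrightarrow> ?R1 \<or> ?R2")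
proof (cases "ereal t < hit e n \<omega>")
  case True
  then show ?thesis
    using hit_time_mono[OF cont_paths[OF assms(1)] assms(2), of n "Suc n"] by (auto simp: hit_def)
next
  case False
  note c = cont_paths[OF assms(1)]
  obtain x where x: "hit e n \<omega> = ereal x" "0 \<le> x"
    using hit_time_nonneg_cases[OF c assms(2), of n] False by (auto simp: hit_def)
  have xt: "x \<le> t" using False x by simp
  have Bx: "Bp \<omega> s = B s \<omega>" if "x \<le> s" for s using that x by (simp add: Bp_def)
  have "?L \<longleftrightarrow> ?R2"
  proof
    assume L: ?L
    have "continuous_on {x..t} (\<lambda>t. B t \<omega>)"
        using x by (intro continuous_on_subset[OF c]) auto
      then have "continuous_on {x..t} (\<lambda>s. \<bar>B s \<omega> - B x \<omega>\<bar>)"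
      by (intro continuous_intros)
    then obtain s where s: "s \<in> {x..t}" "\<And>s'. s' \<in> {x..t} \<Longrightarrow> \<bar>B s' \<omega> - B x \<omega>\<bar> \<le> \<bar>B s \<omega> - B x \<omega>\<bar>"
      using continuous_attains_sup[of "{x..t}"] xt by (metis atLeastatMost_empty_iff compact_Icc not_less)
    have "\<bar>B s \<omega> - B x \<omega>\<bar> < e"
    proof (rule abs_diff_less_before_hit[OF c assms(2)])
      show "hit_time e (\<lambda>t. B t \<omega>) n = ereal x" using x by (simp add: hit_def)
      have "ereal s \<le> ereal t" using s(1) by simp
      then show "ereal s < hit_time e (\<lambda>t. B t \<omega>) (Suc n)" using L unfolding hit_def by (rule le_less_trans)
    qed (use s(1) x in auto)
    then obtain k where k: "1 / real (Suc k) < e - \<bar>B s \<omega> - B x \<omega>\<bar>"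
      using nat_approx_posE[of "e - \<bar>B s \<omega> - B x \<omega>\<bar>"] by auto
    show ?R2
    proof (intro exI[of _ k] allI impI)
      fix q :: rat assume q: "of_rat q \<le> t \<and> hit e n \<omega> \<le> ereal (of_rat q)"
      then have "\<bar>B (of_rat q) \<omega> - B x \<omega>\<bar> \<le> \<bar>B s \<omega> - B x \<omega>\<bar>" using x by (intro s) auto
      then show "\<bar>Bp \<omega> (of_rat q) - Bp \<omega> (real_of_ereal (hit e n \<omega>))\<bar> \<le> e - 1 / Suc k"
        using k q x by (simp add: Bx)
    qed
  next
    assume ?R2
    then obtain k where k: "\<And>q::rat. of_rat q \<le> t \<Longrightarrow> x \<le> of_rat q \<Longrightarrow> \<bar>B (of_rat q) \<omega> - B x \<omega>\<bar> \<le> e - 1 / Suc k"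
      using x by (auto simp: Bx)
    show ?L
    proof (rule ccontr)
      assume "\<not> ?L"
      then have le: "hit e (Suc n) \<omega> \<le> ereal t" by simp
      with hit_time_Suc_cases[OF c assms(2) x(1)[unfolded hit_def] x(2)] obtain y
        where y: "x < y" "y \<le> t" "\<bar>B y \<omega> - B x \<omega>\<bar> = e" by (auto simp: hit_def)
      have "continuous_on {x..y} (\<lambda>t. B t \<omega>)"
        using x by (intro continuous_on_subset[OF c]) auto
      then have "continuous_on {x..y} (\<lambda>s. \<bar>B s \<omega> - B x \<omega>\<bar>)"
        by (intro continuous_intros)
      then have "((\<lambda>s. \<bar>B s \<omega> - B x \<omega>\<bar>) \<longlongrightarrow> \<bar>B y \<omega> - B x \<omega>\<bar>) (at y within {x..y})"
        using y(1) unfolding continuous_on_def by simp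
      moreover have "e - 1 / Suc k < \<bar>B y \<omega> - B x \<omega>\<bar>" using y by simp
      ultimately have "\<forall>\<^sub>F s in at y within {x..y}. e - 1 / Suc k < \<bar>B s \<omega> - B x \<omega>\<bar>"
        by (intro order_tendstoD(1))
      then obtain d where d: "0 < d" "\<And>s. s \<in> {x..y} \<Longrightarrow> s \<noteq> y \<Longrightarrow> dist s y < d \<Longrightarrow> e - 1 / Suc k < \<bar>B s \<omega> - B x \<omega>\<bar>"
        unfolding eventually_at by blast
      \<comment> \<open>The rational time is taken to the left of the hit y: it must not exceed t
        and must not precede x.\<close>
      have "max x (y - d) < y" using y d by simp
      then obtain q :: rat where q: "max x (y - d) < of_rat q" "of_rat q < y"
        using of_rat_dense by blast
      have "e - 1 / Suc k < \<bar>B (of_rat q) \<omega> - B x \<omega>\<bar>"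
        using q by (intro d) (auto simp: dist_real_def)
      moreover have "\<bar>B (of_rat q) \<omega> - B x \<omega>\<bar> \<le> e - 1 / Suc k"
        using q y by (intro k) auto
      ultimately show False by simp
    qed
  qed
  then show ?thesis using False by simp
qed

lemma measurable_hit [measurable]:
  assumes e: "0 < e"
  shows "hit e n \<in> borel_measurable M"
proof (induction n)
  case 0
  then show ?case by (simp add: hit_def)
next
  case (Suc n)
  note [measurable] = Suc
  have nn: "0 \<le> hit e m \<omega>" if "\<omega> \<in> space M" for m \<omega>
    using hit_time_nonneg_cases[OF cont_paths[OF that] e, of m] by (auto simp: hit_def)
  show ?case
  proof (rule borel_measurableI_greater)
    fix y :: ereal
    show "{\<omega> \<in> space M. y < hit e (Suc n) \<omega>} \<in> sets M"
    proof (cases "y = \<infinity> \<or> y < 0")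
      case True
      then have "{\<omega> \<in> space M. y < hit e (Suc n) \<omega>} = {} \<or> {\<omega> \<in> space M. y < hit e (Suc n) \<omega>} = space M"
        using nn by (auto intro: less_le_trans)
      then show ?thesis using sets.empty_sets sets.top by metis
    next
      case False
      then obtain t where t: "y = ereal t" "0 \<le> t" by (cases y) auto
      have "{\<omega> \<in> space M. y < hit e (Suc n) \<omega>} = {\<omega> \<in> space M. ereal t < hit e n \<omega> \<or>
        (\<exists>k::nat. \<forall>q::rat. of_rat q \<le> t \<and> hit e n \<omega> \<le> ereal (of_rat q)  \<longrightarrow>
        \<bar>Bp \<omega> (of_rat q) - Bp \<omega> (real_of_ereal (hit e n \<omega>))\<bar> \<le> e - 1 / Suc k)}"
        unfolding t(1) using hit_gt_iff[OF _ e t(2)] by blast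
      also have "\<dots> \<in> sets M" by measurable
      finally show ?thesis .
    qed
  qed
qed

definition wlk :: "real \<Rightarrow> 'a \<Rightarrow> real \<Rightarrow> real" where
  "wlk e \<omega> s = walk e (\<lambda>t. B t \<omega>) s"

lemma measurable_wlk_pair:
  assumes e: "0 < e"
  shows "(\<lambda>(\<omega>, s). wlk e \<omega> s) \<in> borel_measurable (M \<Otimes>\<^sub>M borel)"
proof -
  note [measurable] = measurable_hit[OF e]
  have nn: "0 \<le> real_of_ereal (hit e m \<omega>)" if "\<omega> \<in> space M" for m \<omega>
    using hit_time_nonneg_cases[OF cont_paths[OF that] e, of m] by (auto simp: hit_def)
  have "(\<lambda>(\<omega>, s). \<Sum>n. if hit e (Suc n) \<omega> \<le> ereal s then Bp \<omega> (real_of_ereal (hit e (Suc n) \<omega>)) -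
     Bp \<omega> (real_of_ereal (hit e n \<omega>)) else 0) \<in> borel_measurable (M \<Otimes>\<^sub>M borel)"
    by measurable
  also have "?this \<longleftrightarrow> ?thesis"
    by (intro measurable_cong) (auto simp: space_pair_measure wlk_def walk_def Bp_def nn hit_def[symmetric] max_def intro!: arg_cong[where f=suminf])
  finally show ?thesis .
qed

text \<open>For \<open>s < 0\<close> the maximum in \<^const>\<open>last_time\<close> is over the empty set, hence the restriction to
  \<open>0 \<le> s\<close> when \<^const>\<open>last_time\<close> and \<^const>\<open>next_time\<close> are compared with measurable versions.\<close>

definition lst :: "real \<Rightarrow> 'a \<Rightarrow> real \<Rightarrow> real" where
  "lst e \<omega> s = real_of_ereal (SUP n. if hit e n \<omega> \<le> ereal s then hit e n \<omega> else 0)"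

lemma measurable_lst_pair:
  assumes e: "0 < e"
  shows "(\<lambda>(\<omega>, s). lst e \<omega> s) \<in> borel_measurable (M \<Otimes>\<^sub>M borel)"
proof -
  note [measurable] = measurable_hit[OF e]
  show ?thesis unfolding lst_def by measurable
qed

lemma last_time_eq_lst:
  assumes "0 < e" "\<omega> \<in> space M" "0 \<le> s"
  shows "last_time e (\<lambda>t. B t \<omega>) s = lst e \<omega> s"
proof -
  note c = cont_paths[OF assms(2)]
  obtain n where n: "hit_time e (\<lambda>t. B t \<omega>) n \<le> ereal s" "ereal s < hit_time e (\<lambda>t. B t \<omega>) (Suc n)"
    using ex_hit_index[OF c assms(1,3)] .
  have "(SUP m. if hit e m \<omega> \<le> ereal s then hit e m \<omega> else 0) = hit e n \<omega>"
  proof (rule antisym)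
    show "(SUP m. if hit e m \<omega> \<le> ereal s then hit e m \<omega> else 0) \<le> hit e n \<omega>"
    proof (rule SUP_least)
      fix m
      have "0 \<le> hit e n \<omega>" using hit_time_nonneg_cases[OF c assms(1), of n] by (auto simp: hit_def)
      then show "(if hit e m \<omega> \<le> ereal s then hit e m \<omega> else 0) \<le> hit e n \<omega>"
        using hit_time_le_iff[OF c assms(1) n, of m] hit_time_mono[OF c assms(1), of m n] by (auto simp: hit_def)
    qed
    show "hit e n \<omega> \<le> (SUP m. if hit e m \<omega> \<le> ereal s then hit e m \<omega> else 0)"
      using n by (intro SUP_upper2[of n]) (auto simp: hit_def)
  qed
  then show ?thesis using last_time_eq[OF c assms(1) n] by (simp add: lst_def hit_def)
qed

definition nxt :: "real \<Rightarrow> real \<Rightarrow> 'a \<Rightarrow> real \<Rightarrow> real" where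
  "nxt T e \<omega> s = real_of_ereal (min (INF n. if ereal (lst e \<omega> s) < hit e n \<omega> then hit e n \<omega> else \<infinity>) (ereal T))"

lemma measurable_nxt_pair:
  assumes e: "0 < e"
  shows "(\<lambda>(\<omega>, s). nxt T e \<omega> s) \<in> borel_measurable (M \<Otimes>\<^sub>M borel)"
proof -
  note [measurable] = measurable_hit[OF e] measurable_lst_pair[OF e]
  have [measurable]: "(\<lambda>x. lst e (fst x) (snd x)) \<in> borel_measurable (M \<Otimes>\<^sub>M borel)"
    using measurable_lst_pair[OF e] by (simp add: case_prod_beta)
  have "(\<lambda>x. nxt T e (fst x) (snd x)) \<in> borel_measurable (M \<Otimes>\<^sub>M borel)"
    unfolding nxt_def by measurable
  then show ?thesis by (simp add: case_prod_beta)
qed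

lemma next_time_eq_nxt:
  assumes "0 < e" "\<omega> \<in> space M" "0 \<le> s"
  shows "next_time T e (\<lambda>t. B t \<omega>) s = nxt T e \<omega> s"
proof -
  have "Inf {\<tau> \<in> range (hit_time e (\<lambda>t. B t \<omega>)). ereal (lst e \<omega> s) < \<tau>} =
    (INF n. if ereal (lst e \<omega> s) < hit e n \<omega> then hit e n \<omega> else \<infinity>)"
  proof (rule antisym)
    show "Inf {\<tau> \<in> range (hit_time e (\<lambda>t. B t \<omega>)). ereal (lst e \<omega> s) < \<tau>}
       \<le> (INF n. if ereal (lst e \<omega> s) < hit e n \<omega> then hit e n \<omega> else \<infinity>)"
      by (rule INF_greatest) (auto intro!: Inf_lower simp: hit_def)
    show "(INF n. if ereal (lst e \<omega> s) < hit e n \<omega> then hit e n \<omega> else \<infinity>)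
      \<le> Inf {\<tau> \<in> range (hit_time e (\<lambda>t. B t \<omega>)). ereal (lst e \<omega> s) < \<tau>}"
    proof (rule Inf_greatest)
      fix \<tau> assume "\<tau> \<in> {\<tau> \<in> range (hit_time e (\<lambda>t. B t \<omega>)). ereal (lst e \<omega> s) < \<tau>}"
      then obtain n where n: "\<tau> = hit e n \<omega>" "ereal (lst e \<omega> s) < hit e n \<omega>" by (auto simp: hit_def)
      then show "(INF n. if ereal (lst e \<omega> s) < hit e n \<omega> then hit e n \<omega> else \<infinity>) \<le> \<tau>"
        by (intro INF_lower2[of n]) auto
    qed
  qed
  then show ?thesis by (simp add: next_time_def nxt_def last_time_eq_lst[OF assms])
qed

lemma measurable_wlk [measurable (raw)]:
  assumes "0 < e" "f \<in> measurable N M" "g \<in> borel_measurable N"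
  shows "(\<lambda>x. wlk e (f x) (g x)) \<in> borel_measurable N"
  using measurable_compose[OF measurable_Pair[OF assms(2,3)] measurable_wlk_pair[OF assms(1)]] by simp

lemma measurable_lst [measurable (raw)]:
  assumes "0 < e" "f \<in> measurable N M" "g \<in> borel_measurable N"
  shows "(\<lambda>x. lst e (f x) (g x)) \<in> borel_measurable N"
  using measurable_compose[OF measurable_Pair[OF assms(2,3)] measurable_lst_pair[OF assms(1)]] by simp

lemma measurable_nxt [measurable (raw)]:
  assumes "0 < e" "f \<in> measurable N M" "g \<in> borel_measurable N"
  shows "(\<lambda>x. nxt T e (f x) (g x)) \<in> borel_measurable N"
  using measurable_compose[OF measurable_Pair[OF assms(2,3)] measurable_nxt_pair[OF assms(1)]] by simp

end

text \<open>A deterministic path is viewed as a process on a one-point space, so that the joint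
  measurability results apply.\<close>

lemma set_borel_measurable_walk:
  assumes "continuous_on {0..} b" "b 0 = 0" "0 < e" "0 \<le> t"
  shows "set_borel_measurable lborel {0<..<1} (\<lambda>u. walk e b (t * u))"
    and "set_borel_measurable lborel {0<..<1} (\<lambda>u. walk e b (next_time T e b (t * u)))"
proof -
  interpret continuous_paths "count_space (UNIV :: unit set)" "\<lambda>t _. b t"
    by unfold_locales (use assms in simp_all)
  note [measurable (raw)] = measurable_wlk[OF assms(3)] measurable_nxt[OF assms(3)]
  have [simp]: "next_time T e b (t * u) = nxt T e () (t * u)" if "0 < u" for u
    using next_time_eq_nxt[OF assms(3), of "()" "t * u"] that assms by simp
  have "(\<lambda>u. indicator {0<..<1} u *\<^sub>R wlk e () (t * u)) \<in> borel_measurable lborel" by measurable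
  then show "set_borel_measurable lborel {0<..<1} (\<lambda>u. walk e b (t * u))"
    by (simp add: set_borel_measurable_def wlk_def)
  have "(\<lambda>u. indicator {0<..<1} u *\<^sub>R wlk e () (nxt T e () (t * u))) \<in> borel_measurable lborel" by measurable
  also have "?this \<longleftrightarrow> (\<lambda>u. indicator {0<..<1} u *\<^sub>R walk e b (next_time T e b (t * u))) \<in> borel_measurable lborel"
    by (intro measurable_cong) (auto simp: wlk_def indicator_def)
  finally show "set_borel_measurable lborel {0<..<1} (\<lambda>u. walk e b (next_time T e b (t * u)))"
    by (simp add: set_borel_measurable_def)
qed

section \<open>Pathwise error of the approximation\<close>

lemma fbm_approx_eq:
  assumes b: "continuous_on {0..} b" "b 0 = 0" and e: "0 < e" and H: "0 < H" "H < 1/2" and t: "0 \<le> t"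
    and pos: "0 < last_time e b t"
  shows "fbm_approx c H T e b t = c * last_time e b t powr (H - 1/2) *
    (J1 H (\<lambda>u. b (last_time e b t) - walk e b (next_time T e b (last_time e b t * u))) +
     J2 H (\<lambda>u. walk e b (last_time e b t * u)))"
  unfolding fbm_approx_def integral_dK1_scale[OF pos] integral_dK2_scale[OF H pos]
  using last_time_bounds(4)[OF b(1) e t] b(2) by (simp add: algebra_simps)

lemma fbm_approx_eq_last_time:
  assumes b: "continuous_on {0..} b" and e: "0 < e" and t: "0 \<le> t"
  shows "fbm_approx c H T e b t = fbm_approx c H T e b (last_time e b t)"
  unfolding fbm_approx_def last_time_bounds(6)[OF b e t] ..

lemma fbm_approx_last_time_0:
  assumes "last_time e b t = 0"
  shows "fbm_approx c H T e b t = 0"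
  by (simp add: fbm_approx_def assms set_lebesgue_integral_def)

text \<open>The first summand comes from freezing the path, its factor 2 from (2 e)^r <= 2 e^r; the
  second is the Hoelder constant of \<open>Lam\<close>. Their sum serves as a common bound for both
  error terms.\<close>

definition path_const :: "real \<Rightarrow> real \<Rightarrow> real \<Rightarrow> real \<Rightarrow> real" where
  "path_const H \<mu> r T = (N1 H ((r + \<mu>) * (1 - r)) + N2 H ((r + \<mu>) * (1 - r))) * T powr ((r + \<mu>) * (1 - r) + H - 1/2) * 2
     + (3 * N1 H \<mu> + 2 * N2 H \<mu>) * T powr (\<mu> + H - 1/2)"

lemma path_const_nonneg:
  assumes "0 < H" "H < 1/2" "1/2 - H < \<mu>" "1/2 - H < (r + \<mu>) * (1 - r)"
  shows "0 \<le> path_const H \<mu> r T"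
  unfolding path_const_def
  using N1_nonneg[OF assms(1-3)] N2_nonneg[OF assms(1-3)] N1_nonneg[OF assms(1,2,4)] N2_nonneg[OF assms(1,2,4)] by auto

context
  fixes H \<mu> r T L e c :: real and b :: "real \<Rightarrow> real"
  assumes H: "0 < H" "H < 1/2" and \<mu>: "1/2 - H < \<mu>" and r: "0 < r" "r + \<mu> \<le> 1" and T: "0 < T" and L: "0 \<le> L"
    and cont: "continuous_on {0..} b" and b0: "b 0 = 0" and hold: "holder L (r + \<mu>) T b"
    and r1: "1/2 - H < (r + \<mu>) * (1 - r)" and e: "0 < e" and c: "0 \<le> c"
begin

text \<open>The hit following v lies between v and the last hit up to t, and the last hit up to v
  lies between 0 and v. Hence freezing moves the time by at most \<open>last_time e b t - v\<close>
  in the first integral and by at most v in the second, which are the distances that the two weights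
  ask for.\<close>

lemma fbm_approx_minus_Lam_last_time:
  assumes t: "0 \<le> t" "t \<le> T"
  shows "\<bar>fbm_approx c H T e b t - Lam c H b (last_time e b t)\<bar>
    \<le> c * (N1 H ((r + \<mu>) * (1 - r)) + N2 H ((r + \<mu>) * (1 - r))) * T powr ((r + \<mu>) * (1 - r) + H - 1/2)
      * ((2 * e) powr r * L powr (1 - r))"
proof -
  let ?s = "last_time e b t"
  note lt = last_time_bounds[OF cont e]
  have s: "0 \<le> ?s" "?s \<le> t" using lt t by auto
  show ?thesis
  proof (cases "?s = 0")
    case True
    then show ?thesis using c N1_nonneg[OF H r1] N2_nonneg[OF H r1] by (simp add: fbm_approx_last_time_0)
  next
    case False
    then have pos: "0 < ?s" using s by simp
    note m = set_borel_measurable_walk[OF cont b0 e s(1)]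
    show ?thesis
      unfolding fbm_approx_eq[OF cont b0 e H t(1) pos]
    proof (rule approx_kernel_error[OF H \<mu> r T L cont b0 hold pos _ c e r1 _ _ _ _ m(2) m(1)])
      show "?s \<le> T" using s t by simp
      fix v assume v: "0 < v" "v < ?s"
      note n = next_time_bounds[OF cont e _ v(2) t, unfolded b0]
      have v0: "0 \<le> v" using v by simp
      show "\<bar>b v - walk e b (next_time T e b v)\<bar> \<le> 2 * e"
        using n(3,4)[OF v0] by simp
      have "\<bar>b (next_time T e b v) - b v\<bar> \<le> L * (next_time T e b v - v) powr (r + \<mu>)"
        using n(1,2)[OF v0] v s t by (intro holderD[OF hold]) auto
      also have "\<dots> \<le> L * (?s - v) powr (r + \<mu>)"
        using n(1,2)[OF v0] v s t L r H \<mu> by (intro mult_left_mono powr_mono2) auto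
      finally show "\<bar>b v - walk e b (next_time T e b v)\<bar> \<le> L * (?s - v) powr (r + \<mu>)"
        using n(3)[OF v0] by (simp add: abs_minus_commute)
      note l = lt[OF v0, unfolded b0]
      show "\<bar>b v - walk e b v\<bar> \<le> 2 * e"
        using l(3) l(5)[of v] l(2) e by simp
      have "\<bar>b v - b (last_time e b v)\<bar> \<le> L * (v - last_time e b v) powr (r + \<mu>)"
        using l(1,2) v s t by (intro holderD[OF hold]) auto
      also have "\<dots> \<le> L * v powr (r + \<mu>)"
        using l(1,2) v s t L r H \<mu> by (intro mult_left_mono powr_mono2) auto
      finally show "\<bar>b v - walk e b v\<bar> \<le> L * v powr (r + \<mu>)"
        using l(3) by simp
    qed
  qed
qed

lemma fbm_approx_minus_Lam:
  assumes t: "0 \<le> t" "t \<le> T"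
  shows "\<bar>fbm_approx c H T e b t - Lam c H b t\<bar>
    \<le> c * path_const H \<mu> r T * (e powr r * L powr (1 - r) + L * (t - last_time e b t) powr r)"
proof -
  let ?s = "last_time e b t"
  let ?A = "(N1 H ((r + \<mu>) * (1 - r)) + N2 H ((r + \<mu>) * (1 - r))) * T powr ((r + \<mu>) * (1 - r) + H - 1/2)"
  let ?B = "(3 * N1 H \<mu> + 2 * N2 H \<mu>) * T powr (\<mu> + H - 1/2)"
  have A: "0 \<le> ?A" and B: "0 \<le> ?B"
    using N1_nonneg[OF H \<mu>] N2_nonneg[OF H \<mu>] N1_nonneg[OF H r1] N2_nonneg[OF H r1] by auto
  note lt = last_time_bounds[OF cont e t(1)]
  have 1: "\<bar>Lam c H b t - Lam c H b ?s\<bar> \<le> c * ?B * (L * (t - ?s) powr r)"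
    using Lam_holder[OF H \<mu> r T L cont b0 hold lt(1,2) t(2) c] by (simp add: mult.assoc)
  have "(2 * e) powr r \<le> 2 * e powr r"
    using e r H \<mu> powr_mono[of r 1 2] by (simp add: powr_mult)
  then have "c * ?A * ((2 * e) powr r * L powr (1 - r)) \<le> c * ?A * (2 * e powr r * L powr (1 - r))"
    using A c by (intro mult_left_mono mult_right_mono) auto
  with fbm_approx_minus_Lam_last_time[OF t]
  have 2: "\<bar>fbm_approx c H T e b t - Lam c H b ?s\<bar> \<le> c * (?A * 2) * (e powr r * L powr (1 - r))"
    by (simp add: mult_ac)
  have "\<bar>fbm_approx c H T e b t - Lam c H b t\<bar> \<le> c * (?A * 2) * (e powr r * L powr (1 - r)) + c * ?B * (L * (t - ?s) powr r)"
    using 1 2 by linarith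
  also have "\<dots> \<le> c * path_const H \<mu> r T * (e powr r * L powr (1 - r)) + c * path_const H \<mu> r T * (L * (t - ?s) powr r)"
    unfolding path_const_def using A B c L by (intro add_mono mult_right_mono mult_left_mono mult_nonneg_nonneg) auto
  finally show ?thesis by (simp add: distrib_left)
qed

end

section \<open>Moments of the Hoelder constant\<close>

lemma floor_double_cases:
  fixes y :: real
  shows "\<lfloor>2 * y\<rfloor> = 2 * \<lfloor>y\<rfloor> \<or> \<lfloor>2 * y\<rfloor> = 2 * \<lfloor>y\<rfloor> + 1"
  by linarith

text \<open>From one dyadic level to the next, the left grid point of x either stays or moves to its
  right neighbour on the finer grid, an increment of size at most K q^(n + 1). The geometric series
  sums these steps, and continuity identifies the limit.\<close>

lemma dyadic_approx_bound:
  fixes g :: "real \<Rightarrow> real" and q K :: real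
  assumes cont: "continuous_on {0..1} g" and q: "0 < q" "q < 1" and K: "0 \<le> K"
    and inc: "\<And>n j. j < 2^n \<Longrightarrow> \<bar>g (real (Suc j) / 2^n) - g (real j / 2^n)\<bar> \<le> K * q^n"
    and x: "0 \<le> x" "x \<le> 1"
  shows "\<bar>g x - g (of_int \<lfloor>2^n * x\<rfloor> / 2^n)\<bar> \<le> K * q^(Suc n) / (1 - q)"
proof -
  define p where "p n = (of_int \<lfloor>2^n * x\<rfloor> / 2^n :: real)" for n
  have p01: "p n \<in> {0..1}" for n
  proof -
    have "of_int \<lfloor>2^n * x\<rfloor> \<le> 2^n * x" by linarith
    also have "\<dots> \<le> 2^n" using x by simp
    finally show ?thesis using x by (simp add: p_def field_simps)
  qed
  have step: "\<bar>g (p (Suc n)) - g (p n)\<bar> \<le> K * q^(Suc n)" for n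
  proof -
    define y where "y = 2^n * x"
    define j where "j = nat (2 * \<lfloor>y\<rfloor>)"
    have y0: "0 \<le> \<lfloor>y\<rfloor>" using x by (simp add: y_def)
    have pn: "p n = real j / 2^Suc n"
      using y0 by (simp add: p_def y_def j_def)
    from floor_double_cases[of y] show ?thesis
    proof
      assume "\<lfloor>2 * y\<rfloor> = 2 * \<lfloor>y\<rfloor>"
      then have "p (Suc n) = p n" by (simp add: p_def y_def mult.assoc)
      then show ?thesis using K q by simp
    next
      assume a: "\<lfloor>2 * y\<rfloor> = 2 * \<lfloor>y\<rfloor> + 1"
      then have ps: "p (Suc n) = real (Suc j) / 2^Suc n"
        using y0 by (simp add: p_def y_def j_def mult.assoc)
      have "real (Suc j) \<le> 2^Suc n" using p01[of "Suc n"] unfolding ps by simp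
      then have "j < 2^Suc n" by (metis Suc_le_eq of_nat_le_iff of_nat_numeral of_nat_power)
      then show ?thesis unfolding ps pn by (rule inc)
    qed
  qed
  have tele: "\<bar>g (p (n + k)) - g (p n)\<bar> \<le> K * q^(Suc n) * (\<Sum>i<k. q^i)" for k
  proof (induction k)
    case (Suc k)
    have "\<bar>g (p (n + Suc k)) - g (p n)\<bar> \<le> \<bar>g (p (Suc (n + k))) - g (p (n + k))\<bar> + \<bar>g (p (n + k)) - g (p n)\<bar>"
      by simp
    also have "\<dots> \<le> K * q^(Suc (n + k)) + K * q^(Suc n) * (\<Sum>i<k. q^i)"
      by (intro add_mono step Suc.IH)
    finally show ?case by (simp add: algebra_simps power_add)
  qed simp
  have "(\<Sum>i<k. q^i) \<le> 1 / (1 - q)" for k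
    using q by (simp add: sum_gp_strict divide_right_mono)
  then have bound: "\<bar>g (p (n + k)) - g (p n)\<bar> \<le> K * q^(Suc n) * (1 / (1 - q))" for k
    using K q by (intro order_trans[OF tele] mult_left_mono) auto
  have "p \<longlonglongrightarrow> x"
  proof (rule tendsto_sandwich)
    have *: "x - (1/2)^n \<le> p n \<and> p n \<le> x" for n
    proof -
      have "2^n * x - 1 \<le> of_int \<lfloor>2^n * x\<rfloor>" "of_int \<lfloor>2^n * x\<rfloor> \<le> 2^n * x" by linarith+
      then have "(2^n * x - 1) / 2^n \<le> p n" "p n \<le> 2^n * x / 2^n"
        unfolding p_def by (intro divide_right_mono; simp)+
      then show ?thesis by (simp add: diff_divide_distrib power_divide)
    qed
    show "\<forall>\<^sub>F n in sequentially. x - (1/2)^n \<le> p n" "\<forall>\<^sub>F n in sequentially. p n \<le> x"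
      using * by auto
    have "(\<lambda>n. (1/2)^n :: real) \<longlonglongrightarrow> 0" by (rule LIMSEQ_realpow_zero) auto
    from tendsto_diff[OF tendsto_const this, of x] show "(\<lambda>n. x - (1/2)^n) \<longlonglongrightarrow> x" by simp
  qed simp
  then have "(\<lambda>k. p (n + k)) \<longlonglongrightarrow> x" using LIMSEQ_ignore_initial_segment[of p x n] by (simp add: add.commute)
  then have "(\<lambda>k. g (p (n + k))) \<longlonglongrightarrow> g x"
    using continuous_on_tendsto_compose[OF cont, of "\<lambda>k. p (n + k)" x sequentially] x p01 by auto
  then have "(\<lambda>k. \<bar>g (p (n + k)) - g (p n)\<bar>) \<longlonglongrightarrow> \<bar>g x - g (p n)\<bar>"
    by (intro tendsto_intros)
  then have "\<bar>g x - g (p n)\<bar> \<le> K * q^(Suc n) * (1 / (1 - q))"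
    by (rule LIMSEQ_le_const2) (use bound in blast)
  then show ?thesis by (simp add: p_def)
qed

text \<open>At the level n with 2^-(n+1) < t - s <= 2^-n, the grid points of s and t coincide or are
  neighbours. The constant collects 1 for the step between them, 2 / (1 - q) for the two tails and
  2^\<kappa> from 2^-n < 2 (t - s).\<close>

lemma dyadic_increments_imp_holder_unit:
  fixes g :: "real \<Rightarrow> real" and \<kappa> K :: real
  assumes cont: "continuous_on {0..1} g" and \<kappa>: "0 < \<kappa>" and K: "0 \<le> K"
    and inc: "\<And>n j. j < 2^n \<Longrightarrow> \<bar>g (real (Suc j) / 2^n) - g (real j / 2^n)\<bar> \<le> K * (2 powr - \<kappa>)^n"
    and st: "0 \<le> s" "s \<le> t" "t \<le> 1"
  shows "\<bar>g t - g s\<bar> \<le> 2 powr \<kappa> * (1 + 2 / (1 - 2 powr - \<kappa>)) * K * (t - s) powr \<kappa>"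
proof (cases "s = t")
  case False
  define q where "q = 2 powr - \<kappa>"
  have q: "0 < q" "q < 1" using \<kappa> by (auto simp: q_def powr_less_one)
  define d where "d = t - s"
  have d: "0 < d" "d \<le> 1" using False st by (auto simp: d_def)
  obtain m where "(1/2)^m < d" using real_arch_pow_inv[of d "1/2"] d by auto
  \<comment> \<open>This is n + 1 for the level n wanted; it is positive because (1/2)^0 = 1 is not
    below d.\<close>
  define m0 where "m0 = (LEAST m. (1/2)^m < d)"
  have m0: "(1/2)^m0 < d" unfolding m0_def by (rule LeastI) fact
  then obtain n where n: "m0 = Suc n" using d by (cases m0) auto
  have "\<not> (1/2)^n < d" using not_less_Least[of n "\<lambda>m. (1/2)^m < d"] n by (simp add: m0_def)
  then have dn: "2^n * d \<le> 1" "1 < 2 * 2^n * d" using m0 n by (auto simp: field_simps power_divide)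
  let ?p = "\<lambda>x. of_int \<lfloor>2^n * x\<rfloor> / 2^n :: real"
  note ap = dyadic_approx_bound[OF cont q K inc[folded q_def]]
  have "2^n * t - 2^n * s \<le> 1" "2^n * s \<le> 2^n * t" using dn st by (auto simp: d_def algebra_simps)
  then have "\<lfloor>2^n * t\<rfloor> = \<lfloor>2^n * s\<rfloor> \<or> \<lfloor>2^n * t\<rfloor> = \<lfloor>2^n * s\<rfloor> + 1" by linarith
  then have mid: "\<bar>g (?p t) - g (?p s)\<bar> \<le> K * q^n"
  proof
    assume "\<lfloor>2^n * t\<rfloor> = \<lfloor>2^n * s\<rfloor>"
    then show ?thesis using K q by simp
  next
    assume a: "\<lfloor>2^n * t\<rfloor> = \<lfloor>2^n * s\<rfloor> + 1"
    define j where "j = nat \<lfloor>2^n * s\<rfloor>"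
    have "0 \<le> \<lfloor>2^n * s\<rfloor>" using st by simp
    then have ps: "?p s = real j / 2^n" "?p t = real (Suc j) / 2^n" using a by (auto simp: j_def)
    have "real (Suc j) \<le> 2^n * t" using a \<open>0 \<le> \<lfloor>2^n * s\<rfloor>\<close> unfolding j_def by linarith
    also have "\<dots> \<le> 2^n" using st by simp
    finally have "j < 2^n" by (metis Suc_le_eq of_nat_le_iff of_nat_numeral of_nat_power)
    then show ?thesis unfolding ps q_def by (rule inc)
  qed
  have "\<bar>g t - g s\<bar> \<le> K * q^n + 2 * (K * q^(Suc n) / (1 - q))"
    using mid ap[of t n] ap[of s n] st by linarith
  also have "\<dots> \<le> K * q^n + 2 * (K * q^n / (1 - q))"
    using q K by (intro add_mono mult_left_mono divide_right_mono order_refl) (auto simp: mult_left_le_one_le)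
  also have "\<dots> = (1 + 2 / (1 - q)) * K * q^n" by (simp add: algebra_simps)
  also have "\<dots> \<le> (1 + 2 / (1 - q)) * K * (2 powr \<kappa> * d powr \<kappa>)"
  proof (intro mult_left_mono)
    have "q^n = (2 powr - \<kappa>) powr real n" using q by (simp add: q_def powr_realpow)
    also have "\<dots> = (1 / 2^n) powr \<kappa>"
      by (simp add: powr_powr powr_divide powr_minus field_simps flip: powr_realpow)
    also have "\<dots> \<le> (2 * d) powr \<kappa>"
      using dn \<kappa> by (intro powr_mono2) (auto simp: field_simps)
    finally show "q^n \<le> 2 powr \<kappa> * d powr \<kappa>" using d by (simp add: powr_mult)
  qed (use q K in auto)
  finally show ?thesis by (simp add: q_def d_def algebra_simps)
qed (use K \<kappa> in simp)

text \<open>\<open>T powr - \<kappa>\<close> is the cost of rescaling [0, T] to the unit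
  interval.\<close>

definition chain_const :: "real \<Rightarrow> real \<Rightarrow> real" where
  "chain_const \<kappa> T = 2 powr \<kappa> * (1 + 2 / (1 - 2 powr - \<kappa>)) * T powr - \<kappa>"

lemma chain_const_nonneg: "0 < \<kappa> \<Longrightarrow> 0 \<le> chain_const \<kappa> T"
  using powr_less_one[of 2 "- \<kappa>"] by (simp add: chain_const_def)

lemma dyadic_increments_imp_holder:
  fixes f :: "real \<Rightarrow> real" and \<kappa> K T :: real
  assumes cont: "continuous_on {0..} f" and \<kappa>: "0 < \<kappa>" and K: "0 \<le> K" and T: "0 < T"
    and inc: "\<And>n j. j < 2^n \<Longrightarrow> \<bar>f (T * real (Suc j) / 2^n) - f (T * real j / 2^n)\<bar> \<le> K * (2 powr - \<kappa>)^n"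
  shows "holder (chain_const \<kappa> T * K) \<kappa> T f"
proof -
  have *: "\<bar>f t - f s\<bar> \<le> chain_const \<kappa> T * K * (t - s) powr \<kappa>" if st: "0 \<le> s" "s \<le> t" "t \<le> T" for s t
  proof -
    let ?g = "\<lambda>x. f (T * x)"
    have "continuous_on {0..1} (\<lambda>x. T * x)" by (intro continuous_intros)
    moreover have "(\<lambda>x. T * x) ` {0..1} \<subseteq> {0..}" using T by auto
    ultimately have c: "continuous_on {0..1} ?g" by (rule continuous_on_compose2[OF cont])
    have i: "\<bar>?g (real (Suc j) / 2^n) - ?g (real j / 2^n)\<bar> \<le> K * (2 powr - \<kappa>)^n" if "j < 2^n" for n j
      using inc[OF that] by simp
    have "\<bar>?g (t / T) - ?g (s / T)\<bar> \<le> 2 powr \<kappa> * (1 + 2 / (1 - 2 powr - \<kappa>)) * K * (t / T - s / T) powr \<kappa>"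
      by (rule dyadic_increments_imp_holder_unit[OF c \<kappa> K i]) (use st T in \<open>auto simp: divide_right_mono\<close>)
    also have "t / T - s / T = (t - s) / T" by (simp add: diff_divide_distrib)
    also have "((t - s) / T) powr \<kappa> = (t - s) powr \<kappa> * T powr - \<kappa>"
      using st T by (simp add: powr_divide powr_minus_divide)
    finally show ?thesis using T by (simp add: chain_const_def algebra_simps)
  qed
  show ?thesis
    unfolding holder_def
  proof (intro ballI)
    fix s t assume "s \<in> {0..T}" "t \<in> {0..T}"
    then show "\<bar>f t - f s\<bar> \<le> chain_const \<kappa> T * K * \<bar>t - s\<bar> powr \<kappa>"
      using *[of s t] *[of t s] by (cases "s \<le> t") (auto simp: abs_minus_commute)
  qed
qed

text \<open>The three factors are the number of increments at level n, the scaling of their moment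
  of order 2k, and the normalisation by the target modulus. The product is a geometric sequence in n
  whose ratio is below 1 exactly when k (1 - 2 \<kappa>) > 1.\<close>

lemma dyadic_scaling_powr:
  "2^n * (1 / 2^n)^k * (1 / ((2 powr - \<kappa>)^n)^(2*k)) = (2 powr (1 + 2 * real k * \<kappa> - real k)) ^ n"
proof -
  have 1: "(2::real)^n = 2 powr real n" by (simp add: powr_realpow)
  have "2 powr - real (n * k) = 1 / (2::real) ^ (n * k)"
    unfolding powr_minus_divide by (subst powr_realpow) auto
  then have 2: "(1 / 2^n)^k = (2::real) powr - real (n * k)"
    by (simp add: power_mult power_divide)
  have 3: "1 / ((2 powr - \<kappa>)^n)^(2*k) = 2 powr (\<kappa> * real (n * (2 * k)))"
  proof -
    have "((2 powr - \<kappa>)^n)^(2*k) = (2 powr - \<kappa>) powr real (n * (2 * k))"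
      unfolding power_mult[symmetric] by (rule powr_realpow[symmetric]) simp
    also have "\<dots> = 2 powr - (\<kappa> * real (n * (2 * k)))" by (simp only: powr_powr minus_mult_left)
    finally show ?thesis by (simp only: powr_minus_divide) simp
  qed
  have "(2 powr (1 + 2 * real k * \<kappa> - real k)) ^ n = 2 powr ((1 + 2 * real k * \<kappa> - real k) * real n)"
    by (simp only: powr_powr[symmetric]) (rule powr_realpow[symmetric], simp)
  also have "(1 + 2 * real k * \<kappa> - real k) * real n = real n + - real (n * k) + \<kappa> * real (n * (2 * k))"
    by (simp add: algebra_simps)
  finally show ?thesis unfolding 2 3 unfolding 1 powr_add by simp
qed

lemma power_powr_inverse:
  assumes "0 \<le> d" "0 < k"
  shows "(d ^ (2 * k)) powr (1 / (2 * real k)) = d"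
proof (cases "d = 0")
  case False
  then have "d ^ (2 * k) = d powr (2 * real k)" using assms powr_realpow[of d "2 * k"] by simp
  then show ?thesis using assms by (simp add: powr_powr)
qed (use assms in simp)

section \<open>Moments of Brownian increments and of the Hoelder constant\<close>

locale brownian = prob_space M for M :: "'a measure" + 
  fixes B :: "real \<Rightarrow> 'a \<Rightarrow> real"
  assumes brownian_motion: "brownian_motion M B"
begin

sublocale continuous_paths M B
  using brownian_motion by unfold_locales (auto simp: brownian_motion_def)

lemma increment_distributed:
  "0 \<le> s \<Longrightarrow> s < t \<Longrightarrow> distributed M lborel (\<lambda>\<omega>. B t \<omega> - B s \<omega>) (normal_density 0 (sqrt (t - s)))"
  using brownian_motion by (auto simp: brownian_motion_def)

lemma increments_indep:
  "0 \<le> u 0 \<Longrightarrow> (\<And>i. i < n \<Longrightarrow> u i \<le> u (Suc i)) \<Longrightarrow>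
    indep_vars (\<lambda>_. borel) (\<lambda>i \<omega>. B (u (Suc i)) \<omega> - B (u i) \<omega>) {..<n}"
  using brownian_motion by (auto simp: brownian_motion_def)

lemma increment_moment_even:
  assumes "0 \<le> s" "s < t"
  shows "(\<integral>\<^sup>+\<omega>. ennreal ((B t \<omega> - B s \<omega>) ^ (2 * k)) \<partial>M) = ennreal (fact (2 * k) / (2 ^ k * fact k) * (t - s) ^ k)"
proof -
  let ?\<sigma> = "sqrt (t - s)"
  have "(\<integral>\<^sup>+\<omega>. ennreal ((B t \<omega> - B s \<omega>) ^ (2 * k)) \<partial>M) =
    (\<integral>\<^sup>+x. ennreal (normal_density 0 ?\<sigma> x) * ennreal (x ^ (2 * k)) \<partial>lborel)"
    by (rule distributed_nn_integral[OF increment_distributed[OF assms], symmetric]) measurable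
  also have "\<dots> = (\<integral>\<^sup>+x. ennreal (normal_density 0 ?\<sigma> x * (x - 0) ^ (2 * k)) \<partial>lborel)"
    by (intro nn_integral_cong) (simp add: ennreal_mult')
  also have "\<dots> = ennreal (fact (2 * k) / ((2 / ?\<sigma>\<^sup>2) ^ k * fact k))"
    using normal_moment_even[of ?\<sigma> 0 k] assms
    by (subst nn_integral_eq_integral) (auto simp: has_bochner_integral_iff intro!: mult_nonneg_nonneg zero_le_even_power)
  also have "fact (2 * k) / ((2 / ?\<sigma>\<^sup>2) ^ k * fact k) = fact (2 * k) / (2 ^ k * fact k) * (t - s) ^ k"
    using assms by (simp add: power_divide)
  finally show ?thesis .
qed

text \<open>The normal density is at most 1 / (2 \<sigma>), because 2 pi >= 4, and the interval has
  length 4 e.\<close>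

lemma increment_small_ball:
  assumes "0 \<le> s" "s < t" "0 < e"
  shows "prob {\<omega> \<in> space M. \<bar>B t \<omega> - B s \<omega>\<bar> \<le> 2 * e} \<le> 2 * e / sqrt (t - s)"
proof -
  let ?\<sigma> = "sqrt (t - s)"
  have \<sigma>: "0 < ?\<sigma>" using assms by simp
  have dens: "normal_density 0 ?\<sigma> x \<le> 1 / (2 * ?\<sigma>)" for x
  proof -
    have "4 * 1 \<le> 2 * pi" using pi_gt3 by simp
    then have "sqrt (2\<^sup>2) \<le> sqrt (2 * pi)" by (subst real_sqrt_le_iff) simp
    then have "2 * ?\<sigma> \<le> sqrt (2 * pi) * ?\<sigma>" using \<sigma> by simp
    then have "2 * ?\<sigma> \<le> sqrt (2 * pi * ?\<sigma>\<^sup>2)" using \<sigma> by (simp add: real_sqrt_mult)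
    moreover have "exp (- (x - 0)\<^sup>2 / (2 * ?\<sigma>\<^sup>2)) \<le> 1" by simp
    ultimately have "1 / sqrt (2 * pi * ?\<sigma>\<^sup>2) * exp (- (x - 0)\<^sup>2 / (2 * ?\<sigma>\<^sup>2)) \<le> 1 / (2 * ?\<sigma>) * 1"
      using \<sigma> by (intro mult_mono divide_left_mono) auto
    then show ?thesis by (simp add: normal_density_def)
  qed
  let ?X = "\<lambda>\<omega>. B t \<omega> - B s \<omega>"
  have "emeasure M (?X -` {- (2 * e)..2 * e} \<inter> space M) = 
    (\<integral>\<^sup>+x. ennreal (normal_density 0 ?\<sigma> x) * indicator {- (2 * e)..2 * e} x \<partial>lborel)"
    by (rule distributed_emeasure[OF increment_distributed[OF assms(1,2)]]) simp
  also have "\<dots> \<le> (\<integral>\<^sup>+x. ennreal (1 / (2 * ?\<sigma>)) * indicator {- (2 * e)..2 * e} x \<partial>lborel)"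
    by (intro nn_integral_mono mult_right_mono ennreal_leI dens) auto
  also have "\<dots> = ennreal (1 / (2 * ?\<sigma>)) * ennreal (4 * e)"
    using assms by (simp add: nn_integral_cmult_indicator)
  also have "\<dots> = ennreal (2 * e / ?\<sigma>)"
    using assms by (simp flip: ennreal_mult')
  finally have "emeasure M (?X -` {- (2 * e)..2 * e} \<inter> space M) \<le> ennreal (2 * e / ?\<sigma>)" .
  moreover have "?X -` {- (2 * e)..2 * e} \<inter> space M = {\<omega> \<in> space M. \<bar>B t \<omega> - B s \<omega>\<bar> \<le> 2 * e}"
    by (auto simp: abs_le_iff)
  ultimately show ?thesis
    using assms by (simp add: emeasure_eq_measure)
qed

text \<open>A sum in place of a supremum: it dominates every normalised dyadic increment to the
  power 2k, and its expectation is computed term by term. Values in \<open>ennreal\<close> allow it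
  to be formed before its almost sure finiteness is known.\<close>

definition dyadic_var :: "real \<Rightarrow> real \<Rightarrow> nat \<Rightarrow> 'a \<Rightarrow> ennreal" where
  "dyadic_var \<kappa> T k \<omega> = (\<Sum>n. \<Sum>j<2^n. ennreal (((B (T * real (Suc j) / 2^n) \<omega> - B (T * real j / 2^n) \<omega>)
     / (2 powr - \<kappa>)^n) ^ (2 * k)))"

lemma measurable_dyadic_var [measurable]: "0 \<le> T \<Longrightarrow> dyadic_var \<kappa> T k \<in> borel_measurable M"
proof -
  assume "0 \<le> T"
  then have [measurable]: "B (T * real (Suc j) / 2^n) \<in> borel_measurable M" "B (T * real j / 2^n) \<in> borel_measurable M" for n j
    by (auto intro!: measurable_B)
  show ?thesis unfolding dyadic_var_def by measurable
qed

lemma nn_integral_dyadic_var: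
  assumes T: "0 < T"
  shows "(\<integral>\<^sup>+\<omega>. dyadic_var \<kappa> T k \<omega> \<partial>M) =
    (\<Sum>n. ennreal (fact (2 * k) / (2 ^ k * fact k) * T ^ k * (2 powr (1 + 2 * real k * \<kappa> - real k)) ^ n))"
proof -
  let ?q = "2 powr - \<kappa> :: real"
  have [measurable]: "B (T * real (Suc j) / 2^n) \<in> borel_measurable M" "B (T * real j / 2^n) \<in> borel_measurable M" for n j
    using T by (auto intro!: measurable_B)
  have one: "(\<integral>\<^sup>+\<omega>. ennreal (((B (T * real (Suc j) / 2^n) \<omega> - B (T * real j / 2^n) \<omega>) / ?q^n) ^ (2 * k)) \<partial>M)
    = ennreal (fact (2 * k) / (2 ^ k * fact k) * (T / 2^n) ^ k * (1 / (?q^n)^(2*k)))" for n j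
  proof -
    have lt: "0 \<le> T * real j / 2^n" "T * real j / 2^n < T * real (Suc j) / 2^n"
      using T by (auto simp: divide_strict_right_mono)
    have "T * real (Suc j) / 2^n - T * real j / 2^n = T / 2^n" by (simp add: field_simps)
    note mom = increment_moment_even[OF lt, unfolded this, of k]
    have eq: "ennreal ((x / ?q^n) ^ (2 * k)) = ennreal (x ^ (2 * k)) * ennreal (1 / (?q^n)^(2*k))" for x :: real
    proof -
      have "(x / ?q^n) ^ (2 * k) = x ^ (2 * k) * (1 / (?q^n)^(2*k))" by (simp add: power_divide)
      then show ?thesis by (simp only:) (rule ennreal_mult, auto intro: zero_le_even_power)
    qed
    have "(\<integral>\<^sup>+\<omega>. ennreal (((B (T * real (Suc j) / 2^n) \<omega> - B (T * real j / 2^n) \<omega>) / ?q^n) ^ (2 * k)) \<partial>M)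
      = (\<integral>\<^sup>+\<omega>. ennreal ((B (T * real (Suc j) / 2^n) \<omega> - B (T * real j / 2^n) \<omega>) ^ (2 * k)) * ennreal (1 / (?q^n)^(2*k)) \<partial>M)"
      unfolding eq ..
    also have "\<dots> = ennreal (fact (2 * k) / (2 ^ k * fact k) * (T / 2^n) ^ k) * ennreal (1 / (?q^n)^(2*k))"
      unfolding mom[symmetric] by (rule nn_integral_multc) measurable
    also have "\<dots> = ennreal (fact (2 * k) / (2 ^ k * fact k) * (T / 2^n) ^ k * (1 / (?q^n)^(2*k)))"
      using T by (intro ennreal_mult[symmetric]) auto
    finally show ?thesis .
  qed
  note pw = dyadic_scaling_powr[of _ k \<kappa>]
  have "(\<integral>\<^sup>+\<omega>. dyadic_var \<kappa> T k \<omega> \<partial>M) = (\<Sum>n. \<Sum>j<(2::nat)^n. 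
    ennreal (fact (2 * k) / (2 ^ k * fact k) * (T / 2^n) ^ k * (1 / (?q^n)^(2*k))))"
    unfolding dyadic_var_def
    by (subst nn_integral_suminf, measurable, subst nn_integral_sum, measurable) (simp only: one)
  also have "\<dots> = (\<Sum>n. ennreal (fact (2 * k) / (2 ^ k * fact k) * T ^ k * (2 powr (1 + 2 * real k * \<kappa> - real k)) ^ n))"
  proof (intro suminf_cong)
    fix n
    have "(\<Sum>j<(2::nat)^n. ennreal (fact (2 * k) / (2 ^ k * fact k) * (T / 2^n) ^ k * (1 / (?q^n)^(2*k))))
     = ennreal (2^n * (fact (2 * k) / (2 ^ k * fact k) * (T / 2^n) ^ k * (1 / (?q^n)^(2*k))))"
      using T by (subst sum_ennreal) auto
    also have "2^n * (fact (2 * k) / (2 ^ k * fact k) * (T / 2^n) ^ k * (1 / (?q^n)^(2*k))) =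
      fact (2 * k) / (2 ^ k * fact k) * T ^ k * (2^n * (1 / 2^n)^k * (1 / (?q^n)^(2*k)))"
      by (simp add: power_divide mult_ac)
    finally show "(\<Sum>j<(2::nat)^n. ennreal (fact (2 * k) / (2 ^ k * fact k) * (T / 2^n) ^ k * (1 / (?q^n)^(2*k))))
     = ennreal (fact (2 * k) / (2 ^ k * fact k) * T ^ k * (2 powr (1 + 2 * real k * \<kappa> - real k)) ^ n)"
      unfolding pw .
  qed
  finally show ?thesis .
qed

end

definition dyadic_const :: "real \<Rightarrow> real \<Rightarrow> nat \<Rightarrow> real" where
  "dyadic_const \<kappa> T k = fact (2 * k) / (2 ^ k * fact k) * T ^ k / (1 - 2 powr (1 + 2 * real k * \<kappa> - real k))"

context brownian
begin

lemma nn_integral_dyadic_var_eq: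
  assumes T: "0 < T" and k: "1 < real k * (1 - 2 * \<kappa>)"
  shows "(\<integral>\<^sup>+\<omega>. dyadic_var \<kappa> T k \<omega> \<partial>M) = ennreal (dyadic_const \<kappa> T k)"
proof -
  let ?z = "2 powr (1 + 2 * real k * \<kappa> - real k) :: real"
  have "2 powr (1 + 2 * real k * \<kappa> - real k) < 2 powr (0::real)"
    using k by (intro powr_less_mono) (auto simp: algebra_simps)
  then have z: "0 \<le> ?z" "?z < 1" by auto
  have "(\<lambda>n. fact (2 * k) / (2 ^ k * fact k) * T ^ k * ?z ^ n) sums
    (fact (2 * k) / (2 ^ k * fact k) * T ^ k * (1 / (1 - ?z)))"
    by (intro sums_mult geometric_sums) (use z in auto)
  then show ?thesis
    unfolding nn_integral_dyadic_var[OF T] dyadic_const_def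
    using T z by (subst suminf_ennreal_eq) (auto intro!: mult_nonneg_nonneg)
qed

text \<open>A single nonnegative term is at most the whole sum, so the root of order 2k of the sum
  bounds every normalised dyadic increment, and chaining applies.\<close>

lemma holder_of_dyadic_var:
  assumes \<omega>: "\<omega> \<in> space M" and T: "0 < T" and \<kappa>: "0 < \<kappa>" and k: "0 < k" and fin: "dyadic_var \<kappa> T k \<omega> < \<infinity>"
  shows "holder (chain_const \<kappa> T * enn2real (dyadic_var \<kappa> T k \<omega>) powr (1 / (2 * real k))) \<kappa> T (\<lambda>t. B t \<omega>)"
proof (rule dyadic_increments_imp_holder[OF cont_paths[OF \<omega>] \<kappa> _ T])
  fix n j :: nat assume j: "j < 2^n"
  let ?q = "2 powr - \<kappa> :: real"
  let ?d = "\<bar>B (T * real (Suc j) / 2^n) \<omega> - B (T * real j / 2^n) \<omega>\<bar> / ?q^n"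
  let ?a = "\<lambda>n j. ennreal (((B (T * real (Suc j) / 2^n) \<omega> - B (T * real j / 2^n) \<omega>) / ?q^n) ^ (2 * k))"
  have "?a n j \<le> (\<Sum>j<2^n. ?a n j)"
    by (rule member_le_sum) (use j in auto)
  also have "\<dots> \<le> dyadic_var \<kappa> T k \<omega>"
  proof -
    define S where "S n = (\<Sum>j<2^n. ?a n j)" for n
    have "sum S {n} \<le> suminf S" by (rule sum_le_suminf) auto
    moreover have "dyadic_var \<kappa> T k \<omega> = suminf S" unfolding dyadic_var_def S_def ..
    ultimately show ?thesis unfolding S_def by (simp only: sum.insert sum.empty finite.emptyI empty_iff not_False_eq_True add_0_right)
  qed
  finally have "?a n j \<le> dyadic_var \<kappa> T k \<omega>" .
  then have "enn2real (?a n j) \<le> enn2real (dyadic_var \<kappa> T k \<omega>)"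
    by (rule enn2real_mono[OF _ fin[unfolded infinity_ennreal_def]])
  then have "((B (T * real (Suc j) / 2^n) \<omega> - B (T * real j / 2^n) \<omega>) / ?q^n) ^ (2 * k) \<le> enn2real (dyadic_var \<kappa> T k \<omega>)"
    by (subst (asm) enn2real_ennreal) (rule zero_le_even_power, simp)
  moreover have "\<bar>x\<bar> ^ (2 * k) = x ^ (2 * k)" for x :: real by (simp add: power_even_abs)
  ultimately have "?d ^ (2 * k) \<le> enn2real (dyadic_var \<kappa> T k \<omega>)"
    by (simp only: power_divide)
  moreover have "0 \<le> ?d" by simp
  ultimately have "(?d ^ (2 * k)) powr (1 / (2 * real k)) \<le> enn2real (dyadic_var \<kappa> T k \<omega>) powr (1 / (2 * real k))"
    by (intro powr_mono2 zero_le_even_power) simp_all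
  also have "(?d ^ (2 * k)) powr (1 / (2 * real k)) = ?d"
    by (rule power_powr_inverse) (use k in simp_all)
  finally show "\<bar>B (T * real (Suc j) / 2^n) \<omega> - B (T * real j / 2^n) \<omega>\<bar> \<le> enn2real (dyadic_var \<kappa> T k \<omega>) powr (1 / (2 * real k)) * ?q^n"
    by (subst (asm) pos_divide_le_eq) simp_all
qed simp

end

section \<open>Moments of the largest gap between hitting times\<close>

text \<open>The probability bound is raised to the power \<rho> / m and multiplied by the power
  \<rho> of the gap size. The step size then enters as e^\<rho>, and n through a geometric factor
  whose ratio is below 1 as soon as m > 2 and \<rho> > 0.\<close>

lemma gap_scale_powr:
  fixes T e \<rho> :: real
  assumes T: "0 < T" and e: "0 < e" and m: "0 < m"
  shows "(T / 2^n) powr \<rho> * (2^(n+2) * (2 * e / sqrt (T / (2^(n+2) * real m)))^m) powr (\<rho> / real m)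
    = T powr \<rho> * 2 powr \<rho> * (real m / T) powr (\<rho>/2) * 4 powr (\<rho> / real m + \<rho>/2) * e powr \<rho>
      * (2 powr (\<rho> / real m - \<rho>/2))^n"
proof -
  let ?N = "2^(n+2) :: real"
  let ?\<alpha> = "\<rho> / real m"
  let ?z = "2 * e / sqrt (T / (?N * real m))"
  have N: "?N = 4 * 2 powr real n" by (simp add: powr_realpow)
  have z: "0 < ?z" using T e m by simp
  have "?z = 2 * e * (?N * (real m / T)) powr (1/2)"
    using T e m by (simp add: powr_half_sqrt real_sqrt_divide real_sqrt_mult field_simps)
  then have "?z powr \<rho> = 2 powr \<rho> * e powr \<rho> * (?N powr (\<rho>/2) * (real m / T) powr (\<rho>/2))"
    using T e m by (simp only: powr_mult powr_powr) (simp add: powr_mult powr_powr)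
  moreover have "(?z^m) powr ?\<alpha> = ?z powr \<rho>"
    using z m by (simp only: powr_realpow[symmetric] powr_powr) simp
  ultimately have 1: "(?N * ?z^m) powr ?\<alpha> = ?N powr (?\<alpha> + \<rho>/2) * (2 powr \<rho> * e powr \<rho> * (real m / T) powr (\<rho>/2))"
    using z by (simp only: powr_mult powr_add) simp
  have 2: "(T / 2^n) powr \<rho> = T powr \<rho> * 2 powr (- (real n * \<rho>))"
    using T by (simp add: powr_divide powr_minus_divide powr_powr flip: powr_realpow)
  have 3: "?N powr (?\<alpha> + \<rho>/2) = 4 powr (?\<alpha> + \<rho>/2) * 2 powr (real n * (?\<alpha> + \<rho>/2))"
    unfolding N by (simp add: powr_mult powr_powr)
  have "(2 powr (?\<alpha> - \<rho>/2))^n = (2 powr (?\<alpha> - \<rho>/2)) powr real n"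
    by (rule powr_realpow[symmetric]) simp
  also have "\<dots> = 2 powr (- (real n * \<rho>) + real n * (?\<alpha> + \<rho>/2))"
    unfolding powr_powr by (simp add: algebra_simps)
  finally have 4: "(2 powr (?\<alpha> - \<rho>/2))^n = 2 powr (- (real n * \<rho>)) * 2 powr (real n * (?\<alpha> + \<rho>/2))"
    by (simp only: powr_add)
  show ?thesis unfolding 1 2 3 4 by (simp only: mult_ac)
qed

definition gap_const :: "real \<Rightarrow> nat \<Rightarrow> real \<Rightarrow> real" where
  "gap_const \<rho> m T = T powr \<rho> * 2 powr \<rho> * (real m / T) powr (\<rho>/2) * 4 powr (\<rho> / real m + \<rho>/2)
     / (1 - 2 powr (\<rho> / real m - \<rho>/2))"

lemma gap_const_nonneg:
  assumes "0 < \<rho>" "2 < m"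
  shows "0 \<le> gap_const \<rho> m T"
proof -
  have "\<rho> / real m \<le> \<rho> / 2" using assms by (intro divide_left_mono) auto
  then have "2 powr (\<rho> / real m - \<rho>/2) \<le> 2 powr (0::real)" by (intro powr_mono) auto
  then show ?thesis by (simp add: gap_const_def)
qed

text \<open>Block j at scale n has length h = T / 2^(n+2) and is cut into m equal pieces. A gap
  longer than T / 2^(n+1) = 2 h contains a complete block, which explains the n + 2.\<close>

definition grid_point :: "real \<Rightarrow> nat \<Rightarrow> nat \<Rightarrow> nat \<Rightarrow> nat \<Rightarrow> real" where
  "grid_point T m n j i = (real j + real i / real m) * (T / 2^(n+2))"

lemma grid_point_bounds:
  assumes "0 < T" "i \<le> m" "0 < m"
  shows "real j * (T / 2^(n+2)) \<le> grid_point T m n j i" "grid_point T m n j i \<le> (real j + 1) * (T / 2^(n+2))"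
  unfolding grid_point_def using assms by (intro mult_right_mono; simp)+

lemma grid_point_nonneg: "0 < T \<Longrightarrow> 0 \<le> grid_point T m n j i"
  by (simp add: grid_point_def)

lemma grid_point_Suc:
  assumes "0 < m"
  shows "grid_point T m n j (Suc i) - grid_point T m n j i = T / (2^(n+2) * real m)"
  using assms by (simp add: grid_point_def field_simps)

context brownian
begin

definition small_block :: "real \<Rightarrow> real \<Rightarrow> nat \<Rightarrow> nat \<Rightarrow> nat \<Rightarrow> 'a set" where
  "small_block e T m n j = {\<omega> \<in> space M. \<forall>i<m.
     \<bar>B (grid_point T m n j (Suc i)) \<omega> - B (grid_point T m n j i) \<omega>\<bar> \<le> 2 * e}"

lemma sets_small_block [measurable]: "0 < T \<Longrightarrow> small_block e T m n j \<in> sets M"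
proof -
  assume "0 < T"
  then have [measurable]: "B (grid_point T m n j i) \<in> borel_measurable M" for i
    by (intro measurable_B grid_point_nonneg)
  show ?thesis unfolding small_block_def by measurable
qed

lemma prob_small_block:
  assumes T: "0 < T" and e: "0 < e" and m: "0 < m"
  shows "prob (small_block e T m n j) \<le> (2 * e / sqrt (T / (2^(n+2) * real m))) ^ m"
proof -
  let ?u = "grid_point T m n j"
  let ?X = "\<lambda>i \<omega>. B (?u (Suc i)) \<omega> - B (?u i) \<omega>"
  have d: "0 < T / (2^(n+2) * real m)" using T m by simp
  have lt: "?u i < ?u (Suc i)" for i using grid_point_Suc[OF m, of T n j i] d by linarith
  have set: "small_block e T m n j = (\<Inter>i\<in>{..<m}. ?X i -` {- (2 * e)..2 * e} \<inter> space M)"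
    using m by (auto simp: small_block_def abs_le_iff)
  have "prob (small_block e T m n j) = (\<Prod>i\<in>{..<m}. prob (?X i -` {- (2 * e)..2 * e} \<inter> space M))"
    unfolding set
    by (rule indep_varsD_finite[OF increments_indep]) (use m T lt in \<open>auto simp: grid_point_nonneg less_imp_le\<close>)
  also have "\<dots> \<le> (\<Prod>i\<in>{..<m}. 2 * e / sqrt (T / (2^(n+2) * real m)))"
  proof (rule prod_mono, intro conjI)
    fix i
    have "?X i -` {- (2 * e)..2 * e} \<inter> space M = {\<omega> \<in> space M. \<bar>B (?u (Suc i)) \<omega> - B (?u i) \<omega>\<bar> \<le> 2 * e}"
      by (auto simp: abs_le_iff)
    then show "prob (?X i -` {- (2 * e)..2 * e} \<inter> space M) \<le> 2 * e / sqrt (T / (2^(n+2) * real m))"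
      using increment_small_ball[OF grid_point_nonneg[OF T] lt e] by (simp only: grid_point_Suc[OF m])
  qed simp
  finally show ?thesis by simp
qed

definition gap_event :: "real \<Rightarrow> real \<Rightarrow> nat \<Rightarrow> nat \<Rightarrow> 'a set" where
  "gap_event e T m n = (\<Union>j<2^(n+2). small_block e T m n j)"

lemma sets_gap_event [measurable]: "0 < T \<Longrightarrow> gap_event e T m n \<in> sets M"
  unfolding gap_event_def by (intro sets.finite_UN) auto

lemma prob_gap_event:
  assumes T: "0 < T" and e: "0 < e" and m: "0 < m"
  shows "prob (gap_event e T m n) \<le> 2^(n+2) * (2 * e / sqrt (T / (2^(n+2) * real m))) ^ m"
proof -
  have "prob (gap_event e T m n) \<le> (\<Sum>j<(2::nat)^(n+2). prob (small_block e T m n j))"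
    unfolding gap_event_def by (rule finite_measure_subadditive_finite) (use T in auto)
  also have "\<dots> \<le> (\<Sum>j<(2::nat)^(n+2). (2 * e / sqrt (T / (2^(n+2) * real m))) ^ m)"
    by (intro sum_mono prob_small_block assms)
  also have "\<dots> = 2^(n+2) * (2 * e / sqrt (T / (2^(n+2) * real m))) ^ m"
    by (simp only: sum_constant card_lessThan) simp
  finally show ?thesis .
qed

text \<open>A gap of length in (T / 2^(n+1), T / 2^n] forces \<open>gap_event\<close> at scale n, so
  the summand of index n alone dominates its power \<rho>. The sum therefore dominates this power of
  every gap at once and is visibly measurable.\<close>

definition gap_var :: "real \<Rightarrow> real \<Rightarrow> nat \<Rightarrow> real \<Rightarrow> 'a \<Rightarrow> ennreal" where
  "gap_var e T m \<rho> \<omega> = (\<Sum>n. ennreal ((T / 2^n) powr \<rho>) * indicator (gap_event e T m n) \<omega>)"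

lemma measurable_gap_var [measurable]: "0 < T \<Longrightarrow> gap_var e T m \<rho> \<in> borel_measurable M"
  unfolding gap_var_def by measurable

lemma nn_integral_gap_var:
  assumes T: "0 < T" and e: "0 < e" and m: "2 < m" and \<rho>: "0 < \<rho>" "\<rho> \<le> real m"
  shows "(\<integral>\<^sup>+\<omega>. gap_var e T m \<rho> \<omega> \<partial>M) \<le> ennreal (gap_const \<rho> m T * e powr \<rho>)"
proof -
  let ?A = "T powr \<rho> * 2 powr \<rho> * (real m / T) powr (\<rho>/2) * 4 powr (\<rho> / real m + \<rho>/2) * e powr \<rho>"
  let ?z = "2 powr (\<rho> / real m - \<rho>/2)"
  have m0: "0 < m" using m by simp
  have term_le: "(T / 2^n) powr \<rho> * prob (gap_event e T m n) \<le> ?A * ?z ^ n" for n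
  proof -
    let ?P = "prob (gap_event e T m n)"
    let ?\<alpha> = "\<rho> / real m"
    have \<alpha>: "0 < ?\<alpha>" "?\<alpha> \<le> 1" using m \<rho> by auto
    \<comment> \<open>A probability is at most its power \<rho> / m, since \<rho> <= m. This turns
      the factor e^m coming from m increments into the wanted e^\<rho>.\<close>
    have "?P \<le> ?P powr ?\<alpha>"
    proof (cases "?P = 0")
      case False
      then have "?P powr 1 \<le> ?P powr ?\<alpha>" using \<alpha> by (intro powr_mono') auto
      then show ?thesis by simp
    qed simp
    also have "\<dots> \<le> (2^(n+2) * (2 * e / sqrt (T / (2^(n+2) * real m))) ^ m) powr ?\<alpha>"
      using \<alpha> prob_gap_event[OF T e m0] by (intro powr_mono2) auto
    finally have "(T / 2^n) powr \<rho> * ?P \<le> (T / 2^n) powr \<rho> * (2^(n+2) * (2 * e / sqrt (T / (2^(n+2) * real m))) ^ m) powr ?\<alpha>"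
      by (intro mult_left_mono) auto
    then show ?thesis unfolding gap_scale_powr[OF T e m0] .
  qed
  have "\<rho> / real m < \<rho> / 2" using m \<rho> by (intro divide_strict_left_mono) auto
  then have "?z < 2 powr 0" by (intro powr_less_mono) auto
  then have z: "0 \<le> ?z" "?z < 1" by auto
  have sums: "(\<lambda>n. ?A * ?z ^ n) sums (?A * (1 / (1 - ?z)))"
    by (intro sums_mult geometric_sums) (use z in auto)
  have "(\<integral>\<^sup>+\<omega>. gap_var e T m \<rho> \<omega> \<partial>M) = (\<Sum>n. ennreal ((T / 2^n) powr \<rho> * prob (gap_event e T m n)))"
    unfolding gap_var_def using T
    by (subst nn_integral_suminf) (auto simp: nn_integral_cmult_indicator emeasure_eq_measure ennreal_mult')
  also have "\<dots> \<le> (\<Sum>n. ennreal (?A * ?z ^ n))"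
    by (intro suminf_le ennreal_leI term_le) auto
  also have "\<dots> = ennreal (?A * (1 / (1 - ?z)))"
    using sums z by (intro suminf_ennreal_eq) auto
  finally show ?thesis by (simp add: gap_const_def mult_ac)
qed

text \<open>During a gap the path stays within e of its value at the last hit, so all increments
  inside the gap are at most 2 * e. It remains to find a full grid block within it.\<close>

lemma last_time_gap_le_gap_var:
  assumes \<omega>: "\<omega> \<in> space M" and T: "0 < T" and e: "0 < e" and m: "0 < m" and \<rho>: "0 < \<rho>" and t: "0 \<le> t" "t \<le> T"
  shows "ennreal ((t - last_time e (\<lambda>s. B s \<omega>) t) powr \<rho>) \<le> gap_var e T m \<rho> \<omega>"
proof -
  let ?l = "last_time e (\<lambda>s. B s \<omega>) t"
  define g where "g = t - ?l"
  note lt = last_time_bounds[OF cont_paths[OF \<omega>] e t(1)]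
  have g0: "0 \<le> g" "g \<le> T" using lt(1,2) t by (auto simp: g_def)
  show ?thesis
  proof (cases "g = 0")
    case False
    then have g: "0 < g / T" "g / T \<le> 1" using g0 T by auto
    obtain k where "(1/2)^k < g / T" using real_arch_pow_inv[of "g / T" "1/2"] g by auto
    define k0 where "k0 = (LEAST k. (1/2)^k < g / T)"
    have k0: "(1/2)^k0 < g / T" unfolding k0_def by (rule LeastI) fact
    then obtain n where n: "k0 = Suc n" using g by (cases k0) auto
    have "\<not> (1/2)^n < g / T" using not_less_Least[of n "\<lambda>k. (1/2)^k < g / T"] n by (simp add: k0_def)
    then have gn: "g \<le> T / 2^n" "T / 2^(n+1) < g" using k0 n T by (auto simp: field_simps power_divide)
    let ?h = "T / 2^(n+2)"
    have h: "0 < ?h" using T by simp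
    have "T / 2^(n+1) = 2 * ?h" by simp
    then have hg: "2 * ?h < g" using gn by linarith
    \<comment> \<open>The first grid index at or after the last hit: the block starts less than h
      later and ends before t, the gap exceeding 2 h, while t <= T keeps j in range.\<close>
    define j where "j = nat \<lceil>?l / ?h\<rceil>"
    have "0 \<le> \<lceil>?l / ?h\<rceil>" using lt(1) h by (metis ceiling_mono ceiling_zero divide_nonneg_pos)
    then have "real j = of_int \<lceil>?l / ?h\<rceil>" by (simp add: j_def)
    then have "?l / ?h \<le> real j" "real j < ?l / ?h + 1" by linarith+
    moreover have "l \<le> i * h \<and> i * h < l + h" if "l / h \<le> i" "i < l / h + 1" "0 < h" for l h i :: real
      using that by (simp add: field_simps)
    ultimately have lj: "?l \<le> real j * ?h" "real j * ?h < ?l + ?h"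
      using h by blast+
    then have tj: "(real j + 1) * ?h \<le> t" using hg unfolding g_def by (simp only: distrib_right)
    have "real j * ?h < 2^(n+2) * ?h" 
    proof -
      have "2^(n+2) * ?h = T" by simp
      then show ?thesis using tj t(2) h unfolding distrib_right by linarith
    qed
    then have "real j < 2^(n+2)" using h by (simp only: mult_less_cancel_right_pos)
    then have j: "j < 2^(n+2)" by (metis of_nat_less_iff of_nat_numeral of_nat_power)
    have "\<omega> \<in> small_block e T m n j"
      unfolding small_block_def
    proof (intro CollectI conjI \<omega> allI impI)
      fix i assume i: "i < m"
      have close: "\<bar>B (grid_point T m n j i') \<omega> - B ?l \<omega>\<bar> < e" if "i' \<le> m" for i'
        using grid_point_bounds[OF T that m, where j=j and n=n] lj(1) tj by (intro lt(5)) linarith+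
      show "\<bar>B (grid_point T m n j (Suc i)) \<omega> - B (grid_point T m n j i) \<omega>\<bar> \<le> 2 * e"
        using close[of i] close[of "Suc i"] i by auto
    qed
    then have ev: "\<omega> \<in> gap_event e T m n" using j unfolding gap_event_def by blast
    define S where "S n = ennreal ((T / 2^n) powr \<rho>) * indicator (gap_event e T m n) \<omega>" for n
    have "ennreal (g powr \<rho>) \<le> ennreal ((T / 2^n) powr \<rho>)"
      using gn g0 \<rho> by (intro ennreal_leI powr_mono2) auto
    also have "\<dots> = sum S {n}" using ev by (simp add: S_def)
    also have "\<dots> \<le> suminf S" by (rule sum_le_suminf) auto
    also have "suminf S = gap_var e T m \<rho> \<omega>" unfolding gap_var_def S_def ..
    finally show ?thesis by (simp add: g_def)
  qed (simp add: g_def[symmetric])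
qed

end

section \<open>The normalising constant\<close>

text \<open>The half-open intervals are pairwise disjoint because the nodes increase, so all cross
  terms vanish.\<close>

lemma step_fun_square:
  assumes "\<forall>i<n. u i \<le> u (Suc i)"
  shows "(step_fun n u a s)\<^sup>2 = (\<Sum>i<n. (a i)\<^sup>2 * indicator {u i<..u (Suc i)} s)"
  using assms
proof (induction n)
  case (Suc n)
  have mono: "u i \<le> u j" if "i \<le> j" "j \<le> Suc n" for i j
    using that Suc.prems by (induction j) (auto simp: le_Suc_eq less_Suc_eq intro: order_trans)
  have "step_fun n u a s * indicator {u n<..u (Suc n)} s = 0"
  proof (cases "s \<in> {u n<..u (Suc n)}")
    case True
    have "indicator {u i<..u (Suc i)} s = (0 :: real)" if "i < n" for i
      using True mono[of "Suc i" n] that by (auto simp: indicator_def)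
    then show ?thesis by (simp add: step_fun_def)
  qed simp
  then have "(step_fun n u a s + a n * indicator {u n<..u (Suc n)} s)\<^sup>2 =
     (step_fun n u a s)\<^sup>2 + (a n)\<^sup>2 * indicator {u n<..u (Suc n)} s"
    by (cases "s \<in> {u n<..u (Suc n)}") (auto simp: power2_sum power_mult_distrib)
  then show ?case using Suc by (simp add: step_fun_def)
qed (simp add: step_fun_def)

context brownian
begin

lemma increment_moments:
  assumes "0 \<le> s" "s \<le> t"
  shows "integrable M (\<lambda>\<omega>. B t \<omega> - B s \<omega>)" "expectation (\<lambda>\<omega>. B t \<omega> - B s \<omega>) = 0"
    "integrable M (\<lambda>\<omega>. (B t \<omega> - B s \<omega>)\<^sup>2)" "expectation (\<lambda>\<omega>. (B t \<omega> - B s \<omega>)\<^sup>2) = t - s"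
proof -
  have [measurable]: "B t \<in> borel_measurable M" "B s \<in> borel_measurable M"
    using assms by (auto intro!: measurable_B)
  show sq: "integrable M (\<lambda>\<omega>. (B t \<omega> - B s \<omega>)\<^sup>2)" "expectation (\<lambda>\<omega>. (B t \<omega> - B s \<omega>)\<^sup>2) = t - s"
  proof -
    have "(\<integral>\<^sup>+\<omega>. ennreal ((B t \<omega> - B s \<omega>)\<^sup>2) \<partial>M) = ennreal (t - s)"
    proof (cases "s = t")
      case False
      then show ?thesis using increment_moment_even[of s t 1] assms by (simp add: fact_2 numeral_2_eq_2)
    qed simp
    then show "integrable M (\<lambda>\<omega>. (B t \<omega> - B s \<omega>)\<^sup>2)" "expectation (\<lambda>\<omega>. (B t \<omega> - B s \<omega>)\<^sup>2) = t - s"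
      using assms nn_integral_eq_integrable[of "\<lambda>\<omega>. (B t \<omega> - B s \<omega>)\<^sup>2" M "t - s"] by auto
  qed
  show "integrable M (\<lambda>\<omega>. B t \<omega> - B s \<omega>)"
    by (rule square_integrable_imp_integrable[OF _ sq(1)]) measurable
  show "expectation (\<lambda>\<omega>. B t \<omega> - B s \<omega>) = 0"
  proof (cases "s = t")
    case False
    then show ?thesis using normal_distributed_expectation[OF _ increment_distributed[of s t]] assms by simp
  qed simp
qed

text \<open>The Ito isometry for step functions: off-diagonal products have expectation 0, because
  distinct increments are independent and centred.\<close>

lemma step_integral_second_moment:
  assumes u: "0 \<le> u 0" "\<forall>i<n. u i \<le> u (Suc i)"
  shows "(\<integral>\<^sup>+\<omega>. ennreal ((step_integral B n u a \<omega>)\<^sup>2) \<partial>M) = ennreal (\<Sum>i<n. (a i)\<^sup>2 * (u (Suc i) - u i))"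
proof -
  let ?X = "\<lambda>i \<omega>. B (u (Suc i)) \<omega> - B (u i) \<omega>"
  have u0: "i \<le> n \<Longrightarrow> 0 \<le> u i" for i
    by (induction i) (use u in \<open>auto intro: order_trans simp: less_Suc_eq_le Suc_le_eq\<close>)
  have ui: "0 \<le> u i" "u i \<le> u (Suc i)" if "i < n" for i using u0[of i] u that by auto
  note mom = increment_moments[OF ui]
  have pair: "integrable M (\<lambda>\<omega>. ?X i \<omega> * ?X j \<omega>) \<and> expectation (\<lambda>\<omega>. ?X i \<omega> * ?X j \<omega>) = (if i = j then u (Suc i) - u i else 0)"
    if ij: "i < n" "j < n" for i j
  proof (cases "i = j")
    case True
    then show ?thesis using mom(3,4)[OF ij(1) ij(1)] by (simp add: power2_eq_square)
  next
    case False
    have indep: "indep_vars (\<lambda>_. borel) ?X {i, j}"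
      by (rule indep_vars_subset[OF increments_indep[of u n]]) (use u ij in auto)
    have "integrable M (\<lambda>\<omega>. \<Prod>k\<in>{i,j}. ?X k \<omega>)" "expectation (\<lambda>\<omega>. \<Prod>k\<in>{i,j}. ?X k \<omega>) = (\<Prod>k\<in>{i,j}. expectation (?X k))"
      using mom ij by (intro indep_vars_integrable indep_vars_lebesgue_integral indep; auto)+
    then show ?thesis using False mom(2) ij by simp
  qed
  have sq: "(step_integral B n u a \<omega>)\<^sup>2 = (\<Sum>i<n. \<Sum>j<n. a i * a j * (?X i \<omega> * ?X j \<omega>))" for \<omega>
    by (simp add: step_integral_def power2_eq_square sum_product mult_ac)
  have int: "integrable M (\<lambda>\<omega>. (step_integral B n u a \<omega>)\<^sup>2)"
    unfolding sq using pair by (intro Bochner_Integration.integrable_sum integrable_mult_right) auto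
  have "expectation (\<lambda>\<omega>. (step_integral B n u a \<omega>)\<^sup>2) = (\<Sum>i<n. \<Sum>j<n. a i * a j * (if i = j then u (Suc i) - u i else 0))"
    unfolding sq using pair
    by (subst Bochner_Integration.integral_sum, force intro!: Bochner_Integration.integrable_sum integrable_mult_right)
      (intro sum.cong refl, subst Bochner_Integration.integral_sum, auto intro!: sum.cong integrable_mult_right)
  also have "\<dots> = (\<Sum>i<n. (a i)\<^sup>2 * (u (Suc i) - u i))"
    by (intro sum.cong refl) (simp add: if_distrib sum.delta power2_eq_square cong: if_cong)
  finally show ?thesis
    using int by (subst nn_integral_eq_integral) auto
qed

lemma step_fun_L2_le:
  assumes u: "0 \<le> u 0" "\<forall>i<n. u i \<le> u (Suc i)"
  shows "(\<integral>\<^sup>+s\<in>A. ennreal ((step_fun n u a s)\<^sup>2) \<partial>lborel) \<le> (\<integral>\<^sup>+\<omega>. ennreal ((step_integral B n u a \<omega>)\<^sup>2) \<partial>M)"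
proof -
  have "(\<integral>\<^sup>+s\<in>A. ennreal ((step_fun n u a s)\<^sup>2) \<partial>lborel) \<le> (\<integral>\<^sup>+s. ennreal ((step_fun n u a s)\<^sup>2) \<partial>lborel)"
    by (intro nn_integral_mono) (auto simp: indicator_def)
  also have "\<dots> = (\<integral>\<^sup>+s. (\<Sum>i<n. ennreal ((a i)\<^sup>2) * indicator {u i<..u (Suc i)} s) \<partial>lborel)"
    unfolding step_fun_square[OF u(2)]
    by (intro nn_integral_cong) (auto simp: sum_ennreal[symmetric] ennreal_mult' ennreal_indicator intro!: sum.cong simp del: sum_ennreal)
  also have "\<dots> = (\<Sum>i<n. ennreal ((a i)\<^sup>2) * ennreal (u (Suc i) - u i))"
    using u(2) by (subst nn_integral_sum) (auto simp: nn_integral_cmult_indicator intro!: sum.cong)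
  also have "\<dots> = ennreal (\<Sum>i<n. (a i)\<^sup>2 * (u (Suc i) - u i))"
    using u(2) by (subst sum_ennreal[symmetric]) (auto simp: ennreal_mult')
  finally show ?thesis unfolding step_integral_second_moment[OF u] .
qed

text \<open>The factor 4 = 2 * 2 arises from using x^2 <= 2 (x - y)^2 + 2 y^2 twice, once to pass
  from f to step functions and once to pass from their integrals to X. The inequality turns the
  variance of X into a bound on the kernel, and so on c.\<close>

lemma wiener_integral_L2_le:
  assumes "wiener_integral M B t f X"
  shows "(\<integral>\<^sup>+s\<in>{0<..<t}. ennreal ((f s)\<^sup>2) \<partial>lborel) \<le> 4 * (\<integral>\<^sup>+\<omega>. ennreal ((X \<omega>)\<^sup>2) \<partial>M)"
proof -
  from assms obtain n u a where X: "X \<in> borel_measurable M" and f: "set_borel_measurable lborel {0<..<t} f"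
    and u: "\<And>m. 0 \<le> u m 0 \<and> (\<forall>i<n m. u m i \<le> u m (Suc i)) \<and> u m (n m) \<le> t"
    and l1: "(\<lambda>m. \<integral>\<^sup>+s\<in>{0<..<t}. ennreal ((f s - step_fun (n m) (u m) (a m) s)\<^sup>2) \<partial>lborel) \<longlonglongrightarrow> 0"
    and l2: "(\<lambda>m. \<integral>\<^sup>+\<omega>. ennreal ((X \<omega> - step_integral B (n m) (u m) (a m) \<omega>)\<^sup>2) \<partial>M) \<longlonglongrightarrow> 0"
    unfolding wiener_integral_def by blast
  note [measurable] = X
  let ?A = "{0<..<t}"
  let ?I = "\<lambda>m. step_integral B (n m) (u m) (a m)"
  let ?F = "\<lambda>m. step_fun (n m) (u m) (a m)"
  have sq: "ennreal (x\<^sup>2) \<le> 2 * ennreal ((x - y)\<^sup>2) + 2 * ennreal (y\<^sup>2)" for x y :: real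
  proof -
    have "x\<^sup>2 \<le> 2 * (x - y)\<^sup>2 + 2 * y\<^sup>2" using zero_le_power2[of "x - 2 * y"] by (simp add: power2_eq_square algebra_simps)
    then have "ennreal (x\<^sup>2) \<le> ennreal (2 * (x - y)\<^sup>2 + 2 * y\<^sup>2)" by (rule ennreal_leI)
    then show ?thesis by (simp add: ennreal_mult')
  qed
  have bound: "(\<integral>\<^sup>+s\<in>?A. ennreal ((f s)\<^sup>2) \<partial>lborel) \<le>
     2 * (\<integral>\<^sup>+s\<in>?A. ennreal ((f s - ?F m s)\<^sup>2) \<partial>lborel) + 2 * (2 * (\<integral>\<^sup>+\<omega>. ennreal ((X \<omega> - ?I m \<omega>)\<^sup>2) \<partial>M)
       + 2 * (\<integral>\<^sup>+\<omega>. ennreal ((X \<omega>)\<^sup>2) \<partial>M))" for m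
  proof -
    have ui: "0 \<le> u m i" if "i \<le> n m" for i
      using that by (induction i) (use u[of m] in \<open>auto intro: order_trans simp: less_Suc_eq_le Suc_le_eq\<close>)
    have [measurable]: "?I m \<in> borel_measurable M"
      unfolding step_integral_def using ui
      by (intro borel_measurable_sum borel_measurable_times borel_measurable_diff measurable_B borel_measurable_const) auto
    have [measurable]: "?F m \<in> borel_measurable borel"
      unfolding step_fun_def[abs_def] by measurable
    have [measurable]: "(\<lambda>s. indicator ?A s * f s) \<in> borel_measurable borel"
      using f by (simp add: set_borel_measurable_def)
    have m1: "(\<lambda>s. ennreal ((f s - ?F m s)\<^sup>2) * indicator ?A s) \<in> borel_measurable lborel"
    proof -
      have "(\<lambda>s. ennreal ((indicator ?A s * f s - ?F m s)\<^sup>2) * indicator ?A s) \<in> borel_measurable lborel" by measurable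
      also have "(\<lambda>s. ennreal ((indicator ?A s * f s - ?F m s)\<^sup>2) * indicator ?A s) = (\<lambda>s. ennreal ((f s - ?F m s)\<^sup>2) * indicator ?A s)"
        by (auto simp: indicator_def)
      finally show ?thesis .
    qed
    have "(\<integral>\<^sup>+s\<in>?A. ennreal ((f s)\<^sup>2) \<partial>lborel) \<le> 
      (\<integral>\<^sup>+s. 2 * (ennreal ((f s - ?F m s)\<^sup>2) * indicator ?A s) + 2 * (ennreal ((?F m s)\<^sup>2) * indicator ?A s) \<partial>lborel)"
      using sq by (intro nn_integral_mono) (auto simp: indicator_def)
    also have "\<dots> = 2 * (\<integral>\<^sup>+s\<in>?A. ennreal ((f s - ?F m s)\<^sup>2) \<partial>lborel) + 2 * (\<integral>\<^sup>+s\<in>?A. ennreal ((?F m s)\<^sup>2) \<partial>lborel)"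
      using m1 by (subst nn_integral_add) (auto simp: nn_integral_cmult)
    also have "(\<integral>\<^sup>+s\<in>?A. ennreal ((?F m s)\<^sup>2) \<partial>lborel) \<le> (\<integral>\<^sup>+\<omega>. ennreal ((?I m \<omega>)\<^sup>2) \<partial>M)"
      using u by (intro step_fun_L2_le) auto
    also have "\<dots> \<le> (\<integral>\<^sup>+\<omega>. 2 * ennreal ((X \<omega> - ?I m \<omega>)\<^sup>2) + 2 * ennreal ((X \<omega>)\<^sup>2) \<partial>M)"
      using sq[of "?I m _" "X _"] by (intro nn_integral_mono) (simp add: power2_commute)
    also have "\<dots> = 2 * (\<integral>\<^sup>+\<omega>. ennreal ((X \<omega> - ?I m \<omega>)\<^sup>2) \<partial>M) + 2 * (\<integral>\<^sup>+\<omega>. ennreal ((X \<omega>)\<^sup>2) \<partial>M)"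
      by (subst nn_integral_add) (auto simp: nn_integral_cmult)
    finally show ?thesis by (simp add: add_left_mono mult_left_mono)
  qed
  have "(\<lambda>m. 2 * (\<integral>\<^sup>+s\<in>?A. ennreal ((f s - ?F m s)\<^sup>2) \<partial>lborel) + 2 * (2 * (\<integral>\<^sup>+\<omega>. ennreal ((X \<omega> - ?I m \<omega>)\<^sup>2) \<partial>M)
       + 2 * (\<integral>\<^sup>+\<omega>. ennreal ((X \<omega>)\<^sup>2) \<partial>M))) \<longlonglongrightarrow> 2 * 0 + 2 * (2 * 0 + 2 * (\<integral>\<^sup>+\<omega>. ennreal ((X \<omega>)\<^sup>2) \<partial>M))"
    by (intro tendsto_add ennreal_tendsto_cmult l1 l2 tendsto_const) auto
  from LIMSEQ_le_const[OF this] bound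
  have "(\<integral>\<^sup>+s\<in>?A. ennreal ((f s)\<^sup>2) \<partial>lborel) \<le> 2 * (2 * (\<integral>\<^sup>+\<omega>. ennreal ((X \<omega>)\<^sup>2) \<partial>M))"
    by simp
  then show ?thesis by (simp flip: mult.assoc)
qed

text \<open>The variance at T is T^(2H), while on [T/2, T) the kernel is at least c times a positive
  constant, its second part being nonnegative. Comparing L2 norms bounds c in terms of H and T
  alone, which makes the final constant independent of M, B and c.\<close>

lemma fbm_constant_bound:
  assumes H: "0 < H" "H < 1/2" and T: "0 < T" and fc: "fbm_constant M B T H c"
  shows "0 < c" "c \<le> sqrt (8 * T powr (2 * H - 1)) / (T powr (2 * H - 1) * (T / 2) powr (1/2 - H))"
proof -
  from fc obtain X where c: "0 < c" and W: "wiener_integral M B T (\<lambda>s. K1 c H T s + K2 c H T s) (X T)"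
    and fbm: "fractional_brownian_motion M T H X"
    using T unfolding fbm_constant_def by force
  show "0 < c" by (rule c)
  have "T \<in> {0..T}" using T by simp
  then have "(\<integral>\<omega>. X T \<omega> * X T \<omega> \<partial>M) = 1/2 * (T powr (2 * H) + T powr (2 * H) - \<bar>T - T\<bar> powr (2 * H))"
    using fbm unfolding fractional_brownian_motion_def by blast
  then have "(\<integral>\<omega>. X T \<omega> * X T \<omega> \<partial>M) = T powr (2 * H)" by simp
  then have XX: "(\<integral>\<omega>. (X T \<omega>)\<^sup>2 \<partial>M) = T powr (2 * H)" by (simp add: power2_eq_square)
  moreover have "0 < T powr (2 * H)" using T by simp
  \<comment> \<open>A non-integrable function has integral 0 by convention, so a positive integral
    proves integrability.\<close>
  ultimately have "integrable M (\<lambda>\<omega>. (X T \<omega>)\<^sup>2)"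
    using not_integrable_integral_eq by fastforce
  then have EX: "(\<integral>\<^sup>+\<omega>. ennreal ((X T \<omega>)\<^sup>2) \<partial>M) = ennreal (T powr (2 * H))"
    by (subst nn_integral_eq_integral) (auto simp: XX)
  let ?k = "T powr (2 * H - 1) * (T / 2) powr (1/2 - H)"
  have k: "0 < ?k" using T by simp
  have low: "c * ?k \<le> K1 c H T s + K2 c H T s" if s: "T / 2 \<le> s" "s < T" for s
  proof -
    have "T powr (H - 1/2) * (T / 2) powr (1/2 - H) * T powr (H - 1/2) \<le> T powr (H - 1/2) * s powr (1/2 - H) * (T - s) powr (H - 1/2)"
      using s T H by (intro mult_mono powr_mono2 powr_mono2') auto
    moreover have "?k = T powr (H - 1/2) * (T / 2) powr (1/2 - H) * T powr (H - 1/2)"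
      using powr_add[of T "H - 1/2" "H - 1/2"] by simp
    ultimately have "?k \<le> T powr (H - 1/2) * s powr (1/2 - H) * (T - s) powr (H - 1/2)" by linarith
    then have "c * ?k \<le> c * (T powr (H - 1/2) * s powr (1/2 - H) * (T - s) powr (H - 1/2))"
      using c by (intro mult_left_mono) auto
    then have "c * ?k \<le> K1 c H T s" by (simp add: K1_def mult.assoc)
    moreover have "0 \<le> K2 c H T s"
      using s T c H by (subst K2_eq) (auto simp: theta_nonneg)
    ultimately show ?thesis by simp
  qed
  have "ennreal ((c * ?k)\<^sup>2 * (T / 2)) = ennreal ((c * ?k)\<^sup>2) * ennreal (T / 2)"
    using T by (intro ennreal_mult) auto
  also have "\<dots> = (\<integral>\<^sup>+s. ennreal ((c * ?k)\<^sup>2) * indicator {T/2<..<T} s \<partial>lborel)"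
    using T by (subst nn_integral_cmult_indicator) auto
  also have "\<dots> \<le> (\<integral>\<^sup>+s\<in>{0<..<T}. ennreal ((K1 c H T s + K2 c H T s)\<^sup>2) \<partial>lborel)"
    using low c k T by (intro nn_integral_mono) (auto simp: indicator_def intro!: ennreal_leI power_mono)
  also have "\<dots> \<le> 4 * ennreal (T powr (2 * H))"
    using wiener_integral_L2_le[OF W] unfolding EX .
  also have "\<dots> = ennreal (4 * T powr (2 * H))" by (simp add: ennreal_mult')
  finally have "(c * ?k)\<^sup>2 * (T / 2) \<le> 4 * T powr (2 * H)" by (subst (asm) ennreal_le_iff) auto
  then have "(c * ?k)\<^sup>2 \<le> 8 * T powr (2 * H - 1)"
    using T by (simp add: powr_diff field_simps)
  then have "c * ?k \<le> sqrt (8 * T powr (2 * H - 1))" by (rule real_le_rsqrt)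
  then show "c \<le> sqrt (8 * T powr (2 * H - 1)) / ?k" using k by (subst pos_le_divide_eq) auto
qed

end

section \<open>The moment bound\<close>

lemma powr_add_le:
  fixes x y p :: real
  assumes "0 \<le> x" "0 \<le> y" "0 \<le> p"
  shows "(x + y) powr p \<le> 2 powr p * (x powr p + y powr p)"
proof -
  have "(x + y) powr p \<le> (2 * max x y) powr p"
    using assms by (intro powr_mono2) auto
  also have "\<dots> = 2 powr p * max x y powr p" using assms by (simp add: powr_mult)
  also have "\<dots> \<le> 2 powr p * (x powr p + y powr p)"
    by (intro mult_left_mono) (auto simp: max_def)
  finally show ?thesis .
qed

text \<open>It reduces all smaller powers of L to the single high moment that is available.\<close>

lemma powr_le_one_plus:
  fixes x a b :: real
  assumes "0 \<le> x" "0 \<le> a" "a \<le> b"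
  shows "x powr a \<le> 1 + x powr b"
proof (cases "x \<le> 1")
  case True
  then have "x powr a \<le> 1" using assms by (simp add: powr_le1)
  then show ?thesis by (simp add: add_increasing2)
next
  case False
  then have "x powr a \<le> x powr b" using assms by (intro powr_mono) auto
  then show ?thesis by simp
qed

lemma young_scaled:
  fixes x y E :: real
  assumes "0 \<le> x" "0 \<le> y" "0 < E"
  shows "x * y \<le> E * x\<^sup>2 + y\<^sup>2 / E"
proof -
  have "0 \<le> (E * x - y)\<^sup>2 / E" using assms by simp
  also have "\<dots> = E * x\<^sup>2 - 2 * (x * y) + y\<^sup>2 / E"
    using assms by (simp add: power2_eq_square field_simps)
  finally have "2 * (x * y) \<le> E * x\<^sup>2 + y\<^sup>2 / E" by simp
  moreover have "0 \<le> x * y" using assms by simp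
  ultimately show ?thesis by linarith
qed

text \<open>The weight in Young's inequality is e^(rp) because g^(2rp) will have expectation of
  order e^(2rp): after division by e^(rp) both terms have order e^(rp). Lower powers of L are
  absorbed in 1 + L^k.\<close>

lemma error_powr_bound:
  fixes d P e r L g p k :: real
  assumes "0 \<le> d" "0 \<le> P" "0 < e" "0 < r" "r < 1" "0 \<le> L" "0 \<le> g" "1 \<le> p" "2 * p \<le> k"
    and d: "d \<le> P * (e powr r * L powr (1 - r) + L * g powr r)"
  shows "d powr p \<le> P powr p * 2 powr p * (2 * e powr (r * p) * (1 + L powr k) + e powr - (r * p) * g powr (2 * r * p))"
proof -
  let ?E = "e powr (r * p)"
  have "d powr p \<le> (P * (e powr r * L powr (1 - r) + L * g powr r)) powr p"
    using assms by (intro powr_mono2) auto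
  also have "\<dots> = P powr p * (e powr r * L powr (1 - r) + L * g powr r) powr p"
    using assms by (simp add: powr_mult)
  also have "\<dots> \<le> P powr p * (2 powr p * ((e powr r * L powr (1 - r)) powr p + (L * g powr r) powr p))"
    using assms by (intro mult_left_mono powr_add_le) auto
  also have "(e powr r * L powr (1 - r)) powr p = ?E * L powr ((1 - r) * p)"
    using assms by (simp add: powr_mult powr_powr)
  also have "(L * g powr r) powr p = L powr p * g powr (r * p)"
    using assms by (simp add: powr_mult powr_powr)
  also have "P powr p * (2 powr p * (?E * L powr ((1 - r) * p) + L powr p * g powr (r * p)))
    \<le> P powr p * (2 powr p * (2 * ?E * (1 + L powr k) + e powr - (r * p) * g powr (2 * r * p)))"
  proof (intro mult_left_mono)
    have "(1 - r) * p \<le> 1 * p" using assms by (intro mult_right_mono) auto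
    then have "(1 - r) * p \<le> k" using assms by linarith
    then have 1: "?E * L powr ((1 - r) * p) \<le> ?E * (1 + L powr k)"
      using assms by (intro mult_left_mono powr_le_one_plus) auto
    have "L powr p * g powr (r * p) \<le> ?E * (L powr p)\<^sup>2 + (g powr (r * p))\<^sup>2 / ?E"
      using assms by (intro young_scaled) auto
    also have "(L powr p)\<^sup>2 = L powr (2 * p)" by (simp add: power2_eq_square flip: powr_add)
    also have "(g powr (r * p))\<^sup>2 = g powr (2 * r * p)"
    proof -
      have "2 * r * p = r * p + r * p" by simp
      then show ?thesis by (simp only: powr_add power2_eq_square)
    qed
    also have "?E * L powr (2 * p) + g powr (2 * r * p) / ?E \<le> ?E * (1 + L powr k) + g powr (2 * r * p) / ?E"
      using assms by (intro add_right_mono mult_left_mono powr_le_one_plus) auto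
    finally have 2: "L powr p * g powr (r * p) \<le> ?E * (1 + L powr k) + e powr - (r * p) * g powr (2 * r * p)"
      by (simp add: powr_minus_divide)
    show "?E * L powr ((1 - r) * p) + L powr p * g powr (r * p) \<le> 2 * ?E * (1 + L powr k) + e powr - (r * p) * g powr (2 * r * p)"
      using 1 2 by linarith
  qed auto
  finally show ?thesis by (simp only: mult.assoc)
qed

lemma sup_norm_powr_le:
  assumes T: "0 \<le> T" and p: "0 < p" and f: "\<And>t. t \<in> {0..T} \<Longrightarrow> \<bar>f t\<bar> powr p \<le> Y"
  shows "sup_norm T f powr p \<le> Y"
proof -
  have Y: "0 \<le> Y" using f[of 0] T by (meson atLeastAtMost_iff order_refl order_trans powr_ge_zero)
  have le: "\<bar>f t\<bar> \<le> Y powr (1 / p)" if "t \<in> {0..T}" for t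
  proof -
    have "\<bar>f t\<bar> = (\<bar>f t\<bar> powr p) powr (1 / p)" using p by (simp add: powr_powr)
    also have "\<dots> \<le> Y powr (1 / p)" using f[OF that] p by (intro powr_mono2) auto
    finally show ?thesis .
  qed
  have "sup_norm T f \<le> Y powr (1 / p)"
    unfolding sup_norm_def using T by (intro cSUP_least le) auto
  moreover have "0 \<le> sup_norm T f"
    unfolding sup_norm_def using T le by (intro cSUP_upper2[where x=0] bdd_aboveI2[of _ _ "Y powr (1 / p)"]) auto
  ultimately have "sup_norm T f powr p \<le> (Y powr (1 / p)) powr p" using p by (intro powr_mono2) auto
  then show ?thesis using p Y by (simp add: powr_powr)
qed

section \<open>Measurability of the supremum of the error\<close>

text \<open>The preimages under f and g differ only inside a null set, all of whose subsets are
  measurable by completeness.\<close>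

lemma (in complete_measure) borel_measurable_AE_eq:
  assumes "f \<in> borel_measurable M" "AE x in M. f x = g x"
  shows "g \<in> borel_measurable M"
proof (rule measurableI)
  fix A :: "'b::topological_space set" assume A: "A \<in> sets borel"
  show "g -` A \<inter> space M \<in> sets M"
    by (rule in_sets_AE[OF _ measurable_sets[OF assms(1) A]]) (use assms(2) in auto)
qed simp

lemma last_time_right_constant:
  assumes "continuous_on {0..} b" "0 < e" "0 \<le> t"
  obtains t' where "t < t'" "\<And>s. t \<le> s \<Longrightarrow> s < t' \<Longrightarrow> last_time e b s = last_time e b t"
proof -
  obtain n where n: "hit_time e b n \<le> ereal t" "ereal t < hit_time e b (Suc n)"
    using ex_hit_index[OF assms] .
  obtain t' where t': "t < t'" "ereal t' \<le> hit_time e b (Suc n)"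
  proof (cases "hit_time e b (Suc n)")
    case (real x)
    then show ?thesis using that[of x] n by simp
  next
    case PInf
    then show ?thesis using that[of "t + 1"] by simp
  next
    case MInf
    then show ?thesis using n by simp
  qed
  show ?thesis
  proof (rule that[OF t'(1)])
    fix s assume s: "t \<le> s" "s < t'"
    have "hit_time e b n \<le> ereal s" using n(1) s by (meson ereal_less_eq(3) order_trans)
    moreover have "ereal s < hit_time e b (Suc n)" using t'(2) s by (meson ereal_less(3) less_ereal.simps(1) less_le_trans)
    ultimately show "last_time e b s = last_time e b t"
      using last_time_eq[OF assms(1,2)] n by metis
  qed
qed

context continuous_paths
begin

lemma measurable_J:
  assumes H: "0 < H" "H < 1/2" and [measurable]: "(\<lambda>x. F (fst x) (snd x)) \<in> borel_measurable (M \<Otimes>\<^sub>M borel)"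
  shows "(\<lambda>\<omega>. J1 H (F \<omega>)) \<in> borel_measurable M" "(\<lambda>\<omega>. J2 H (F \<omega>)) \<in> borel_measurable M"
proof -
  note [measurable] = borel_measurable_g2[OF H]
  have [measurable]: "(\<lambda>x. F (fst x) (snd x)) \<in> borel_measurable (M \<Otimes>\<^sub>M lborel)"
    using assms(3) by (simp cong: measurable_cong_sets)
  show "(\<lambda>\<omega>. J1 H (F \<omega>)) \<in> borel_measurable M"
    unfolding J1_def set_lebesgue_integral_def
    by (rule lborel.borel_measurable_lebesgue_integral) (simp add: case_prod_beta, measurable)
  show "(\<lambda>\<omega>. J2 H (F \<omega>)) \<in> borel_measurable M"
    unfolding J2_def set_lebesgue_integral_def
    by (rule lborel.borel_measurable_lebesgue_integral) (simp add: case_prod_beta, measurable)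
qed

lemma measurable_Lam:
  assumes H: "0 < H" "H < 1/2" and t: "0 \<le> t"
  shows "(\<lambda>\<omega>. Lam c H (\<lambda>s. B s \<omega>) t) \<in> borel_measurable M"
proof (cases "t = 0")
  case False
  then have t0: "0 < t" using t by simp
  have eq: "J1 H (\<lambda>u. B t \<omega> - B (t * u) \<omega>) = J1 H (\<lambda>u. Bp \<omega> t - Bp \<omega> (t * u))"
    "J2 H (\<lambda>u. B (t * u) \<omega>) = J2 H (\<lambda>u. Bp \<omega> (t * u))" for \<omega>
    unfolding J1_def J2_def using t0
    by (intro set_lebesgue_integral_cong; auto simp: Bp_def max_def zero_le_mult_iff)+
  have [measurable]: "(\<lambda>\<omega>. J1 H (\<lambda>u. Bp \<omega> t - Bp \<omega> (t * u))) \<in> borel_measurable M"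
    "(\<lambda>\<omega>. J2 H (\<lambda>u. Bp \<omega> (t * u))) \<in> borel_measurable M"
    by (rule measurable_J[OF H]; measurable)+
  show ?thesis unfolding Lam_scale[OF H t0] eq by measurable
qed simp

lemma measurable_fbm_approx:
  assumes H: "0 < H" "H < 1/2" and t: "0 \<le> t" and e: "0 < e"
  shows "(\<lambda>\<omega>. fbm_approx c H T e (\<lambda>s. B s \<omega>) t) \<in> borel_measurable M"
proof -
  note [measurable (raw)] = measurable_wlk[OF e] measurable_nxt[OF e] measurable_lst[OF e]
  let ?l = "\<lambda>\<omega>. lst e \<omega> t"
  let ?R = "\<lambda>\<omega>. if 0 < ?l \<omega> then c * ?l \<omega> powr (H - 1/2) *
      (J1 H (\<lambda>u. Bp \<omega> (?l \<omega>) - wlk e \<omega> (nxt T e \<omega> (?l \<omega> * u))) + J2 H (\<lambda>u. wlk e \<omega> (?l \<omega> * u))) else 0"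
  have [measurable]: "(\<lambda>\<omega>. J1 H (\<lambda>u. Bp \<omega> (?l \<omega>) - wlk e \<omega> (nxt T e \<omega> (?l \<omega> * u)))) \<in> borel_measurable M"
    "(\<lambda>\<omega>. J2 H (\<lambda>u. wlk e \<omega> (?l \<omega> * u))) \<in> borel_measurable M"
    by (rule measurable_J[OF H]; measurable)+
  have "?R \<in> borel_measurable M" by measurable
  moreover have "?R \<omega> = fbm_approx c H T e (\<lambda>s. B s \<omega>) t" if \<omega>: "\<omega> \<in> space M" for \<omega>
  proof (cases "0 < ?l \<omega>")
    case True
    note lt = last_time_eq_lst[OF e \<omega> t]
    have "J1 H (\<lambda>u. B (?l \<omega>) \<omega> - walk e (\<lambda>s. B s \<omega>) (next_time T e (\<lambda>s. B s \<omega>) (?l \<omega> * u)))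
      = J1 H (\<lambda>u. Bp \<omega> (?l \<omega>) - wlk e \<omega> (nxt T e \<omega> (?l \<omega> * u)))"
      unfolding J1_def using True
      by (intro set_lebesgue_integral_cong) (auto simp: Bp_def wlk_def next_time_eq_nxt[OF e \<omega>])
    then show ?thesis
      using True fbm_approx_eq[OF cont_paths[OF \<omega>] B_0[OF \<omega>] e H t, of c T] by (simp add: lt wlk_def)
  next
    case False
    then have "last_time e (\<lambda>s. B s \<omega>) t = 0"
      using last_time_bounds(1)[OF cont_paths[OF \<omega>] e t] last_time_eq_lst[OF e \<omega> t] by simp
    then show ?thesis using False by (simp add: fbm_approx_last_time_0)
  qed
  ultimately show ?thesis by (subst measurable_cong[of M _ ?R]) auto
qed

end
context brownian
begin

text \<open>To the right of t the approximation stays constant until the next hit, so the increment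
  of the error is that of \<open>Lam\<close>, which is Hoelder continuous of order r.\<close>

lemma fbm_error_tendsto_right:
  assumes H: "0 < H" "H < 1/2" and r: "0 < r" and \<mu>: "1/2 - H < \<mu>" "r + \<mu> \<le> 1" and T: "0 < T" and e: "0 < e" and c: "0 \<le> c"
    and \<omega>: "\<omega> \<in> space M" and L: "0 \<le> L" "holder L (r + \<mu>) T (\<lambda>s. B s \<omega>)"
    and t: "0 \<le> t" "t < T"
  defines "D \<equiv> (\<lambda>t. fbm_approx c H T e (\<lambda>s. B s \<omega>) t - Lam c H (\<lambda>s. B s \<omega>) t)"
  shows "(D \<longlongrightarrow> D t) (at_right t)"
proof -
  let ?b = "\<lambda>s. B s \<omega>"
  note cont = cont_paths[OF \<omega>]
  obtain t' where t': "t < t'" "\<And>s. t \<le> s \<Longrightarrow> s < t' \<Longrightarrow> last_time e ?b s = last_time e ?b t"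
    using last_time_right_constant[OF cont e t(1)] by blast
  let ?K = "c * (3 * N1 H \<mu> + 2 * N2 H \<mu>) * T powr (\<mu> + H - 1/2) * L"
  have "\<bar>D s - D t\<bar> \<le> ?K * (s - t) powr r" if "t < s" "s < min t' T" for s
  proof -
    have "fbm_approx c H T e ?b s = fbm_approx c H T e ?b t"
      using that t t'(2)[of s] fbm_approx_eq_last_time[OF cont e, of s] fbm_approx_eq_last_time[OF cont e, of t] by simp
    then have "\<bar>D s - D t\<bar> = \<bar>Lam c H ?b s - Lam c H ?b t\<bar>" by (simp add: D_def)
    also have "\<dots> \<le> ?K * (s - t) powr r"
      using that t by (intro Lam_holder[OF H \<mu>(1) r \<mu>(2) T L(1) cont B_0[OF \<omega>] L(2) _ _ _ c]) auto
    finally show ?thesis .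
  qed
  then have "\<forall>\<^sub>F s in at_right t. norm (D s - D t) \<le> ?K * (s - t) powr r"
    using t t'(1) by (auto simp: eventually_at_right intro!: exI[of _ "min t' T"])
  moreover have "((\<lambda>s. ?K * (s - t) powr r) \<longlongrightarrow> 0) (at_right t)"
  proof -
    have "((\<lambda>s. ?K * (s - t) powr r) \<longlongrightarrow> ?K * (t - t) powr r) (at_right t)"
      using r by (intro tendsto_intros tendsto_powr2) (auto simp: eventually_at_right_less eventually_at_filter)
    then show ?thesis by simp
  qed
  ultimately have "((\<lambda>s. D s - D t) \<longlongrightarrow> 0) (at_right t)"
    by (rule Lim_null_comparison)
  then show ?thesis by (simp add: LIM_zero_iff)
qed

end

text \<open>A value of \<bar>f\<bar> above the countable supremum would persist at nearby rational
  times to the right. The end point T has no such times in [0, T] and is added by hand.\<close>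

lemma sup_norm_eq_rational_SUP:
  fixes f :: "real \<Rightarrow> real"
  assumes T: "0 < T" and bd: "bdd_above ((\<lambda>t. \<bar>f t\<bar>) ` {0..T})"
    and rc: "\<And>t. 0 \<le> t \<Longrightarrow> t < T \<Longrightarrow> (f \<longlongrightarrow> f t) (at_right t)"
  shows "sup_norm T f = enn2real (SUP q\<in>insert T (\<rat> \<inter> {0..T}). ennreal \<bar>f q\<bar>)"
proof -
  let ?Q = "insert T (\<rat> \<inter> {0..T})"
  let ?S = "SUP q\<in>?Q. ennreal \<bar>f q\<bar>"
  have le: "\<bar>f t\<bar> \<le> sup_norm T f" if "t \<in> {0..T}" for t
    unfolding sup_norm_def by (rule cSUP_upper[OF that bd])
  have S: "?S \<le> ennreal (sup_norm T f)"
    using T by (intro SUP_least ennreal_leI le) auto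
  then have fin: "?S < \<infinity>" by (rule le_less_trans) simp
  have "\<bar>f t\<bar> \<le> enn2real ?S" if t: "t \<in> {0..T}" for t
  proof -
    have q: "\<bar>f q\<bar> \<le> enn2real ?S" if "q \<in> ?Q" for q
    proof -
      have "ennreal \<bar>f q\<bar> \<le> ?S" by (rule SUP_upper[OF that])
      from enn2real_mono[OF this] fin show ?thesis by simp
    qed
    show ?thesis
    proof (cases "t = T")
      case False
      then have lt: "t < T" using t by simp
      show ?thesis
      proof (rule ccontr)
        assume "\<not> ?thesis"
        then have "enn2real ?S < \<bar>f t\<bar>" by simp
        moreover have "((\<lambda>s. \<bar>f s\<bar>) \<longlongrightarrow> \<bar>f t\<bar>) (at_right t)"
          using t lt by (intro tendsto_rabs rc) auto
        ultimately have "\<forall>\<^sub>F s in at_right t. enn2real ?S < \<bar>f s\<bar>"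
          by (intro order_tendstoD(1))
        then obtain b where b: "t < b" "\<And>s. t < s \<Longrightarrow> s < b \<Longrightarrow> enn2real ?S < \<bar>f s\<bar>"
          unfolding eventually_at_right[OF lt] by blast
        obtain s where s: "s \<in> \<rat>" "t < s" "s < min b T"
          using Rats_dense_in_real[of t "min b T"] b lt by auto
        then have "s \<in> ?Q" using t by auto
        from q[OF this] b(2)[of s] s show False by simp
      qed
    qed (use q in simp)
  qed
  then have "sup_norm T f \<le> enn2real ?S"
    unfolding sup_norm_def using T by (intro cSUP_least) auto
  moreover have "enn2real ?S \<le> sup_norm T f"
  proof -
    have "0 \<le> sup_norm T f" using le[of 0] T by (intro order_trans[OF abs_ge_zero]) auto
    then show ?thesis using enn2real_mono[OF S] by simp
  qed
  ultimately show ?thesis by simp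
qed

section \<open>Assembly of the constant and the moment bound\<close>

text \<open>The quotient with the square root is the bound on c from
  \<open>fbm_constant_bound\<close>, so neither the measure nor c enters.\<close>

definition error_const :: "real \<Rightarrow> real \<Rightarrow> real \<Rightarrow> real \<Rightarrow> nat \<Rightarrow> nat \<Rightarrow> real" where
  "error_const H r p T k m = (let \<kappa> = 1/2 - (H - r) / 2 in
     (sqrt (8 * T powr (2 * H - 1)) / (T powr (2 * H - 1) * (T / 2) powr (1/2 - H)) * path_const H (\<kappa> - r) r T) powr p
       * 2 powr p * (2 * (1 + chain_const \<kappa> T powr (2 * real k) * dyadic_const \<kappa> T k) + gap_const (2 * r * p) m T))"

context brownian
begin

lemma fbm_error_moment_bound:
  assumes compl: "complete_measure M" and fc: "fbm_constant M B T H c"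
    and H: "0 < H" "H < 1/2" and T: "0 < T" and p: "1 \<le> p" and r: "0 < r" "r < H" and e: "0 < e"
    and k: "p \<le> real k" "1 < real k * (H - r)" and m: "2 < m" "2 * r * p \<le> real m"
  defines "D \<equiv> (\<lambda>\<omega> t. fbm_approx c H T e (\<lambda>s. B s \<omega>) t - Lam c H (\<lambda>s. B s \<omega>) t)"
  shows "AE \<omega> in M. bdd_above ((\<lambda>t. \<bar>D \<omega> t\<bar>) ` {0..T})"
    and "integrable M (\<lambda>\<omega>. sup_norm T (D \<omega>) powr p)"
    and "(\<integral>\<omega>. sup_norm T (D \<omega>) powr p \<partial>M) \<le> error_const H r p T k m * e powr (r * p)"
proof -
  define \<kappa> where "\<kappa> = 1/2 - (H - r) / 2"
  define \<mu> where "\<mu> = \<kappa> - r"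
  define cmax where "cmax = sqrt (8 * T powr (2 * H - 1)) / (T powr (2 * H - 1) * (T / 2) powr (1/2 - H))"
  define P where "P = path_const H \<mu> r T"
  define \<rho> where "\<rho> = 2 * r * p"
  let ?V = "dyadic_var \<kappa> T k" and ?G = "gap_var e T m \<rho>"
  let ?Ch = "chain_const \<kappa> T powr (2 * real k)"
  have \<mu>: "1/2 - H < \<mu>" "r + \<mu> \<le> 1" "r + \<mu> = \<kappa>"
  proof -
    have "2 * \<kappa> = 1 - H + r" by (simp add: \<kappa>_def diff_divide_distrib)
    then show "1/2 - H < \<mu>" "r + \<mu> \<le> 1" "r + \<mu> = \<kappa>" unfolding \<mu>_def using H r by linarith+
  qed
  have \<kappa>: "0 < \<kappa>" using H r by (auto simp: \<kappa>_def)
  have r1: "1/2 - H < (r + \<mu>) * (1 - r)"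
  proof -
    have "\<kappa> * r \<le> 1/2 * r" using H r by (intro mult_right_mono) (auto simp: \<kappa>_def)
    moreover have "2 * \<kappa> = 1 - H + r" by (simp add: \<kappa>_def diff_divide_distrib)
    moreover have "\<kappa> * (1 - r) = \<kappa> - \<kappa> * r" by (simp add: right_diff_distrib)
    ultimately show ?thesis unfolding \<mu>(3) using H by linarith
  qed
  have k0: "0 < k" using k p by (cases k) auto
  have "1 - 2 * \<kappa> = H - r" by (simp add: \<kappa>_def diff_divide_distrib)
  then have kk: "1 < real k * (1 - 2 * \<kappa>)" using k by simp
  have \<rho>: "0 < \<rho>" "\<rho> \<le> real m" using r p m by (auto simp: \<rho>_def)
  have c: "0 \<le> c" "c \<le> cmax" using fbm_constant_bound[OF H T fc] by (auto simp: cmax_def)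
  have P: "0 \<le> P" unfolding P_def by (rule path_const_nonneg[OF H \<mu>(1) r1])
  have EV: "(\<integral>\<^sup>+\<omega>. ?V \<omega> \<partial>M) = ennreal (dyadic_const \<kappa> T k)" by (rule nn_integral_dyadic_var_eq[OF T kk])
  note mV = measurable_dyadic_var[of T \<kappa> k] and mG = measurable_gap_var[OF T, of e m \<rho>]
  note [measurable] = mV[OF less_imp_le[OF T]] mG
  have fin: "AE \<omega> in M. ?V \<omega> < \<infinity>"
    using nn_integral_PInf_AE[of ?V M] EV by (auto simp: less_top)
  define L where "L \<omega> = chain_const \<kappa> T * enn2real (?V \<omega>) powr (1 / (2 * real k))" for \<omega>
  have L0: "0 \<le> L \<omega>" for \<omega> using chain_const_nonneg[OF \<kappa>, of T] by (simp add: L_def)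
  have hold: "holder (L \<omega>) (r + \<mu>) T (\<lambda>s. B s \<omega>)" if "\<omega> \<in> space M" "?V \<omega> < \<infinity>" for \<omega>
    unfolding L_def \<mu>(3) using that by (intro holder_of_dyadic_var T \<kappa> k0)
  have err: "\<bar>D \<omega> t\<bar> \<le> cmax * P * (e powr r * L \<omega> powr (1 - r) + L \<omega> * (t - last_time e (\<lambda>s. B s \<omega>) t) powr r)"
    if "\<omega> \<in> space M" "?V \<omega> < \<infinity>" "0 \<le> t" "t \<le> T" for \<omega> t
  proof -
    have "\<bar>D \<omega> t\<bar> \<le> c * P * (e powr r * L \<omega> powr (1 - r) + L \<omega> * (t - last_time e (\<lambda>s. B s \<omega>) t) powr r)"
      unfolding D_def P_def using that
      by (intro fbm_approx_minus_Lam[OF H \<mu>(1) r(1) \<mu>(2) T L0 cont_paths B_0 hold r1 e c(1)])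
    also have "\<dots> \<le> cmax * P * (e powr r * L \<omega> powr (1 - r) + L \<omega> * (t - last_time e (\<lambda>s. B s \<omega>) t) powr r)"
      using c P L0 by (intro mult_right_mono) auto
    finally show ?thesis .
  qed
  have bdd: "bdd_above ((\<lambda>t. \<bar>D \<omega> t\<bar>) ` {0..T})" if \<omega>: "\<omega> \<in> space M" "?V \<omega> < \<infinity>" for \<omega>
  proof (rule bdd_aboveI2)
    fix t assume t: "t \<in> {0..T}"
    have "(t - last_time e (\<lambda>s. B s \<omega>) t) powr r \<le> T powr r"
      using last_time_bounds(1,2)[OF cont_paths[OF \<omega>(1)] e, of t] t r by (intro powr_mono2) auto
    then have "cmax * P * (e powr r * L \<omega> powr (1 - r) + L \<omega> * (t - last_time e (\<lambda>s. B s \<omega>) t) powr r)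
       \<le> cmax * P * (e powr r * L \<omega> powr (1 - r) + L \<omega> * T powr r)"
      using c P L0 by (intro mult_left_mono add_left_mono) auto
    then show "\<bar>D \<omega> t\<bar> \<le> cmax * P * (e powr r * L \<omega> powr (1 - r) + L \<omega> * T powr r)"
      using err[OF \<omega>, of t] t by auto
  qed
  show AE_bdd: "AE \<omega> in M. bdd_above ((\<lambda>t. \<bar>D \<omega> t\<bar>) ` {0..T})"
    using fin AE_space by eventually_elim (rule bdd)
  let ?Kp = "(cmax * P) powr p * 2 powr p"
  let ?E = "e powr (r * p)" and ?F = "e powr - (r * p)"
  have maj: "ennreal (sup_norm T (D \<omega>) powr p) \<le>
    ennreal ?Kp * (ennreal (2 * ?E) * (1 + ennreal ?Ch * ?V \<omega>) + ennreal ?F * ?G \<omega>)"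
    if \<omega>: "\<omega> \<in> space M" "?V \<omega> < \<infinity>" for \<omega>
  \<comment> \<open>\<open>enn2real\<close> sends infinity to 0, so the real-valued majorant is
    valid only where \<open>?G \<omega>\<close> is finite, or where \<open>?Kp\<close> vanishes and
    both sides are 0. Elsewhere the right-hand side is infinite.\<close>
  proof (cases "?G \<omega> < \<infinity> \<or> ?Kp = 0")
    case True
    have sup: "sup_norm T (D \<omega>) powr p \<le> ?Kp * (2 * ?E * (1 + ?Ch * enn2real (?V \<omega>)) + ?F * enn2real (?G \<omega>))"
    proof (rule sup_norm_powr_le)
      fix t assume t: "t \<in> {0..T}"
      let ?g = "t - last_time e (\<lambda>s. B s \<omega>) t"
      have g: "0 \<le> ?g" using last_time_bounds(2)[OF cont_paths[OF \<omega>(1)] e, of t] t by auto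
      have "\<bar>D \<omega> t\<bar> powr p \<le> ?Kp * (2 * ?E * (1 + L \<omega> powr (2 * real k)) + ?F * ?g powr (2 * r * p))"
        by (rule error_powr_bound) (use c P e r H L0 g p k err[OF \<omega>, of t] t in auto)
      also have "L \<omega> powr (2 * real k) = ?Ch * enn2real (?V \<omega>)"
        using chain_const_nonneg[OF \<kappa>, of T] k0 by (simp add: L_def powr_mult powr_powr)
      also have "?Kp * (2 * ?E * (1 + ?Ch * enn2real (?V \<omega>)) + ?F * ?g powr (2 * r * p))
        \<le> ?Kp * (2 * ?E * (1 + ?Ch * enn2real (?V \<omega>)) + ?F * enn2real (?G \<omega>))"
      proof (cases "?Kp = 0")
        case False
        with True have "?G \<omega> < top" by auto
        moreover have "ennreal (?g powr \<rho>) \<le> ?G \<omega>"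
          using \<omega>(1) t m by (intro last_time_gap_le_gap_var T e \<rho>) auto
        ultimately have "?g powr \<rho> \<le> enn2real (?G \<omega>)"
          using enn2real_mono[of "ennreal (?g powr \<rho>)" "?G \<omega>"] by simp
        then show ?thesis unfolding \<rho>_def by (intro mult_left_mono add_left_mono) auto
      next
        case True
        show ?thesis unfolding True mult_zero_left by (rule order_refl)
      qed
      finally show "\<bar>D \<omega> t\<bar> powr p \<le> ?Kp * (2 * ?E * (1 + ?Ch * enn2real (?V \<omega>)) + ?F * enn2real (?G \<omega>))" .
    qed (use T p in auto)
    show ?thesis
    proof (cases "?Kp = 0")
      case True
      have "sup_norm T (D \<omega>) powr p \<le> 0" using sup unfolding True mult_zero_left .
      then have "ennreal (sup_norm T (D \<omega>) powr p) = 0" by (rule ennreal_neg)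
      then show ?thesis by simp
    next
      case False
      with True have G: "ennreal (enn2real (?G \<omega>)) = ?G \<omega>" by auto
      have V: "ennreal (enn2real (?V \<omega>)) = ?V \<omega>" using \<omega>(2) by auto
      have "ennreal (?Kp * (2 * ?E * (1 + ?Ch * enn2real (?V \<omega>)) + ?F * enn2real (?G \<omega>)))
        = ennreal ?Kp * (ennreal (2 * ?E) * (1 + ennreal ?Ch * ennreal (enn2real (?V \<omega>))) + ennreal ?F * ennreal (enn2real (?G \<omega>)))"
        by (simp only: ennreal_mult' ennreal_plus powr_ge_zero enn2real_nonneg mult_nonneg_nonneg add_nonneg_nonneg zero_le_one zero_le_numeral ennreal_1)
      then show ?thesis using ennreal_leI[OF sup] unfolding V G by simp
    qed
  next
    case False
    then have G: "?G \<omega> = top" and K: "0 < ?Kp" by (auto simp: less_top[symmetric] order_less_le)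
    have mt: "ennreal x * top = top" if "0 < x" for x
      using that by (simp add: ennreal_mult_eq_top_iff)
    have F: "0 < ?F" using e by simp
    show ?thesis unfolding G mt[OF F] by (simp only: add_top_right_ennreal mt[OF K] top_greatest)
  qed
  have nn: "(\<integral>\<^sup>+\<omega>. ennreal (sup_norm T (D \<omega>) powr p) \<partial>M) \<le> ennreal (error_const H r p T k m * ?E)"
  proof -
    have "(\<integral>\<^sup>+\<omega>. ennreal (sup_norm T (D \<omega>) powr p) \<partial>M) \<le>
      (\<integral>\<^sup>+\<omega>. ennreal ?Kp * (ennreal (2 * ?E) * (1 + ennreal ?Ch * ?V \<omega>) + ennreal ?F * ?G \<omega>) \<partial>M)"
    proof (rule nn_integral_mono_AE)
      show "AE \<omega> in M. ennreal (sup_norm T (D \<omega>) powr p) \<le>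
          ennreal ?Kp * (ennreal (2 * ?E) * (1 + ennreal ?Ch * ?V \<omega>) + ennreal ?F * ?G \<omega>)"
        using fin AE_space by eventually_elim (rule maj)
    qed
    also have "\<dots> = ennreal ?Kp * (ennreal (2 * ?E) * (1 + ennreal ?Ch * (\<integral>\<^sup>+\<omega>. ?V \<omega> \<partial>M)) + ennreal ?F * (\<integral>\<^sup>+\<omega>. ?G \<omega> \<partial>M))"
      by (simp add: nn_integral_cmult nn_integral_add emeasure_space_1)
    also have "\<dots> \<le> ennreal ?Kp * (ennreal (2 * ?E) * (1 + ennreal ?Ch * ennreal (dyadic_const \<kappa> T k)) + ennreal ?F * ennreal (gap_const \<rho> m T * e powr \<rho>))"
      unfolding EV by (intro mult_left_mono add_left_mono nn_integral_gap_var T e m(1) \<rho>) auto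
    also have "\<dots> = ennreal (?Kp * (2 * ?E * (1 + ?Ch * dyadic_const \<kappa> T k) + ?F * (gap_const \<rho> m T * e powr \<rho>)))"
    proof -
      have "0 \<le> dyadic_const \<kappa> T k"
      proof -
        have "2 powr (1 + 2 * real k * \<kappa> - real k) < 2 powr (0::real)"
          using kk by (intro powr_less_mono) (auto simp: algebra_simps)
        then show ?thesis using T by (auto simp: dyadic_const_def)
      qed
      moreover have "0 \<le> gap_const \<rho> m T" by (rule gap_const_nonneg[OF \<rho>(1) m(1)])
      ultimately show ?thesis
        by (simp only: ennreal_mult' ennreal_plus powr_ge_zero mult_nonneg_nonneg add_nonneg_nonneg zero_le_one zero_le_numeral ennreal_1)
    qed
    also have "?Kp * (2 * ?E * (1 + ?Ch * dyadic_const \<kappa> T k) + ?F * (gap_const \<rho> m T * e powr \<rho>)) = error_const H r p T k m * ?E"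
    proof -
      have FE: "?F * e powr \<rho> = ?E" by (simp add: \<rho>_def mult.commute flip: powr_add)
      have "?Kp * (2 * ?E * (1 + ?Ch * dyadic_const \<kappa> T k) + ?F * (gap_const \<rho> m T * e powr \<rho>))
        = ?Kp * (2 * ?E * (1 + ?Ch * dyadic_const \<kappa> T k) + gap_const \<rho> m T * (?F * e powr \<rho>))"
        by (simp add: mult_ac)
      also have "\<dots> = ?Kp * (2 * (1 + ?Ch * dyadic_const \<kappa> T k) + gap_const \<rho> m T) * ?E"
        unfolding FE by (simp add: algebra_simps)
      finally show ?thesis
        by (simp add: error_const_def Let_def \<kappa>_def \<mu>_def cmax_def P_def \<rho>_def)
    qed
    finally show ?thesis .
  qed
  \<comment> \<open>The norm equals a supremum over countably many times on every path with finite
    \<open>dyadic_var\<close>, that is, almost surely; completeness of M then transfers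
    measurability.\<close>
  have meas: "(\<lambda>\<omega>. sup_norm T (D \<omega>) powr p) \<in> borel_measurable M"
  proof (rule complete_measure.borel_measurable_AE_eq[OF compl])
    let ?Q = "insert T (\<rat> \<inter> {0..T})"
    have "countable ?Q" by (simp add: countable_rat)
    moreover have "(\<lambda>\<omega>. D \<omega> q) \<in> borel_measurable M" if "q \<in> ?Q" for q
      unfolding D_def using that T by (intro borel_measurable_diff measurable_fbm_approx measurable_Lam H e) auto
    ultimately have "(\<lambda>\<omega>. SUP q\<in>?Q. ennreal \<bar>D \<omega> q\<bar>) \<in> borel_measurable M"
      by (intro borel_measurable_SUP) auto
    then show "(\<lambda>\<omega>. enn2real (SUP q\<in>?Q. ennreal \<bar>D \<omega> q\<bar>) powr p) \<in> borel_measurable M" by measurable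
    show "AE \<omega> in M. enn2real (SUP q\<in>?Q. ennreal \<bar>D \<omega> q\<bar>) powr p = sup_norm T (D \<omega>) powr p"
      using fin AE_space
    proof eventually_elim
      case (elim \<omega>)
      have "sup_norm T (D \<omega>) = enn2real (SUP q\<in>?Q. ennreal \<bar>D \<omega> q\<bar>)"
        unfolding D_def
        by (rule sup_norm_eq_rational_SUP[OF T bdd[OF elim(2,1), unfolded D_def]
            fbm_error_tendsto_right[OF H r(1) \<mu>(1,2) T e c(1) elim(2) L0 hold[OF elim(2,1)]]])
      then show ?case by simp
    qed
  qed
  show int: "integrable M (\<lambda>\<omega>. sup_norm T (D \<omega>) powr p)"
    using nn by (intro integrableI_bounded meas) (auto intro: le_less_trans)
  have "0 \<le> dyadic_const \<kappa> T k"
    using powr_less_mono[of "1 + 2 * real k * \<kappa> - real k" 0 2] kk T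
    by (auto simp: dyadic_const_def algebra_simps)
  then have "0 \<le> error_const H r p T k m * ?E"
    using gap_const_nonneg[OF \<rho>(1) m(1), of T] unfolding error_const_def Let_def \<rho>_def \<kappa>_def[symmetric]
    by (intro mult_nonneg_nonneg add_nonneg_nonneg) auto
  have "ennreal (\<integral>\<omega>. sup_norm T (D \<omega>) powr p \<partial>M) \<le> ennreal (error_const H r p T k m * ?E)"
    using nn int by (subst nn_integral_eq_integral[symmetric]) auto
  then show "(\<integral>\<omega>. sup_norm T (D \<omega>) powr p \<partial>M) \<le> error_const H r p T k m * ?E"
    using \<open>0 \<le> error_const H r p T k m * ?E\<close> by (subst (asm) ennreal_le_iff) auto
qed

end

theorem theorem3p1:
  fixes H p T \<delta> lam :: real
  assumes "0 < H" "H < 1/2" "1 \<le> p" "0 < T"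
    and "max 0 (1 - p * H / 2) < \<delta>" "\<delta> < 1"
    and "(1 - H) / 2 < lam" "lam < 1/2 + (2 * \<delta> - 2) / (2 * p)"
  shows "\<exists>C :: real. \<forall>(M :: 'a measure) (B :: real \<Rightarrow> 'a \<Rightarrow> real) (c :: real) (\<epsilon> :: nat \<Rightarrow> real).
     prob_space M \<and> complete_measure M \<and> brownian_motion M B \<and> fbm_constant M B T H c \<and>
     (\<forall>k\<ge>1. 0 < \<epsilon> k \<and> \<epsilon> (Suc k) \<le> \<epsilon> k) \<and> \<epsilon> \<longlonglongrightarrow> 0 \<longrightarrow>
     (\<forall>k\<ge>1.
        let D = (\<lambda>\<omega> t. fbm_approx c H T (\<epsilon> k) (\<lambda>s. B s \<omega>) t - Lam c H (\<lambda>s. B s \<omega>) t)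
        in (AE \<omega> in M. bdd_above ((\<lambda>t. \<bar>D \<omega> t\<bar>) ` {0..T})) \<and>
           integrable M (\<lambda>\<omega>. sup_norm T (D \<omega>) powr p) \<and>
           (\<integral>\<omega>. sup_norm T (D \<omega>) powr p \<partial>M)
             \<le> C * \<epsilon> k powr (p * (1 - 2 * lam) + 2 * (\<delta> - 1)))"
proof -
  \<comment> \<open>This is the claimed exponent divided by p. The upper bound on lam says that r is
    positive; the lower bound, together with \<delta> < 1, gives r < H.\<close>
  define r where "r = (1 - 2 * lam) + 2 * (\<delta> - 1) / p"
  have "(2 * \<delta> - 2) / (2 * p) = (\<delta> - 1) / p"
    using assms by (simp add: field_simps)
  then have "2 * lam < 1 + 2 * ((\<delta> - 1) / p)" using assms by linarith
  then have r0: "0 < r" by (simp add: r_def)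
  have "2 * (\<delta> - 1) / p < 0" using assms by (intro divide_neg_pos) auto
  moreover have "1 - H < 2 * lam" using assms(7) by simp
  ultimately have rH: "r < H" unfolding r_def by linarith
  have rp: "r * p = p * (1 - 2 * lam) + 2 * (\<delta> - 1)"
    using assms by (simp add: r_def field_simps)
  \<comment> \<open>The numerator 2 yields the strict inequality k (H - r) > 1 required for the
    moment of L; k >= p makes the order 2k of that moment at least 2p.\<close>
  define k where "k = nat \<lceil>max p (2 / (H - r))\<rceil>"
  \<comment> \<open>m > 2 makes the series over the gap scales converge, and m >= 2 r p allows
    passing from the power m of the step size to the power 2 r p.\<close>
  define m where "m = max 3 (nat \<lceil>2 * r * p\<rceil>)"
  have "max p (2 / (H - r)) \<le> real k" unfolding k_def by (rule real_nat_ceiling_ge)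
  then have k: "p \<le> real k" "2 / (H - r) \<le> real k" by auto
  then have "2 \<le> real k * (H - r)" using rH by (simp add: pos_divide_le_eq)
  then have k2: "1 < real k * (H - r)" by simp
  have m: "2 < m" "2 * r * p \<le> real m"
    using real_nat_ceiling_ge[of "2 * r * p"] by (auto simp: m_def)
  show ?thesis
  proof (rule exI[of _ "error_const H r p T k m"], intro allI impI, elim conjE)
    fix M :: "'a measure" and B :: "real \<Rightarrow> 'a \<Rightarrow> real" and c :: real and \<epsilon> :: "nat \<Rightarrow> real" and i :: nat
    assume M: "prob_space M" "complete_measure M" "brownian_motion M B" "fbm_constant M B T H c"
      and eps: "\<forall>k\<ge>1. 0 < \<epsilon> k \<and> \<epsilon> (Suc k) \<le> \<epsilon> k" and i: "1 \<le> i"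
    interpret prob_space M by fact
    interpret brownian M B by unfold_locales fact
    have e: "0 < \<epsilon> i" using eps i by blast
    note bound = fbm_error_moment_bound[OF M(2,4) assms(1,2,4,3) r0 rH e k(1) k2 m]
    show "let D = (\<lambda>\<omega> t. fbm_approx c H T (\<epsilon> i) (\<lambda>s. B s \<omega>) t - Lam c H (\<lambda>s. B s \<omega>) t)
        in (AE \<omega> in M. bdd_above ((\<lambda>t. \<bar>D \<omega> t\<bar>) ` {0..T})) \<and>
           integrable M (\<lambda>\<omega>. sup_norm T (D \<omega>) powr p) \<and>
           (\<integral>\<omega>. sup_norm T (D \<omega>) powr p \<partial>M)
             \<le> error_const H r p T k m * \<epsilon> i powr (p * (1 - 2 * lam) + 2 * (\<delta> - 1))"
      unfolding Let_def rp[symmetric] using bound by blast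
  qed
qed

end
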